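(* Let $r\geqslant 3$ and $C\in\mathbb{N}$, and let $H$ be a graph with $\chi(H)=r$ and $\delta_\chi(H)\geqslant\frac{2r-5}{2r-3}$. Then for every sufficiently small $\varepsilon>0$ the following holds: if $p=p(n)$ satisfies $n^{-\varepsilon}<p<\varepsilon^2$, then asymptotically almost surely the random graph $G=G_{n,p}$ contains an $H$-free subgraph $G'$ with $\chi(G')\geqslant C$ and $\delta(G')\geqslant(1-\varepsilon)\frac{r-2}{r-1}pn$.
   Context: $G_{n,p}$ is the Erdős–Rényi random graph on $n$ vertices in which each pair is an edge independently with probability $p$; "asymptotically almost surely" means with probability tending to $1$ as $n\to\infty$. A graph is $H$-free if it has no subgraph isomorphic to $H$. The chromatic threshold is $\delta_\chi(H)=\inf\{d : \exists\, C'$ such that every $H$-free graph $G$ on $n$ vertices with $\delta(G)\geqslant dn$ has $\chi(G)\leqslant C'\}$. *)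

theory Defs
  imports "HOL-Probability.Probability" "HOL-Library.Ramsey"
begin

text \<open>Edges are two-element sets of vertices.  Graphs are finite and have at least one vertex, so that
  the minimum degree is meaningful; in particular a subgraph is never the null graph.\<close>

type_synonym 'a graph = "'a set \<times> 'a set set"

abbreviation verts :: "'a graph \<Rightarrow> 'a set" where
  "verts G \<equiv> fst G"

abbreviation edges :: "'a graph \<Rightarrow> 'a set set" where
  "edges G \<equiv> snd G"

definition fin_graph :: "'a graph \<Rightarrow> bool" where
  "fin_graph G \<longleftrightarrow> finite (verts G) \<and> verts G \<noteq> {} \<and> edges G \<subseteq> [verts G]\<^bsup>2\<^esup>"

definition subgraph :: "'a graph \<Rightarrow> 'a graph \<Rightarrow> bool" where
  "subgraph F G \<longleftrightarrow> fin_graph F \<and> verts F \<subseteq> verts G \<and> edges F \<subseteq> edges G"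

definition isomorphic :: "'a graph \<Rightarrow> 'b graph \<Rightarrow> bool" where
  "isomorphic F G \<longleftrightarrow> (\<exists>f. bij_betw f (verts F) (verts G) \<and> (\<lambda>e. f ` e) ` edges F = edges G)"

definition free_of :: "'b graph \<Rightarrow> 'a graph \<Rightarrow> bool" where
  "free_of H G \<longleftrightarrow> \<not> (\<exists>F. subgraph F G \<and> isomorphic F H)"

definition degree :: "'a graph \<Rightarrow> 'a \<Rightarrow> nat" where
  "degree G v = card {e \<in> edges G. v \<in> e}"

definition min_degree :: "'a graph \<Rightarrow> nat" where
  "min_degree G = Min (degree G ` verts G)"

definition colourable :: "nat \<Rightarrow> 'a graph \<Rightarrow> bool" where
  "colourable k G \<longleftrightarrow>
     (\<exists>c :: 'a \<Rightarrow> nat. c ` verts G \<subseteq> {..<k} \<and> (\<forall>u v. {u, v} \<in> edges G \<longrightarrow> c u \<noteq> c v))"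

definition chromatic_number :: "'a graph \<Rightarrow> nat" where
  "chromatic_number G = (LEAST k. colourable k G)"

text \<open>Every finite graph is isomorphic to one with vertices in \<^typ>\<open>nat\<close>, so it suffices to let
  \<open>G\<close> range over those.  The infimum is over \<open>d \<ge> 0\<close>, which keeps the set bounded below: if \<open>H\<close>
  is a forest, then every negative \<open>d\<close> has the required property, too.  The set contains
  \<open>d = 1\<close>, since no graph \<open>G\<close> has minimum degree at least its number of vertices.\<close>

definition chromatic_threshold :: "'a graph \<Rightarrow> real" where
  "chromatic_threshold H = Inf {d. 0 \<le> d \<and>
     (\<exists>C'. \<forall>G :: nat graph. fin_graph G \<longrightarrow> free_of H G \<longrightarrow>
        real (min_degree G) \<ge> d * real (card (verts G)) \<longrightarrow> chromatic_number G \<le> C')}"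

text \<open>One independent Bernoulli variable for each pair of vertices in \<open>{0,\<dots>,n-1}\<close>.  The
  value \<^term>\<open>False\<close> is the default of \<^const>\<open>Pi_pmf\<close> outside the index set.\<close>

definition random_graph :: "nat \<Rightarrow> real \<Rightarrow> nat graph pmf" where
  "random_graph n p =
     map_pmf (\<lambda>X. ({..<n}, {e \<in> [{..<n}]\<^bsup>2\<^esup>. X e}))
       (Pi_pmf ([{..<n}]\<^bsup>2\<^esup>) False (\<lambda>_. bernoulli_pmf p))"

definition asymptotically_almost_surely ::
    "(nat \<Rightarrow> 'a pmf) \<Rightarrow> (nat \<Rightarrow> 'a \<Rightarrow> bool) \<Rightarrow> bool" where
  "asymptotically_almost_surely M P \<longleftrightarrow>
     (\<lambda>n. measure_pmf.prob (M n) {x. P n x}) \<longlonglongrightarrow> 1"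

end

theory Submission
  imports Defs "HOL-Real_Asymp.Real_Asymp"
begin

text \<open>
  Write \<open>k = r - 2\<close> and fix a graph \<open>\<Gamma>\<close> with large chromatic number all of whose subgraphs on at most
  \<open>|V(H)|\<close> vertices are forests.  Since \<open>p \<ge> n\<^sup>-\<^sup>\<epsilon>\<close>, the random graph contains a copy \<open>W\<close> of \<open>\<Gamma>\<close>.
  Split the vertices into \<open>k + 1\<close> equal parts \<open>V\<^sub>0, \<dots>, V\<^sub>k\<close>.  In \<open>G'\<close> keep the copy of \<open>\<Gamma>\<close>, the edges
  from \<open>W\<close> to those vertices of \<open>V\<^sub>0, \<dots>, V\<^bsub>k-1\<^esub>\<close> that have exactly one neighbour in \<open>W\<close>, and the edges between
  different parts whose ends do not both have neighbours in \<open>W\<close>.  As \<open>p < \<epsilon>\<^sup>2\<close> and codegrees are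
  \<open>O(p\<^sup>2 n)\<close>, the last two restrictions cost each vertex only a small proportion of its degree.

  If \<open>G'\<close> contained \<open>H\<close>, then \<open>H\<close> would consist of a forest \<open>X\<close> and a \<open>(k + 1)\<close>-coloured rest that is attached
  to \<open>X\<close> very sparsely.  For such \<open>H\<close> the chromatic threshold is at most
  \<open>1 - 1 / k < (2 r - 5) / (2 r - 3)\<close>, a contradiction: let \<open>G\<close> have minimum degree at least
  \<open>(1 - 1 / k + \<gamma>) n\<close>.  For a vertex \<open>u\<close> and a \<open>(k + 1)\<close>-tuple \<open>b\<close>, count the neighbours of \<open>u\<close> that are adjacent
  to all entries of \<open>b\<close> but the \<open>i\<close>-th.  These counts, as functions of \<open>i\<close> and \<open>b\<close>, form a totally bounded
  family in \<open>L\<^sup>1\<close>, uniformly in \<open>n\<close>, so the vertices split into boundedly many classes of vertices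
  with almost the same counts.  If the chromatic number is large, some class contains a copy of
  \<open>X\<close>; as its vertices have nearly equal counts, many \<open>(k + 1)\<close>-cliques \<open>b\<close> have large counts for all of
  them simultaneously, and supersaturation yields a copy of \<open>H\<close>.
\<close>

section \<open>Total boundedness by sampling\<close>

text \<open>Minimum degree above \<open>(1 - 1 / k) * n\<close> gives any \<open>k\<close> vertices
  common neighbours, but in general not \<open>k + 1\<close> of them. A
  \<open>(k + 1)\<close>-clique can thus be grown with \<open>k\<close> entries in the neighbourhood
  of a given vertex, but not with all. This dictates \<open>G'\<close>: the last part is cut off
  from \<open>W\<close>; an outside vertex sees at most one vertex of \<open>W\<close>, so that it
  has to suit a single vertex of the forest; and attached vertices are not joined to each other,
  since nothing is known about edges between two sets of replacements. No vertex pays more than one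
  part: those in \<open>W\<close> lose the last part, the others their own, whence the factor
  \<open>k / (k + 1) = (r - 2) / (r - 1)\<close>. Forests are within reach because a graph that is
  not \<open>m\<close>-colourable has a subgraph of minimum degree at least \<open>m\<close>, which
  contains every forest on \<open>m\<close> vertices. The number of classes must not depend on
  \<open>n\<close>, which excludes grouping vertices by their exact neighbourhoods and calls for
  averaged counts. \<open>\<Gamma>\<close> depends only on \<open>H\<close> and \<open>C\<close>,
  and \<open>\<epsilon>\<close> is chosen after it, so losses proportional to the size of
  \<open>\<Gamma>\<close> are harmless.\<close>

text \<open>The sample is chosen greedily: the cross terms vanish on average over the next sample point.\<close>

lemma balanced_sample:
  fixes y :: "'p \<Rightarrow> 'v \<Rightarrow> real"
  assumes V: "finite V" "V \<noteq> {}" and P: "finite P"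
    and zero: "\<And>p. p \<in> P \<Longrightarrow> (\<Sum>s\<in>V. y p s) = 0"
    and bd: "\<And>p s. p \<in> P \<Longrightarrow> s \<in> V \<Longrightarrow> \<bar>y p s\<bar> \<le> 1"
  shows "\<exists>s. (\<forall>i<q. s i \<in> V) \<and> (\<Sum>p\<in>P. (\<Sum>i<q. y p (s i))\<^sup>2) \<le> real q * real (card P)"
proof (induction q)
  case 0
  then show ?case by simp
next
  case (Suc q)
  then obtain s where sV: "\<forall>i<q. s i \<in> V"
    and s: "(\<Sum>p\<in>P. (\<Sum>i<q. y p (s i))\<^sup>2) \<le> real q * real (card P)" by blast
  define a where "a p = (\<Sum>i<q. y p (s i))" for p
  have "(\<Sum>x\<in>V. \<Sum>p\<in>P. (a p + y p x)\<^sup>2) = (\<Sum>p\<in>P. \<Sum>x\<in>V. (a p + y p x)\<^sup>2)"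
    by (rule sum.swap)
  also have "\<dots> = (\<Sum>p\<in>P. card V * (a p)\<^sup>2 + (\<Sum>x\<in>V. (y p x)\<^sup>2))"
  proof (rule sum.cong)
    fix p assume "p \<in> P"
    have "(\<Sum>x\<in>V. (a p + y p x)\<^sup>2) = (\<Sum>x\<in>V. (a p)\<^sup>2 + 2 * a p * y p x + (y p x)\<^sup>2)"
      by (simp add: power2_sum algebra_simps)
    also have "\<dots> = card V * (a p)\<^sup>2 + (\<Sum>x\<in>V. (y p x)\<^sup>2)"
      by (simp add: sum.distrib zero[OF \<open>p \<in> P\<close>] flip: sum_distrib_left)
    finally show "(\<Sum>x\<in>V. (a p + y p x)\<^sup>2) = card V * (a p)\<^sup>2 + (\<Sum>x\<in>V. (y p x)\<^sup>2)" .
  qed simp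
  also have "\<dots> \<le> (\<Sum>p\<in>P. card V * (a p)\<^sup>2 + card V)"
  proof (intro sum_mono add_left_mono)
    fix p assume "p \<in> P"
    have "(\<Sum>x\<in>V. (y p x)\<^sup>2) \<le> (\<Sum>x\<in>V. 1)"
      by (intro sum_mono) (use bd[OF \<open>p \<in> P\<close>] in \<open>simp add: abs_square_le_1\<close>)
    then show "(\<Sum>x\<in>V. (y p x)\<^sup>2) \<le> card V" by simp
  qed
  also have "\<dots> = card V * ((\<Sum>p\<in>P. (a p)\<^sup>2) + card P)"
    by (simp add: sum.distrib sum_distrib_left algebra_simps)
  also have "\<dots> \<le> card V * (real q * card P + card P)"
    using s by (intro mult_left_mono) (auto simp: a_def)
  finally have le: "(\<Sum>x\<in>V. \<Sum>p\<in>P. (a p + y p x)\<^sup>2) \<le> card V * (real (Suc q) * card P)"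
    by (simp add: algebra_simps)
  have "\<exists>x\<in>V. (\<Sum>p\<in>P. (a p + y p x)\<^sup>2) \<le> real (Suc q) * card P"
  proof (rule ccontr)
    assume "\<not> ?thesis"
    then have "(\<Sum>x\<in>V. real (Suc q) * card P) < (\<Sum>x\<in>V. \<Sum>p\<in>P. (a p + y p x)\<^sup>2)"
      by (intro sum_strict_mono V) (simp add: not_le)
    with le show False by simp
  qed
  then obtain x where x: "x \<in> V" "(\<Sum>p\<in>P. (a p + y p x)\<^sup>2) \<le> real (Suc q) * card P" by blast
  have "(\<Sum>i<Suc q. y p ((s(q := x)) i)) = a p + y p x" for p
    by (simp add: a_def)
  with x sV show ?case
    by (intro exI[of _ "s(q := x)"]) (auto simp: less_Suc_eq)
qed

text \<open>A common sample approximates \<open>g u\<close> well for half of all \<open>u\<close> in \<open>D\<close>, and the approximation depends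
  only on the trace of \<open>N u\<close> on the sample, for which there are \<open>2 ^ q\<close> possibilities.\<close>

lemma separated_family_bound:
  fixes V :: "'v set" and \<kappa> :: "'v \<Rightarrow> 'z \<Rightarrow> real" and N :: "'u \<Rightarrow> 'v set" and \<delta> :: real
  defines "g \<equiv> \<lambda>u z. \<Sum>s\<in>V \<inter> N u. \<kappa> s z"
  assumes V: "finite V" "V \<noteq> {}" and Z: "finite Z" and D: "finite D"
    and \<kappa>: "\<And>s z. 0 \<le> \<kappa> s z \<and> \<kappa> s z \<le> 1"
    and sep: "\<And>u v. u \<in> D \<Longrightarrow> v \<in> D \<Longrightarrow> u \<noteq> v \<Longrightarrow> \<delta> * card V * card Z < (\<Sum>z\<in>Z. \<bar>g u z - g v z\<bar>)"
    and q: "8 \<le> \<delta>\<^sup>2 * real q" "\<delta> > 0"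
  shows "card D \<le> 2 * 2 ^ q"
proof (rule ccontr)
  assume "\<not> ?thesis"
  then have big: "card D > 2 * 2 ^ q" by simp
  define n where "n = real (card V)"
  have n0: "n > 0" using V by (simp add: n_def card_gt_0_iff)
  have q0: "q > 0" using q by (cases q) auto
  \<comment> \<open>The contribution of \<open>s\<close> to \<open>g u z\<close> minus its mean over
    \<open>V\<close>. A sample sum of \<open>y (u,z)\<close> is therefore the sampling error at
    \<open>u\<close> and \<open>z\<close>.\<close>
  define y where "y = (\<lambda>(u,z) s. (if s \<in> N u then \<kappa> s z else 0) - g u z / n)"
  have g01: "0 \<le> g u z \<and> g u z \<le> n" for u z
  proof -
    have "g u z \<le> (\<Sum>s\<in>V \<inter> N u. 1)" unfolding g_def by (intro sum_mono) (use \<kappa> in auto)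
    also have "\<dots> \<le> n" using V by (simp add: n_def card_mono)
    finally show ?thesis unfolding g_def using \<kappa> by (auto intro: sum_nonneg)
  qed
  have "\<exists>s. (\<forall>i<q. s i \<in> V) \<and> (\<Sum>p\<in>D\<times>Z. (\<Sum>i<q. y p (s i))\<^sup>2) \<le> real q * real (card (D\<times>Z))"
  proof (rule balanced_sample)
    fix p assume "p \<in> D \<times> Z"
    obtain u z where p: "p = (u,z)" by force
    have "(\<Sum>s\<in>V. if s \<in> N u then \<kappa> s z else 0) = g u z"
      unfolding g_def using V by (simp add: sum.inter_restrict)
    then show "(\<Sum>s\<in>V. y p s) = 0"
      using n0 V by (simp add: y_def p sum_subtractf n_def)
    fix s assume "s \<in> V"
    have "0 \<le> g u z / n" "g u z / n \<le> 1"
      using g01[of u z] n0 by auto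
    then show "\<bar>y p s\<bar> \<le> 1"
      using \<kappa>[of s z] by (auto simp: y_def p abs_le_iff)
  qed (use V Z D in auto)
  then obtain s where sV: "\<forall>i<q. s i \<in> V"
    and s: "(\<Sum>p\<in>D\<times>Z. (\<Sum>i<q. y p (s i))\<^sup>2) \<le> real q * real (card (D\<times>Z))" by blast
  define err where "err u = (\<Sum>z\<in>Z. (\<Sum>i<q. y (u,z) (s i))\<^sup>2)" for u
  have err: "(\<Sum>u\<in>D. err u) \<le> real q * card Z * card D"
    using s by (simp add: err_def sum.cartesian_product card_cartesian_product mult_ac)
  \<comment> \<open>The mean of \<open>err\<close> over \<open>D\<close> is at most
    \<open>q * card Z\<close>, and at most half of \<open>D\<close> can exceed twice that, so more
    than \<open>2 ^ q\<close> members survive.\<close>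
  define D' where "D' = {u\<in>D. err u \<le> 2 * real q * card Z}"
  have err0: "err u \<ge> 0" for u by (auto simp: err_def intro: sum_nonneg)
  have "card D \<le> 2 * card D'"
  proof (cases "card Z = 0")
    case True
    then have "D' = D" using Z by (auto simp: D'_def err_def)
    then show ?thesis by simp
  next
    case False
    have "(\<Sum>u\<in>D - D'. 2 * real q * card Z) \<le> (\<Sum>u\<in>D - D'. err u)"
      by (rule sum_mono) (auto simp: D'_def)
    also have "\<dots> \<le> (\<Sum>u\<in>D. err u)"
      by (rule sum_mono2) (use D err0 in auto)
    finally have "real (card (D - D')) * (2 * real q * card Z) \<le> real q * card Z * card D"
      using err by simp
    then have "real q * card Z * (2 * card (D - D')) \<le> real q * card Z * card D"
      by (simp add: mult_ac)
    then have "2 * card (D - D') \<le> card D"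
      using False q0 by (subst (asm) mult_le_cancel_left_pos) auto
    moreover have "card (D - D') = card D - card D'"
      by (intro card_Diff_subset) (use D in \<open>auto simp: D'_def\<close>)
    moreover have "card D' \<le> card D" by (intro card_mono) (use D in \<open>auto simp: D'_def\<close>)
    ultimately show ?thesis by linarith
  qed
  then have "2 ^ q < card D'" using big by linarith
  moreover have "card ((\<lambda>u. {i. i < q \<and> s i \<in> N u}) ` D') \<le> card (Pow {..<q})"
    by (intro card_mono) auto
  ultimately have "card ((\<lambda>u. {i. i < q \<and> s i \<in> N u}) ` D') < card D'"
    by (simp add: card_Pow)
  then have "\<not> inj_on (\<lambda>u. {i. i < q \<and> s i \<in> N u}) D'"
    by (rule pigeonhole)
  then obtain u v where uv: "u \<in> D'" "v \<in> D'" "u \<noteq> v"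
      "{i. i < q \<and> s i \<in> N u} = {i. i < q \<and> s i \<in> N v}"
    unfolding inj_on_def by blast
  \<comment> \<open>Equal traces give equal sampled sums; these cancel and leave only the two
    errors.\<close>
  have diff: "q / n * (g u z - g v z) = (\<Sum>i<q. y (v,z) (s i)) - (\<Sum>i<q. y (u,z) (s i))" for z
  proof -
    have "(\<Sum>i<q. if s i \<in> N u then \<kappa> (s i) z else 0) = (\<Sum>i<q. if s i \<in> N v then \<kappa> (s i) z else 0)"
      by (rule sum.cong) (use uv(4) in auto)
    then show ?thesis by (simp add: y_def sum_subtractf right_diff_distrib)
  qed
  have "(\<Sum>z\<in>Z. (q / n * (g u z - g v z))\<^sup>2) \<le>
        (\<Sum>z\<in>Z. 2 * (\<Sum>i<q. y (v,z) (s i))\<^sup>2 + 2 * (\<Sum>i<q. y (u,z) (s i))\<^sup>2)"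
  proof (rule sum_mono)
    fix z
    have "(a - b)\<^sup>2 \<le> 2 * a\<^sup>2 + 2 * b\<^sup>2" for a b :: real
      using zero_le_power2[of "a + b"] by (simp add: power2_eq_square algebra_simps)
    then show "(q / n * (g u z - g v z))\<^sup>2 \<le> 2 * (\<Sum>i<q. y (v,z) (s i))\<^sup>2 + 2 * (\<Sum>i<q. y (u,z) (s i))\<^sup>2"
      unfolding diff .
  qed
  also have "\<dots> = 2 * err v + 2 * err u"
    by (simp add: err_def sum.distrib sum_distrib_left)
  also have "\<dots> \<le> 8 * real q * card Z"
    using uv by (auto simp: D'_def)
  finally have "(q / n)\<^sup>2 * (\<Sum>z\<in>Z. (g u z - g v z)\<^sup>2) \<le> 8 * real q * card Z"
    unfolding power_mult_distrib sum_distrib_left .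
  then have sq: "real q * (real q * (\<Sum>z\<in>Z. (g u z - g v z)\<^sup>2)) \<le> real q * (8 * card Z * n\<^sup>2)"
    using n0 by (simp add: power_divide field_simps power2_eq_square)
  then have sq: "real q * (\<Sum>z\<in>Z. (g u z - g v z)\<^sup>2) \<le> 8 * card Z * n\<^sup>2"
    using q0 by (subst (asm) mult_le_cancel_left_pos) auto
  have "(\<Sum>z\<in>Z. \<bar>g u z - g v z\<bar>)\<^sup>2 \<le> card Z * (\<Sum>z\<in>Z. (g u z - g v z)\<^sup>2)"
    using Cauchy_Schwarz_ineq_sum[of "\<lambda>_. 1" "\<lambda>z. \<bar>g u z - g v z\<bar>" Z] by simp
  then have "real q * (\<Sum>z\<in>Z. \<bar>g u z - g v z\<bar>)\<^sup>2 \<le> card Z * (real q * (\<Sum>z\<in>Z. (g u z - g v z)\<^sup>2))"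
    using q0 by (simp add: mult.left_commute)
  also have "\<dots> \<le> card Z * (8 * card Z * n\<^sup>2)"
    using sq by (intro mult_left_mono) auto
  \<comment> \<open>The 8 is 2 * 2 + 2 * 2: squaring a difference costs a factor 2 for each of the
    two errors, and each error is at most twice the bound on the mean.\<close>
  also have "\<dots> \<le> (\<delta>\<^sup>2 * real q) * (card Z * n)\<^sup>2"
    using mult_right_mono[OF q(1) zero_le_power2[of "card Z * n"]] by (simp add: power2_eq_square mult_ac)
  finally have "real q * (\<Sum>z\<in>Z. \<bar>g u z - g v z\<bar>)\<^sup>2 \<le> real q * (\<delta> * n * card Z)\<^sup>2"
    by (simp add: power_mult_distrib mult_ac)
  then have "(\<Sum>z\<in>Z. \<bar>g u z - g v z\<bar>)\<^sup>2 \<le> (\<delta> * n * card Z)\<^sup>2"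
    using q0 by (subst (asm) mult_le_cancel_left_pos) auto
  then have "(\<Sum>z\<in>Z. \<bar>g u z - g v z\<bar>) \<le> \<delta> * n * card Z"
    by (rule power2_le_imp_le) (use n0 q in auto)
  moreover have "\<delta> * n * card Z < (\<Sum>z\<in>Z. \<bar>g u z - g v z\<bar>)"
    using sep[of u v] uv by (auto simp: D'_def n_def)
  ultimately show False by simp
qed

text \<open>A maximal \<open>\<delta>\<close>-separated subset of \<open>U\<close> is a
  \<open>\<delta>\<close>-net. Its size is bounded in terms of \<open>q\<close> alone, whatever
  \<open>V\<close>, \<open>Z\<close> and \<open>U\<close> are; this makes the number of classes
  independent of the graph.\<close>

lemma bounded_net:
  fixes V :: "'v set" and \<kappa> :: "'v \<Rightarrow> 'z \<Rightarrow> real" and N :: "'u \<Rightarrow> 'v set" and \<delta> :: real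
  defines "g \<equiv> \<lambda>u z. \<Sum>s\<in>V \<inter> N u. \<kappa> s z"
  assumes V: "finite V" "V \<noteq> {}" and Z: "finite Z" and U: "finite U"
    and \<kappa>: "\<And>s z. 0 \<le> \<kappa> s z \<and> \<kappa> s z \<le> 1"
    and q: "8 \<le> \<delta>\<^sup>2 * real q" "\<delta> > 0"
  shows "\<exists>D\<subseteq>U. card D \<le> 2 * 2 ^ q \<and>
    (\<forall>u\<in>U. \<exists>v\<in>D. (\<Sum>z\<in>Z. \<bar>g u z - g v z\<bar>) \<le> \<delta> * card V * card Z)"
proof -
  define sep where "sep D \<longleftrightarrow> (\<forall>u\<in>D. \<forall>v\<in>D. u \<noteq> v \<longrightarrow> \<delta> * card V * card Z < (\<Sum>z\<in>Z. \<bar>g u z - g v z\<bar>))" for D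
  have "\<exists>D. (D \<subseteq> U \<and> sep D) \<and> (\<forall>D'. D' \<subseteq> U \<and> sep D' \<longrightarrow> card D' \<le> card D)"
    by (rule ex_has_greatest_nat[where k = "{}" and b = "Suc (card U)"])
       (auto simp: sep_def less_Suc_eq_le card_mono[OF U])
  then obtain D where D: "D \<subseteq> U" "sep D" and max: "\<And>D'. D' \<subseteq> U \<Longrightarrow> sep D' \<Longrightarrow> card D' \<le> card D"
    by blast
  have fD: "finite D" using D U finite_subset by blast
  have "card D \<le> 2 * 2 ^ q"
    by (rule separated_family_bound[where V = V and Z = Z and \<kappa> = \<kappa> and N = N and \<delta> = \<delta>])
       (use V Z fD \<kappa> q D in \<open>auto simp: sep_def g_def\<close>)
  moreover have "\<exists>v\<in>D. (\<Sum>z\<in>Z. \<bar>g u z - g v z\<bar>) \<le> \<delta> * card V * card Z" if u: "u \<in> U" for u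
  proof (rule ccontr)
    assume neg: "\<not> ?thesis"
    then have *: "\<delta> * card V * card Z < (\<Sum>z\<in>Z. \<bar>g u z - g v z\<bar>)" if "v \<in> D" for v
      using that by force
    have "u \<notin> D"
    proof
      assume "u \<in> D"
      from *[OF this] show False using q by (simp add: mult_less_0_iff)
    qed
    moreover have "sep (insert u D)"
      using D(2) * unfolding sep_def by (auto simp: abs_minus_commute)
    ultimately show False using max[of "insert u D"] u D fD by simp
  qed
  ultimately show ?thesis using D by blast
qed

section \<open>Boxes in dense relations\<close>

text \<open>Double counting twice. A point of \<open>V\<close> lies on average in a proportion
  \<open>c\<close> of the sets, so many points lie in a proportion \<open>c / 2\<close>. Fix
  \<open>M\<close> of these, a bounded number: a proportion \<open>c / 4\<close> of the sets contain
  \<open>t\<close> of them, and pigeonhole over at most \<open>2 ^ M\<close> subsets yields one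
  \<open>T\<close>.\<close>

lemma dense_common_subset:
  fixes c :: real
  assumes c: "c > 0"
  shows "\<exists>c'>0::real. \<exists>M. \<forall>(V::'v set) (B::'b set) S. finite V \<longrightarrow> M \<le> card V \<longrightarrow> finite B \<longrightarrow>
     (\<forall>b\<in>B. S b \<subseteq> V \<and> c * card V \<le> card (S b)) \<longrightarrow>
     (\<exists>T\<subseteq>V. card T = t \<and> c' * card B \<le> card {b\<in>B. T \<subseteq> S b})"
proof -
  \<comment> \<open>Makes \<open>t \<le> c * M / 4\<close>, so that sets with fewer than
    \<open>t\<close> of the \<open>M\<close> points use up at most half of the average
    \<open>c * M / 2\<close>. The \<open>+ 1\<close> forces \<open>M > 0\<close>.\<close>
  define M where "M = nat \<lceil>4 * (real t + 1) / c\<rceil>"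
  have M: "4 * (real t + 1) \<le> c * M"
  proof -
    have "4 * (real t + 1) / c \<le> M" unfolding M_def by linarith
    then show ?thesis using c by (simp add: field_simps)
  qed
  then have M0: "M > 0" by (cases M) auto
  define c' where "c' = c / 4 / 2 ^ M"
  have main: "\<exists>T\<subseteq>V. card T = t \<and> c' * card B \<le> card {b\<in>B. T \<subseteq> S b}"
    if V: "finite V" "nat \<lceil>2 * M / c\<rceil> + t \<le> card V" and B: "finite B"
      and S: "\<And>b. b \<in> B \<Longrightarrow> S b \<subseteq> V \<and> c * card V \<le> card (S b)"
    for V :: "'v set" and B :: "'b set" and S
  proof (cases "B = {}")
    case True
    \<comment> \<open>Without sets any \<open>t\<close> points will do; the summand \<open>t\<close>
      in the lower bound on \<open>card V\<close> provides them.\<close>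
    have "t \<le> card V" using V(2) by linarith
    then obtain T where "T \<subseteq> V" "card T = t" by (rule obtain_subset_with_card_n)
    then show ?thesis using True by auto
  next
    case False
    then have B0: "card B > 0" using B by (simp add: card_gt_0_iff)
    define w where "w x = card {b\<in>B. x \<in> S b}" for x
    have wB: "w x \<le> card B" for x unfolding w_def by (intro card_mono) (use B in auto)
    define X where "X = {x\<in>V. c / 2 * card B \<le> w x}"
    have "c * card V * card B = (\<Sum>b\<in>B. c * card V)" by simp
    also have "\<dots> \<le> (\<Sum>b\<in>B. real (card {x\<in>V. x \<in> S b}))"
    proof (rule sum_mono)
      fix b assume "b \<in> B"
      then have "{x\<in>V. x \<in> S b} = S b" "c * card V \<le> card (S b)" using S by auto
      then show "c * card V \<le> card {x\<in>V. x \<in> S b}" by simp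
    qed
    also have "\<dots> = real (\<Sum>b\<in>B. card {x\<in>V. x \<in> S b})" by simp
    also have "(\<Sum>b\<in>B. card {x\<in>V. x \<in> S b}) = (\<Sum>x\<in>V. w x)"
      unfolding w_def by (rule sum_multicount_gen) (use B V in auto)
    also have "(\<Sum>x\<in>V. w x) = (\<Sum>x\<in>X. w x) + (\<Sum>x\<in>V - X. w x)"
      using sum.subset_diff[of X V w] V by (auto simp: X_def)
    also have "real \<dots> \<le> (\<Sum>x\<in>X. real (card B)) + (\<Sum>x\<in>V - X. c / 2 * card B)"
      unfolding of_nat_add of_nat_sum
      by (intro add_mono sum_mono) (use wB in \<open>auto simp: X_def\<close>)
    also have "\<dots> \<le> card X * real (card B) + card V * (c / 2 * card B)"
      using c V by (auto intro!: mult_right_mono card_mono)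
    finally have "card B * (c / 2 * card V) \<le> card B * real (card X)"
      by (simp add: algebra_simps)
    then have "c / 2 * card V \<le> card X" using B0 by simp
    moreover have "2 * M / c \<le> card V" using V(2) by linarith
    ultimately have "M \<le> card X" using c by (simp add: field_simps)
    then obtain Y where Y: "Y \<subseteq> X" "card Y = M" "finite Y"
      by (rule obtain_subset_with_card_n)
    define h where "h b = card {x\<in>Y. x \<in> S b}" for b
    have hM: "h b \<le> M" for b unfolding h_def Y(2)[symmetric] by (intro card_mono) (use Y in auto)
    define B' where "B' = {b\<in>B. t \<le> h b}"
    have "M * (c / 2 * card B) = (\<Sum>x\<in>Y. c / 2 * card B)" using Y by simp
    also have "\<dots> \<le> (\<Sum>x\<in>Y. real (w x))"
      by (rule sum_mono) (use Y in \<open>auto simp: X_def\<close>)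
    also have "\<dots> = real (\<Sum>x\<in>Y. w x)" by simp
    also have "(\<Sum>x\<in>Y. w x) = (\<Sum>b\<in>B. h b)"
      unfolding w_def h_def by (rule sum_multicount_gen) (use B Y in auto)
    also have "\<dots> = (\<Sum>b\<in>B'. h b) + (\<Sum>b\<in>B - B'. h b)"
      using sum.subset_diff[of B' B h] B by (auto simp: B'_def)
    also have "real \<dots> \<le> (\<Sum>b\<in>B'. real M) + (\<Sum>b\<in>B - B'. real t)"
      unfolding of_nat_add of_nat_sum
      by (intro add_mono sum_mono) (use hM in \<open>auto simp: B'_def\<close>)
    also have "\<dots> \<le> card B' * real M + card B * real t"
      using B by (auto intro!: mult_right_mono card_mono)
    finally have "M * (c / 2 * card B) \<le> card B' * real M + card B * real t" .
    moreover have "card B * real t \<le> M * (c / 4 * card B)"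
      using mult_right_mono[OF M, of "card B"] by (simp add: algebra_simps)
    ultimately have "M * (c / 4 * card B) \<le> M * real (card B')" by (simp add: algebra_simps)
    then have B': "c / 4 * card B \<le> card B'" using M0 by simp
    define P where "P = {T. T \<subseteq> Y \<and> card T = t}"
    have fP: "finite P" using Y by (auto simp: P_def)
    have "card P \<le> card (Pow Y)" by (intro card_mono) (use Y in \<open>auto simp: P_def\<close>)
    then have cP: "card P \<le> 2 ^ M" using Y by (simp add: card_Pow)
    have "B' \<subseteq> (\<Union>T\<in>P. {b\<in>B. T \<subseteq> S b})"
    proof
      fix b assume b: "b \<in> B'"
      then obtain T where "T \<subseteq> {x\<in>Y. x \<in> S b}" "card T = t"
        using obtain_subset_with_card_n[of t "{x\<in>Y. x \<in> S b}"] unfolding B'_def h_def by blast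
      then show "b \<in> (\<Union>T\<in>P. {b\<in>B. T \<subseteq> S b})" using b by (auto simp: P_def B'_def)
    qed
    then have "card B' \<le> card (\<Union>T\<in>P. {b\<in>B. T \<subseteq> S b})"
      by (intro card_mono) (use B fP in auto)
    also have "\<dots> \<le> (\<Sum>T\<in>P. card {b\<in>B. T \<subseteq> S b})" by (rule card_UN_le[OF fP])
    finally have sum: "real (card B') \<le> (\<Sum>T\<in>P. real (card {b\<in>B. T \<subseteq> S b}))" by (simp flip: of_nat_sum)
    have "\<exists>T\<in>P. c' * card B \<le> card {b\<in>B. T \<subseteq> S b}"
    proof (rule ccontr)
      assume neg: "\<not> ?thesis"
      have "P \<noteq> {}" using sum B' B0 c by (cases "P = {}") (auto simp: mult_le_0_iff)
      then have "(\<Sum>T\<in>P. real (card {b\<in>B. T \<subseteq> S b})) < (\<Sum>T\<in>P. c' * card B)"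
        by (intro sum_strict_mono) (use fP neg in \<open>auto simp: not_le\<close>)
      also have "\<dots> \<le> 2 ^ M * (c' * card B)"
      proof -
        have "real (card P) \<le> 2 ^ M" using cP by (metis of_nat_le_iff of_nat_numeral of_nat_power)
        then show ?thesis unfolding sum_constant using c by (intro mult_right_mono) (auto simp: c'_def)
      qed
      also have "\<dots> = c / 4 * card B" by (simp add: c'_def)
      finally show False using B' sum by simp
    qed
    then show ?thesis using Y by (auto simp: P_def X_def)
  qed
  have "c' > 0" using c by (simp add: c'_def)
  show ?thesis
  proof (rule exI[of _ c'], rule conjI)
    show "\<exists>M. \<forall>(V::'v set) (B::'b set) S. finite V \<longrightarrow> M \<le> card V \<longrightarrow> finite B \<longrightarrow>
      (\<forall>b\<in>B. S b \<subseteq> V \<and> c * card V \<le> card (S b)) \<longrightarrow>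
      (\<exists>T\<subseteq>V. card T = t \<and> c' * card B \<le> card {b\<in>B. T \<subseteq> S b})"
      by (rule exI[of _ "nat \<lceil>2 * M / c\<rceil> + t"], intro allI impI, rule main) (assumption | erule (1) bspec)+
  qed fact
qed

lemma card_PiE_const: "finite I \<Longrightarrow> card (PiE I (\<lambda>_. V)) = card V ^ card I"
  by (simp add: card_PiE)

lemma sum_fibres:
  assumes "finite V" "finite I" "i \<notin> I" "R \<subseteq> PiE (insert i I) (\<lambda>_. V)"
  shows "card R = (\<Sum>y\<in>PiE I (\<lambda>_. V). card {x\<in>V. y(i := x) \<in> R})"
proof -
  have "bij_betw (\<lambda>(y,x). y(i := x)) (SIGMA y:PiE I (\<lambda>_. V). {x\<in>V. y(i := x) \<in> R}) R"
  proof (rule bij_betw_imageI)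
    show "inj_on (\<lambda>(y,x). y(i := x)) (SIGMA y:PiE I (\<lambda>_. V). {x\<in>V. y(i := x) \<in> R})"
    proof (rule inj_onI, clarify)
      fix y x y' x' assume y: "y \<in> PiE I (\<lambda>_. V)" "y' \<in> PiE I (\<lambda>_. V)" "y(i := x) = y'(i := x')"
      then have "y j = y' j" for j
      proof (cases "j = i")
        case True
        then show ?thesis using assms(3) PiE_arb[OF y(1)] PiE_arb[OF y(2)] by simp
      next
        case False
        have "(y(i := x)) j = (y'(i := x')) j" by (simp only: y(3))
        then show ?thesis using False by simp
      qed
      moreover from y(3) have "x = x'" by (metis fun_upd_same)
      ultimately show "y = y' \<and> x = x'" by auto
    qed
    show "(\<lambda>(y,x). y(i := x)) ` (SIGMA y:PiE I (\<lambda>_. V). {x\<in>V. y(i := x) \<in> R}) = R"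
    proof safe
      fix f assume f: "f \<in> R"
      then have f': "f \<in> PiE (insert i I) (\<lambda>_. V)" using assms by blast
      \<comment> \<open>Members of \<open>PiE I\<close> are \<open>undefined\<close> outside
        \<open>I\<close>, so resetting coordinate \<open>i\<close> recovers the base point of the
        fibre.\<close>
      have "f(i := undefined) \<in> PiE I (\<lambda>_. V)" "f i \<in> V" "(f(i := undefined))(i := f i) = f"
        using f' assms(3) by (auto simp: PiE_iff extensional_def)
      then show "f \<in> (\<lambda>(y,x). y(i := x)) ` (SIGMA y:PiE I (\<lambda>_. V). {x\<in>V. y(i := x) \<in> R})"
        using f by (intro image_eqI[of _ _ "(f(i := undefined), f i)"]) auto
    qed
  qed
  then have "card R = card (SIGMA y:PiE I (\<lambda>_. V). {x\<in>V. y(i := x) \<in> R})"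
    by (simp add: bij_betw_same_card)
  then show ?thesis using assms by (simp add: finite_PiE)
qed

text \<open>Erdos's box theorem for dense relations, by induction on \<open>I\<close>. By averaging,
  a proportion \<open>c / 2\<close> of the partial tuples have a fibre of density at least
  \<open>c / 2\<close>. \<open>dense_common_subset\<close> finds \<open>t\<close> values of
  coordinate \<open>i\<close> common to the fibres of a positive proportion of these, and the
  induction hypothesis applies to the partial tuples that remain.\<close>

lemma dense_box:
  fixes c :: real
  assumes "finite I" "c > 0"
  shows "\<exists>M. \<forall>(V::'v set) R. finite V \<longrightarrow> M \<le> card V \<longrightarrow> R \<subseteq> PiE I (\<lambda>_. V) \<longrightarrow> c * real (card V) ^ card I \<le> card R \<longrightarrow>
    (\<exists>T. (\<forall>i\<in>I. T i \<subseteq> V \<and> card (T i) = t) \<and> PiE I T \<subseteq> R)"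
  using assms
proof (induction I arbitrary: c rule: finite_induct)
  case empty
  have "R = {\<lambda>_. undefined}" if "R \<subseteq> PiE {} (\<lambda>_. V)" "c \<le> card R" for V :: "'v set" and R
    using that empty by (cases "R = {}") auto
  then show ?case by (intro exI[of _ 0]) auto
next
  case (insert i I)
  from insert.prems have "c / 2 > 0" by simp
  from dense_common_subset[OF this, where t = t] obtain c' :: real and M1 where c': "c' > 0" and
    step: "\<forall>(V::'v set) (B::('a \<Rightarrow> 'v) set) S. finite V \<longrightarrow> M1 \<le> card V \<longrightarrow> finite B \<longrightarrow>
     (\<forall>b\<in>B. S b \<subseteq> V \<and> c / 2 * card V \<le> card (S b)) \<longrightarrow>
     (\<exists>T\<subseteq>V. card T = t \<and> c' * card B \<le> card {b\<in>B. T \<subseteq> S b})"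
    by (elim exE conjE) (rule that)
  have "c' * (c / 2) > 0" using c' insert.prems by simp
  from insert.IH[OF this] obtain M2 where
    IH: "\<forall>(V::'v set) R. finite V \<longrightarrow> M2 \<le> card V \<longrightarrow> R \<subseteq> PiE I (\<lambda>_. V) \<longrightarrow> c' * (c / 2) * real (card V) ^ card I \<le> card R \<longrightarrow>
    (\<exists>T. (\<forall>i\<in>I. T i \<subseteq> V \<and> card (T i) = t) \<and> PiE I T \<subseteq> R)" by (elim exE) (rule that)
  have main: "\<exists>T. (\<forall>j\<in>insert i I. T j \<subseteq> V \<and> card (T j) = t) \<and> PiE (insert i I) T \<subseteq> R"
    if V: "finite V" "M1 + M2 + 1 \<le> card V" and R: "R \<subseteq> PiE (insert i I) (\<lambda>_. V)"
      "c * real (card V) ^ card (insert i I) \<le> card R"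
    for V :: "'v set" and R
  proof -
    define n where "n = real (card V)"
    have n0: "n > 0" using V by (simp add: n_def)
    define S where "S y = {x\<in>V. y(i := x) \<in> R}" for y
    define \<Omega> where "\<Omega> = PiE I (\<lambda>_. V)"
    have f\<Omega>: "finite \<Omega>" using V insert by (simp add: \<Omega>_def finite_PiE)
    have c\<Omega>: "real (card \<Omega>) = n ^ card I" using insert by (simp add: \<Omega>_def card_PiE_const n_def)
    define B where "B = {y\<in>\<Omega>. c / 2 * n \<le> card (S y)}"
    have Sn: "real (card (S y)) \<le> n" for y unfolding n_def S_def using V by (simp add: card_mono)
    have "c * n ^ Suc (card I) \<le> card R" using R insert by (simp add: n_def)
    also have "real (card R) = (\<Sum>y\<in>\<Omega>. real (card (S y)))"
      using sum_fibres[OF V(1) insert.hyps(1,2) R(1)] by (simp add: S_def \<Omega>_def)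
    also have "\<dots> = (\<Sum>y\<in>B. real (card (S y))) + (\<Sum>y\<in>\<Omega> - B. real (card (S y)))"
      using sum.subset_diff[of B \<Omega> "\<lambda>y. real (card (S y))"] f\<Omega> by (auto simp: B_def)
    also have "\<dots> \<le> (\<Sum>y\<in>B. n) + (\<Sum>y\<in>\<Omega> - B. c / 2 * n)"
      by (intro add_mono sum_mono) (use Sn in \<open>auto simp: B_def\<close>)
    also have "\<dots> \<le> card B * n + n ^ card I * (c / 2 * n)"
      unfolding sum_constant c\<Omega>[symmetric] using insert.prems n0 f\<Omega>
      by (intro add_mono mult_right_mono) (auto intro: card_mono)
    finally have "n * (c / 2 * n ^ card I) \<le> n * real (card B)" by (simp add: algebra_simps)
    then have B: "c / 2 * n ^ card I \<le> card B" using n0 by simp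
    have "\<exists>T\<subseteq>V. card T = t \<and> c' * card B \<le> card {b\<in>B. T \<subseteq> S b}"
      by (rule step[rule_format]) (use V f\<Omega> in \<open>auto simp: B_def S_def n_def\<close>)
    then obtain Ti where Ti: "Ti \<subseteq> V" "card Ti = t" "c' * card B \<le> card {b\<in>B. Ti \<subseteq> S b}" by blast
    have "\<exists>T. (\<forall>i\<in>I. T i \<subseteq> V \<and> card (T i) = t) \<and> PiE I T \<subseteq> {b\<in>B. Ti \<subseteq> S b}"
    proof (rule IH[rule_format])
      have "c' * (c / 2) * n ^ card I \<le> c' * card B"
        using mult_left_mono[OF B, of c'] c' by (simp add: mult_ac)
      then show "c' * (c / 2) * real (card V) ^ card I \<le> card {b\<in>B. Ti \<subseteq> S b}"
        using Ti unfolding n_def by linarith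
    qed (use V in \<open>auto simp: B_def \<Omega>_def\<close>)
    then obtain T where T: "\<forall>i\<in>I. T i \<subseteq> V \<and> card (T i) = t" "PiE I T \<subseteq> {b\<in>B. Ti \<subseteq> S b}" by blast
    have "PiE (insert i I) (T(i := Ti)) \<subseteq> R"
    proof
      fix f assume f: "f \<in> PiE (insert i I) (T(i := Ti))"
      have "f(i := undefined) \<in> PiE I T" "f i \<in> Ti"
        using f insert.hyps(2) by (auto simp: PiE_iff extensional_def split: if_splits)
      then have "f i \<in> S (f(i := undefined))" using T(2) by blast
      then show "f \<in> R" by (simp add: S_def)
    qed
    then show ?thesis using T(1) Ti insert.hyps(2) by (intro exI[of _ "T(i := Ti)"]) auto
  qed
  show ?case by (rule exI[of _ "M1 + M2 + 1"], intro allI impI, rule main) assumption+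
qed

section \<open>Embeddings and colourings\<close>

definition nbrs :: "'a graph \<Rightarrow> 'a \<Rightarrow> 'a set" where
  "nbrs G v = {u. {v, u} \<in> edges G}"

lemma edge_verts:
  assumes "fin_graph G" "{u, v} \<in> edges G"
  shows "u \<in> verts G" "v \<in> verts G" "u \<noteq> v"
proof -
  have "{u, v} \<in> [verts G]\<^bsup>2\<^esup>" using assms unfolding fin_graph_def by blast
  then show "u \<in> verts G" "v \<in> verts G" "u \<noteq> v" by simp_all
qed

lemma mem_nbrs_sym: "u \<in> nbrs G v \<longleftrightarrow> v \<in> nbrs G u"
  by (simp add: nbrs_def insert_commute)

lemma nbrs_subset: "fin_graph G \<Longrightarrow> nbrs G v \<subseteq> verts G"
  by (auto simp: nbrs_def dest: edge_verts(2))

lemma finite_nbrs: "fin_graph G \<Longrightarrow> finite (nbrs G v)"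
  by (rule finite_subset[OF nbrs_subset]) (simp_all add: fin_graph_def)

lemma degree_eq_card_nbrs:
  assumes "fin_graph G"
  shows "degree G v = card (nbrs G v)"
proof -
  have "{e \<in> edges G. v \<in> e} = (\<lambda>u. {v, u}) ` nbrs G v"
  proof safe
    fix e assume e: "e \<in> edges G" "v \<in> e"
    then have "e \<in> [verts G]\<^bsup>2\<^esup>" using assms unfolding fin_graph_def by blast
    then have "card e = 2" by (simp add: nsets_def)
    then obtain a b where "e = {a, b}" unfolding card_2_iff by blast
    then have "\<exists>u. e = {v, u}" using e by auto
    then show "e \<in> (\<lambda>u. {v, u}) ` nbrs G v" using e by (auto simp: nbrs_def)
  qed (auto simp: nbrs_def)
  moreover have "inj_on (\<lambda>u. {v, u}) (nbrs G v)"
    by (auto simp: inj_on_def doubleton_eq_iff)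
  ultimately show ?thesis by (simp add: degree_def card_image)
qed

lemma min_degree_le_card_nbrs:
  assumes "fin_graph G" "v \<in> verts G"
  shows "min_degree G \<le> card (nbrs G v)"
  using assms degree_eq_card_nbrs[OF assms(1), of v] unfolding min_degree_def fin_graph_def
  by (metis Min_le finite_imageI imageI)

lemma chromatic_number_le: "colourable k G \<Longrightarrow> chromatic_number G \<le> k"
  unfolding chromatic_number_def by (rule Least_le)

lemma colourable_card_verts:
  assumes "fin_graph G"
  shows "colourable (card (verts G)) G"
proof -
  obtain c where "bij_betw c (verts G) {..<card (verts G)}"
    using assms ex_bij_betw_finite_nat[of "verts G"] by (auto simp: fin_graph_def atLeast0LessThan)
  then show ?thesis
    unfolding colourable_def
    by (intro exI[of _ c])
       (auto simp: bij_betw_def dest: edge_verts(1)[OF assms] edge_verts(2)[OF assms]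
          edge_verts(3)[OF assms] inj_onD)
qed

lemma colourable_chromatic_number:
  assumes "fin_graph G"
  shows "colourable (chromatic_number G) G"
  unfolding chromatic_number_def using colourable_card_verts[OF assms] by (rule LeastI)

lemma edgeE:
  assumes "fin_graph G" "e \<in> edges G"
  obtains u v where "e = {u, v}" "u \<in> verts G" "v \<in> verts G" "u \<noteq> v"
proof -
  have "e \<in> [verts G]\<^bsup>2\<^esup>" using assms unfolding fin_graph_def by blast
  then have "card e = 2" "e \<subseteq> verts G" by (auto simp: nsets_def)
  then show ?thesis unfolding card_2_iff using that by auto
qed

text \<open>The image of \<open>H\<close> under \<open>g\<close> is the forbidden subgraph and the
  inverse of \<open>g\<close> the isomorphism. Copies of \<open>H\<close> are handled as injective
  edge-preserving maps throughout; \<open>not_free_ofE\<close> is the converse.\<close>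

lemma not_free_ofI:
  assumes H: "fin_graph H" and g: "inj_on g (verts H)" "g ` verts H \<subseteq> verts G"
    and hom: "\<And>u v. {u, v} \<in> edges H \<Longrightarrow> {g u, g v} \<in> edges G"
  shows "\<not> free_of H G"
proof -
  define F where "F = (g ` verts H, (\<lambda>e. g ` e) ` edges H)"
  have ed: "\<exists>u v. e = {u, v} \<and> u \<in> verts H \<and> v \<in> verts H \<and> u \<noteq> v" if "e \<in> edges H" for e
    by (rule edgeE[OF H that]) blast
  have "fin_graph F"
    unfolding fin_graph_def
  proof (intro conjI subsetI)
    fix e assume "e \<in> edges F"
    then obtain e' where e': "e' \<in> edges H" "e = g ` e'" by (auto simp: F_def)
    with ed obtain u v where "e' = {u, v}" "u \<in> verts H" "v \<in> verts H" "u \<noteq> v" by blast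
    then show "e \<in> [verts F]\<^bsup>2\<^esup>" using g(1) e' by (auto simp: F_def inj_on_def)
  qed (use H in \<open>auto simp: F_def fin_graph_def\<close>)
  moreover have "edges F \<subseteq> edges G"
  proof
    fix e assume "e \<in> edges F"
    then obtain e' where e': "e' \<in> edges H" "e = g ` e'" by (auto simp: F_def)
    with ed obtain u v where "e' = {u, v}" by blast
    then show "e \<in> edges G" using hom[of u v] e' by auto
  qed
  ultimately have "subgraph F G" using g by (auto simp: subgraph_def F_def)
  moreover have "isomorphic F H"
    unfolding isomorphic_def
  proof (intro exI[of _ "inv_into (verts H) g"] conjI)
    show "bij_betw (inv_into (verts H) g) (verts F) (verts H)"
      using bij_betw_inv_into[of g "verts H" "g ` verts H"] g(1) by (simp add: F_def bij_betw_def)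
    have "inv_into (verts H) g ` g ` e = e" if "e \<in> edges H" for e
      using ed[OF that] g(1) by (intro inv_into_image_cancel) auto
    then show "(`) (inv_into (verts H) g) ` edges F = edges H"
      by (auto simp: F_def image_image)
  qed
  ultimately show ?thesis unfolding free_of_def by blast
qed

section \<open>Forests, greedy embedding and greedy colouring\<close>

text \<open>Acyclicity of finite graphs in the form of 1-degeneracy: it passes to subsets at once,
  and the vertex of degree at most 1 is the one that a greedy embedding removes.\<close>

definition forest_on :: "'a graph \<Rightarrow> 'a set \<Rightarrow> bool" where
  "forest_on G X \<longleftrightarrow> (\<forall>Y\<subseteq>X. Y \<noteq> {} \<longrightarrow> (\<exists>y\<in>Y. card (nbrs G y \<inter> Y) \<le> 1))"

lemma forest_embedding:
  assumes H: "fin_graph H" and G: "fin_graph G" and U: "U \<noteq> {}" "U \<subseteq> verts G"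
    and deg: "\<And>u. u \<in> U \<Longrightarrow> m \<le> card (nbrs G u \<inter> U)"
    and X: "finite X" "card X \<le> m" "forest_on H X"
  shows "\<exists>\<phi>. inj_on \<phi> X \<and> \<phi> ` X \<subseteq> U \<and> (\<forall>x\<in>X. \<forall>y\<in>X. {x, y} \<in> edges H \<longrightarrow> {\<phi> x, \<phi> y} \<in> edges G)"
  using X
proof (induction "card X" arbitrary: X)
  case 0
  then show ?case by simp
next
  case (Suc l)
  then have "X \<noteq> {}" by auto
  with Suc.prems obtain x where x: "x \<in> X" "card (nbrs H x \<inter> X) \<le> 1"
    unfolding forest_on_def by blast
  let ?X = "X - {x}"
  have fU: "finite U" using U G finite_subset by (auto simp: fin_graph_def)
  have cX: "card ?X = l" using Suc.hyps(2) Suc.prems(1) x by simp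
  have "forest_on H ?X" using Suc.prems(3) unfolding forest_on_def by blast
  then obtain \<phi> where \<phi>: "inj_on \<phi> ?X" "\<phi> ` ?X \<subseteq> U"
      "\<forall>x\<in>?X. \<forall>y\<in>?X. {x, y} \<in> edges H \<longrightarrow> {\<phi> x, \<phi> y} \<in> edges G"
    using Suc.hyps(1)[of ?X] cX Suc.prems Suc.hyps(2) by auto
  have "\<exists>u\<in>U - \<phi> ` ?X. \<forall>y\<in>?X. {x, y} \<in> edges H \<longrightarrow> {u, \<phi> y} \<in> edges G"
  proof -
    have c\<phi>: "card (\<phi> ` ?X) < m"
      using card_image_le[of ?X \<phi>] Suc.prems Suc.hyps(2) cX by simp
    have pick: "\<exists>u\<in>U - \<phi> ` ?X. u \<in> nbrs G w" if "w \<in> U" for w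
    proof (rule ccontr)
      assume "\<not> ?thesis"
      then have "nbrs G w \<inter> U \<subseteq> \<phi> ` ?X" by blast
      then have "card (nbrs G w \<inter> U) \<le> card (\<phi> ` ?X)" using Suc.prems by (intro card_mono) auto
      then show False using deg[OF that] c\<phi> by simp
    qed
    show ?thesis
    proof (cases "nbrs H x \<inter> ?X = {}")
      case True
      then show ?thesis using pick U unfolding nbrs_def by blast
    next
      case False
      then obtain z where z: "z \<in> nbrs H x \<inter> ?X" by blast
      have one: "y = z" if "y \<in> nbrs H x \<inter> ?X" for y
      proof -
        have "card {y, z} \<le> card (nbrs H x \<inter> X)"
          by (intro card_mono) (use that z Suc.prems in auto)
        then show ?thesis using x(2) by (cases "y = z") auto
      qed
      have "\<phi> z \<in> U" using \<phi> z by blast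
      with pick obtain u where "u \<in> U - \<phi> ` ?X" "u \<in> nbrs G (\<phi> z)" by blast
      then show ?thesis using one by (intro bexI[of _ u]) (auto simp: nbrs_def insert_commute)
    qed
  qed
  then obtain u where u: "u \<in> U" "u \<notin> \<phi> ` ?X" "\<forall>y\<in>?X. {x, y} \<in> edges H \<longrightarrow> {u, \<phi> y} \<in> edges G" by blast
  define \<psi> where "\<psi> = \<phi>(x := u)"
  have \<psi>: "\<psi> x = u" "\<And>y. y \<in> ?X \<Longrightarrow> \<psi> y = \<phi> y" by (auto simp: \<psi>_def)
  have img: "\<psi> ` ?X = \<phi> ` ?X" by (rule image_cong) (simp_all add: \<psi>)
  have "inj_on \<psi> (insert x ?X)"
    unfolding inj_on_insert using \<phi>(1) u(2) img \<psi> by (simp add: inj_on_def)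
  moreover have "\<psi> ` insert x ?X \<subseteq> U" unfolding image_insert img \<psi>(1) using \<phi>(2) u(1) by blast
  moreover have "\<forall>a\<in>insert x ?X. \<forall>b\<in>insert x ?X. {a, b} \<in> edges H \<longrightarrow> {\<psi> a, \<psi> b} \<in> edges G"
  proof (intro ballI impI)
    fix a b assume ab: "a \<in> insert x ?X" "b \<in> insert x ?X" "{a, b} \<in> edges H"
    have "a \<noteq> b" by (rule edge_verts(3)[OF H ab(3)])
    then consider "a = x" "b \<in> ?X" | "b = x" "a \<in> ?X" | "a \<in> ?X" "b \<in> ?X" using ab by blast
    then show "{\<psi> a, \<psi> b} \<in> edges G"
    proof cases
      case 1
      then show ?thesis using u(3) ab(3) \<psi> by simp
    next
      case 2
      then have "{x, a} \<in> edges H" using ab(3) by (simp add: insert_commute)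
      then have "{u, \<phi> a} \<in> edges G" using u(3) 2 by blast
      then show ?thesis using \<psi> 2 by (simp add: insert_commute)
    next
      case 3
      then show ?thesis using \<phi>(3) ab(3) \<psi> by simp
    qed
  qed
  moreover have "insert x ?X = X" using x by blast
  ultimately show ?case by (intro exI[of _ \<psi>]) simp
qed

text \<open>A vertex with fewer than \<open>m\<close> neighbours can be coloured last. In the
  application, a failure of the degree hypothesis yields a set \<open>U'\<close> to which
  \<open>forest_embedding\<close> applies.\<close>

lemma degenerate_colouring:
  assumes G: "fin_graph G" and U: "finite U"
    and deg: "\<And>U'. U' \<subseteq> U \<Longrightarrow> U' \<noteq> {} \<Longrightarrow> \<exists>u\<in>U'. card (nbrs G u \<inter> U') < m"
  shows "\<exists>c::'a \<Rightarrow> nat. (\<forall>u\<in>U. c u < m) \<and> (\<forall>u\<in>U. \<forall>v\<in>U. {u, v} \<in> edges G \<longrightarrow> c u \<noteq> c v)"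
  using U deg
proof (induction "card U" arbitrary: U)
  case 0
  then show ?case by simp
next
  case (Suc l)
  then have "U \<noteq> {}" by auto
  with Suc.prems(2)[of U] obtain u where u: "u \<in> U" "card (nbrs G u \<inter> U) < m" by blast
  let ?U = "U - {u}"
  have "card ?U = l" using Suc.hyps(2) Suc.prems(1) u by simp
  moreover have "\<exists>u\<in>U'. card (nbrs G u \<inter> U') < m" if "U' \<subseteq> ?U" "U' \<noteq> {}" for U'
    using Suc.prems(2)[of U'] that by blast
  ultimately obtain c where c: "\<forall>u\<in>?U. c u < m" "\<forall>u\<in>?U. \<forall>v\<in>?U. {u, v} \<in> edges G \<longrightarrow> c u \<noteq> (c v::nat)"
    using Suc.hyps(1)[of ?U] Suc.prems(1) by auto
  have "card (c ` (nbrs G u \<inter> U)) < card {..<m}"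
    using card_image_le[of "nbrs G u \<inter> U" c] u Suc.prems by simp
  then have "\<not> {..<m} \<subseteq> c ` (nbrs G u \<inter> U)"
    by (metis card_mono finite_Int finite_imageI Suc.prems(1) not_le)
  then obtain a where a: "a < m" "a \<notin> c ` (nbrs G u \<inter> U)" by blast
  have "c v \<noteq> a" if "v \<in> U" "{u, v} \<in> edges G" for v using that a(2) by (auto simp: nbrs_def)
  then show ?case
    using c a(1) edge_verts(3)[OF G]
    by (intro exI[of _ "c(u := a)"]) (auto simp: insert_commute)
qed

lemma injective_selection:
  assumes "finite Y" "finite \<Phi>" "\<And>y. y \<in> Y \<Longrightarrow> card Y + card \<Phi> \<le> card (A y)"
  shows "\<exists>g. inj_on g Y \<and> (\<forall>y\<in>Y. g y \<in> A y - \<Phi>)"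
  using assms(1,3)
proof (induction Y rule: finite_induct)
  case empty
  then show ?case by simp
next
  case (insert x Y)
  have "\<exists>g. inj_on g Y \<and> (\<forall>y\<in>Y. g y \<in> A y - \<Phi>)"
    by (rule insert.IH) (use insert in fastforce)
  then obtain g where g: "inj_on g Y" "\<forall>y\<in>Y. g y \<in> A y - \<Phi>" by blast
  have "card (g ` Y \<union> \<Phi>) \<le> card Y + card \<Phi>"
    using card_Un_le[of "g ` Y" \<Phi>] card_image_le[OF insert.hyps(1), of g] by linarith
  then have "card (g ` Y \<union> \<Phi>) < card (A x)" using insert by fastforce
  then have "\<not> A x \<subseteq> g ` Y \<union> \<Phi>"
    by (metis card_mono finite_UnI finite_imageI insert.hyps(1) assms(2) not_le)
  then obtain a where "a \<in> A x" "a \<notin> g ` Y" "a \<notin> \<Phi>" by blast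
  then have "inj_on (g(x := a)) (insert x Y)" "\<forall>y\<in>insert x Y. (g(x := a)) y \<in> A y - \<Phi>"
    using g insert.hyps(2) by (auto simp: inj_on_def)
  then show ?case by blast
qed

text \<open>One application of \<open>dense_common_subset\<close> for each \<open>p\<close>, always
  to the part of \<open>B\<close> that is left; the density factors multiply. In the application
  \<open>p\<close> is a pair of a forest vertex and a colour, so the number of rounds is
  bounded.\<close>

lemma dense_common_subsets:
  fixes c :: real
  assumes "finite P" "c > 0"
  shows "\<exists>c'>0::real. \<exists>M. \<forall>(V::'v set) (B::'b set) S. finite V \<longrightarrow> M \<le> card V \<longrightarrow> finite B \<longrightarrow>
     (\<forall>p\<in>P. \<forall>b\<in>B. S p b \<subseteq> V \<and> c * card V \<le> card (S p b)) \<longrightarrow>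
     (\<exists>T B'. B' \<subseteq> B \<and> c' * card B \<le> card B' \<and>
        (\<forall>p\<in>P. T p \<subseteq> V \<and> card (T p) = t \<and> (\<forall>b\<in>B'. T p \<subseteq> S p b)))"
  using assms(1)
proof (induction P rule: finite_induct)
  case empty
  show ?case by (rule exI[of _ 1]) auto
next
  case (insert p P)
  from insert.IH obtain c1 :: real and M1 where c1: "c1 > 0" and
    IH: "\<forall>(V::'v set) (B::'b set) S. finite V \<longrightarrow> M1 \<le> card V \<longrightarrow> finite B \<longrightarrow>
     (\<forall>p\<in>P. \<forall>b\<in>B. S p b \<subseteq> V \<and> c * card V \<le> card (S p b)) \<longrightarrow>
     (\<exists>T B'. B' \<subseteq> B \<and> c1 * card B \<le> card B' \<and>
        (\<forall>p\<in>P. T p \<subseteq> V \<and> card (T p) = t \<and> (\<forall>b\<in>B'. T p \<subseteq> S p b)))" by (elim exE conjE) (rule that)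
  from dense_common_subset[OF assms(2), where t = t] obtain c2 :: real and M2 where c2: "c2 > 0" and
    step: "\<forall>(V::'v set) (B::'b set) S. finite V \<longrightarrow> M2 \<le> card V \<longrightarrow> finite B \<longrightarrow>
     (\<forall>b\<in>B. S b \<subseteq> V \<and> c * card V \<le> card (S b)) \<longrightarrow>
     (\<exists>T\<subseteq>V. card T = t \<and> c2 * card B \<le> card {b\<in>B. T \<subseteq> S b})"
    by (elim exE conjE) (rule that)
  have main: "\<exists>T B'. B' \<subseteq> B \<and> c2 * c1 * card B \<le> card B' \<and>
        (\<forall>p\<in>insert p P. T p \<subseteq> V \<and> card (T p) = t \<and> (\<forall>b\<in>B'. T p \<subseteq> S p b))"
    if V: "finite V" "M1 + M2 \<le> card V" "finite B"
      and S: "\<forall>p\<in>insert p P. \<forall>b\<in>B. S p b \<subseteq> V \<and> c * card V \<le> card (S p b)"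
    for V :: "'v set" and B :: "'b set" and S
  proof -
    have "\<exists>T B'. B' \<subseteq> B \<and> c1 * card B \<le> card B' \<and>
        (\<forall>p\<in>P. T p \<subseteq> V \<and> card (T p) = t \<and> (\<forall>b\<in>B'. T p \<subseteq> S p b))"
      by (rule IH[rule_format]) (use V S in auto)
    then obtain T B' where T: "B' \<subseteq> B" "c1 * card B \<le> card B'"
      "\<forall>p\<in>P. T p \<subseteq> V \<and> card (T p) = t \<and> (\<forall>b\<in>B'. T p \<subseteq> S p b)" by blast
    have "\<exists>T\<subseteq>V. card T = t \<and> c2 * card B' \<le> card {b\<in>B'. T \<subseteq> S p b}"
      by (rule step[rule_format]) (use V S T(1) finite_subset in auto)
    then obtain Tp where Tp: "Tp \<subseteq> V" "card Tp = t" "c2 * card B' \<le> card {b\<in>B'. Tp \<subseteq> S p b}" by blast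
    have "c2 * c1 * card B \<le> c2 * card B'"
      using mult_left_mono[OF T(2), of c2] c2 by (simp add: mult_ac)
    then have "c2 * c1 * card B \<le> card {b\<in>B'. Tp \<subseteq> S p b}" using Tp(3) by linarith
    then show ?thesis
      using T(1,3) Tp insert.hyps(2)
      by (intro exI[of _ "T(p := Tp)"] exI[of _ "{b\<in>B'. Tp \<subseteq> S p b}"]) auto
  qed
  show ?case
  proof (rule exI[of _ "c2 * c1"], rule conjI)
    show "c2 * c1 > 0" using c1 c2 by simp
  qed (rule exI[of _ "M1 + M2"], intro allI impI, rule main; assumption)
qed

section \<open>Graphs attached to a forest\<close>

text \<open>Each member of \<open>Q\<close> misses at most \<open>(1 / k - \<gamma>) * n\<close>
  vertices, so \<open>k\<close> of them miss at most \<open>(1 - k * \<gamma>) * n\<close>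
  together.\<close>

lemma common_nbrs:
  fixes \<gamma> :: real
  assumes G: "fin_graph G" and k: "k \<ge> 1" and \<gamma>: "\<gamma> > 0"
    and deg: "\<And>v. v \<in> verts G \<Longrightarrow> (1 - 1 / k + \<gamma>) * card (verts G) \<le> card (nbrs G v)"
    and Q: "Q \<subseteq> verts G" "card Q \<le> k"
  shows "\<gamma> * card (verts G) \<le> card {x\<in>verts G. \<forall>q\<in>Q. {q, x} \<in> edges G}"
proof -
  define n where "n = card (verts G)"
  define A where "A = {x\<in>verts G. \<forall>q\<in>Q. {q, x} \<in> edges G}"
  have fV: "finite (verts G)" "verts G \<noteq> {}" using G by (auto simp: fin_graph_def)
  then have n0: "n > 0" by (simp add: n_def card_gt_0_iff)
  have fQ: "finite Q" using Q fV finite_subset by blast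
  have le: "card (nbrs G v) \<le> n" for v unfolding n_def by (intro card_mono fV nbrs_subset G)
  obtain v where "v \<in> verts G" using fV by blast
  from deg[OF this] le[of v] have "(1 - 1 / k + \<gamma>) * n \<le> 1 * real n" by (simp add: n_def)
  \<comment> \<open>The sign is needed to replace the factor \<open>card Q\<close> by
    \<open>k\<close> below.\<close>
  then have \<beta>: "0 \<le> 1 / k - \<gamma>" using n0 by (subst (asm) mult_le_cancel_right_pos) auto
  have "verts G - A \<subseteq> (\<Union>q\<in>Q. verts G - nbrs G q)" by (auto simp: A_def nbrs_def)
  then have "card (verts G - A) \<le> card (\<Union>q\<in>Q. verts G - nbrs G q)"
    by (intro card_mono) (use fQ fV in auto)
  also have "\<dots> \<le> (\<Sum>q\<in>Q. card (verts G - nbrs G q))" by (rule card_UN_le[OF fQ])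
  finally have "real (card (verts G - A)) \<le> (\<Sum>q\<in>Q. real (card (verts G - nbrs G q)))"
    by (simp flip: of_nat_sum)
  also have "\<dots> \<le> (\<Sum>q\<in>Q. (1 / k - \<gamma>) * n)"
  proof (rule sum_mono)
    fix q assume "q \<in> Q"
    then have q: "q \<in> verts G" using Q by blast
    have "card (verts G - nbrs G q) = n - card (nbrs G q)"
      unfolding n_def by (intro card_Diff_subset finite_nbrs nbrs_subset G)
    then have "real (card (verts G - nbrs G q)) = n - real (card (nbrs G q))" using le[of q] by simp
    also have "\<dots> \<le> (1 / k - \<gamma>) * n" using deg[OF q] by (simp add: n_def algebra_simps)
    finally show "real (card (verts G - nbrs G q)) \<le> (1 / k - \<gamma>) * n" .
  qed
  also have "\<dots> \<le> k * ((1 / k - \<gamma>) * n)"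
    unfolding sum_constant using Q \<beta> by (intro mult_right_mono) auto
  also have "\<dots> = n - k * \<gamma> * n" using k by (simp add: field_simps)
  finally have "real (card (verts G - A)) \<le> n - k * \<gamma> * n" .
  moreover have "card (verts G - A) = n - card A" "card A \<le> n"
    using fV by (auto simp: A_def n_def card_Diff_subset card_mono)
  ultimately have "k * (\<gamma> * n) \<le> card A" by simp
  moreover have "1 * (\<gamma> * n) \<le> k * (\<gamma> * n)" using k \<gamma> by (intro mult_right_mono) auto
  ultimately show ?thesis by (simp add: A_def n_def)
qed

text \<open>Entries with index below \<open>k\<close> are neighbours of \<open>v\<close>; an entry with index \<open>k\<close> need not be.\<close>

definition cliques :: "'a graph \<Rightarrow> nat \<Rightarrow> 'a \<Rightarrow> nat \<Rightarrow> (nat \<Rightarrow> 'a) set" where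
  "cliques G k v j = {b \<in> PiE {..<j} (\<lambda>_. verts G).
     (\<forall>i<j. \<forall>i'<j. i \<noteq> i' \<longrightarrow> {b i, b i'} \<in> edges G) \<and> (\<forall>i<j. i < k \<longrightarrow> {v, b i} \<in> edges G)}"

text \<open>A clique of length \<open>j\<close> is extended by a common neighbour of its entries
  and, if \<open>j < k\<close>, of \<open>v\<close>. In both cases these are at most
  \<open>k\<close> vertices, so \<open>common_nbrs\<close> leaves \<open>\<gamma> * n\<close>
  choices. Exempting the entry with index \<open>k\<close> from adjacency to \<open>v\<close> is
  what keeps their number at \<open>k\<close>.\<close>

lemma card_cliques:
  fixes \<gamma> :: real
  assumes G: "fin_graph G" and k: "k \<ge> 1" and \<gamma>: "\<gamma> > 0"
    and deg: "\<And>v. v \<in> verts G \<Longrightarrow> (1 - 1 / k + \<gamma>) * card (verts G) \<le> card (nbrs G v)"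
    and v: "v \<in> verts G" and j: "j \<le> Suc k"
  shows "(\<gamma> * card (verts G)) ^ j \<le> card (cliques G k v j)"
  using j
proof (induction j)
  case 0
  have "cliques G k v 0 = {\<lambda>_. undefined}" by (auto simp: cliques_def)
  then show ?case by simp
next
  case (Suc j)
  define n where "n = card (verts G)"
  have fV: "finite (verts G)" using G by (auto simp: fin_graph_def)
  have ext: "\<gamma> * n \<le> card {x\<in>verts G. y(j := x) \<in> cliques G k v (Suc j)}" if y: "y \<in> cliques G k v j" for y
  proof -
    define Q where "Q = y ` {..<j} \<union> (if j < k then {v} else {})"
    have yV: "y i \<in> verts G" if "i < j" for i using y that by (auto simp: cliques_def PiE_iff)
    have "card (y ` {..<j}) \<le> j" using card_image_le[of "{..<j}" y] by simp
    then have "card Q \<le> k"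
      using card_Un_le[of "y ` {..<j}" "{v}"] Suc.prems by (auto simp: Q_def)
    moreover have "Q \<subseteq> verts G" using yV v by (auto simp: Q_def)
    ultimately have "\<gamma> * n \<le> card {x\<in>verts G. \<forall>q\<in>Q. {q, x} \<in> edges G}"
      unfolding n_def by (intro common_nbrs[OF G k \<gamma> deg])
    also have "\<dots> \<le> card {x\<in>verts G. y(j := x) \<in> cliques G k v (Suc j)}"
    proof (rule of_nat_mono, rule card_mono)
      show "{x\<in>verts G. \<forall>q\<in>Q. {q, x} \<in> edges G} \<subseteq> {x\<in>verts G. y(j := x) \<in> cliques G k v (Suc j)}"
      proof safe
        fix x assume x: "x \<in> verts G" "\<forall>q\<in>Q. {q, x} \<in> edges G"
        have *: "{y i, x} \<in> edges G" "{x, y i} \<in> edges G" if "i < j" for i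
          using x(2) that by (auto simp: Q_def insert_commute)
        have "y(j := x) \<in> PiE {..<Suc j} (\<lambda>_. verts G)"
          using y x(1) by (auto simp: cliques_def lessThan_Suc)
        moreover have "\<forall>i<Suc j. \<forall>i'<Suc j. i \<noteq> i' \<longrightarrow> {(y(j := x)) i, (y(j := x)) i'} \<in> edges G"
          using y * by (auto simp: cliques_def less_Suc_eq)
        moreover have "\<forall>i<Suc j. i < k \<longrightarrow> {v, (y(j := x)) i} \<in> edges G"
          using y x(2) by (auto simp: cliques_def less_Suc_eq Q_def)
        ultimately show "y(j := x) \<in> cliques G k v (Suc j)" by (simp add: cliques_def)
      qed
    qed (use fV in auto)
    finally show ?thesis .
  qed
  have "(\<gamma> * n) ^ Suc j \<le> (\<gamma> * n) * card (cliques G k v j)"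
    using Suc \<gamma> by (simp add: n_def mult_left_mono)
  also have "\<dots> = (\<Sum>y\<in>cliques G k v j. \<gamma> * n)" by simp
  also have "\<dots> \<le> (\<Sum>y\<in>cliques G k v j. real (card {x\<in>verts G. y(j := x) \<in> cliques G k v (Suc j)}))"
    by (rule sum_mono) (rule ext)
  also have "\<dots> \<le> (\<Sum>y\<in>PiE {..<j} (\<lambda>_. verts G). real (card {x\<in>verts G. y(j := x) \<in> cliques G k v (Suc j)}))"
    by (rule sum_mono2) (use fV in \<open>auto simp: finite_PiE cliques_def\<close>)
  also have "\<dots> = card (cliques G k v (Suc j))"
    by (subst sum_fibres[where V = "verts G" and I = "{..<j}" and i = j])
       (use fV in \<open>auto simp: cliques_def lessThan_Suc\<close>)
  finally show ?case by (simp add: n_def)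
qed

text \<open>A counted tuple lies on a line in direction \<open>i\<close> that meets \<open>R\<close>
  in fewer than \<open>c * card V\<close> points, so each line contains at most that many counted
  tuples, and there are \<open>card V ^ (card I - 1)\<close> lines.\<close>

lemma card_few_replacements:
  fixes c :: real
  assumes V: "finite V" and I: "finite I" "i \<in> I" and R: "R \<subseteq> PiE I (\<lambda>_. V)" and c: "c \<ge> 0"
  shows "card {b\<in>R. card {s\<in>V. b(i := s) \<in> R} < c * card V} \<le> c * real (card V) ^ card I"
proof -
  let ?I = "I - {i}"
  define R' where "R' = {b\<in>R. card {s\<in>V. b(i := s) \<in> R} < c * card V}"
  have I': "insert i ?I = I" using I by blast
  have "R' \<subseteq> PiE (insert i ?I) (\<lambda>_. V)" using R unfolding I' R'_def by blast
  then have "card R' = (\<Sum>y\<in>PiE ?I (\<lambda>_. V). card {x\<in>V. y(i := x) \<in> R'})"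
    by (intro sum_fibres) (use V I in auto)
  then have "real (card R') = (\<Sum>y\<in>PiE ?I (\<lambda>_. V). real (card {x\<in>V. y(i := x) \<in> R'}))" by simp
  also have "\<dots> \<le> (\<Sum>y\<in>PiE ?I (\<lambda>_. V). c * card V)"
  proof (rule sum_mono)
    fix y
    show "card {x\<in>V. y(i := x) \<in> R'} \<le> c * card V"
    proof (cases "{x\<in>V. y(i := x) \<in> R'} = {}")
      case True
      then show ?thesis using c unfolding True by simp
    next
      case False
      then obtain x where "y(i := x) \<in> R'" by blast
      then have "card {s\<in>V. y(i := s) \<in> R} < c * card V" by (simp add: R'_def)
      moreover have "card {x\<in>V. y(i := x) \<in> R'} \<le> card {s\<in>V. y(i := s) \<in> R}"
        by (rule card_mono) (use V in \<open>auto simp: R'_def\<close>)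
      ultimately show ?thesis by linarith
    qed
  qed
  also have "\<dots> = c * real (card V) ^ card I"
  proof -
    have "card I = Suc (card ?I)" using I by (metis card.remove)
    moreover have "real (card (PiE ?I (\<lambda>_. V))) = real (card V) ^ card ?I"
      using I by (simp only: card_PiE_const finite_Diff of_nat_power)
    ultimately show ?thesis unfolding sum_constant by (simp only: power_Suc mult_ac)
  qed
  finally show ?thesis by (simp add: R'_def)
qed

section \<open>Types of vertices, and cliques that suit a whole class\<close>

text \<open>The neighbours of \<open>u\<close> that may replace entry \<open>i\<close> of
  \<open>b\<close>. Here \<open>b\<close> is an arbitrary tuple and not tied to \<open>u\<close>, so
  the cardinalities, as functions of \<open>i\<close> and \<open>b\<close>, have the same domain for
  all \<open>u\<close>. This function is the type of \<open>u\<close>.\<close>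

definition repl :: "'a graph \<Rightarrow> nat \<Rightarrow> 'a \<Rightarrow> nat \<Rightarrow> (nat \<Rightarrow> 'a) \<Rightarrow> 'a set" where
  "repl G k u i b = {s \<in> nbrs G u. \<forall>j\<in>{..<Suc k} - {i}. {s, b j} \<in> edges G}"

text \<open>The unnormalised L1 distance of types: \<open>k * n ^ Suc k\<close> terms of size at
  most \<open>n\<close>, which explains the scale \<open>n * (k * n ^ Suc k)\<close> in later
  bounds. Only \<open>i < k\<close> occurs because vertices attached to the forest have colours
  below \<open>k\<close>.\<close>

definition type_dist :: "'a graph \<Rightarrow> nat \<Rightarrow> 'a \<Rightarrow> 'a \<Rightarrow> real" where
  "type_dist G k u v = (\<Sum>(i,b)\<in>{..<k} \<times> PiE {..<Suc k} (\<lambda>_. verts G).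
     \<bar>real (card (repl G k u i b)) - real (card (repl G k v i b))\<bar>)"

lemma markov_count:
  fixes f :: "'z \<Rightarrow> real"
  assumes "finite Z" "\<And>z. z \<in> Z \<Longrightarrow> f z \<ge> 0" "(\<Sum>z\<in>Z. f z) \<le> a" "c > 0"
  shows "c * card {z\<in>Z. c < f z} \<le> a"
proof -
  have "c * card {z\<in>Z. c < f z} = (\<Sum>z\<in>{z\<in>Z. c < f z}. c)" by simp
  also have "\<dots> \<le> (\<Sum>z\<in>{z\<in>Z. c < f z}. f z)" by (rule sum_mono) auto
  also have "\<dots> \<le> (\<Sum>z\<in>Z. f z)" by (rule sum_mono2) (use assms in auto)
  finally show ?thesis using assms by linarith
qed

text \<open>Few cliques \<open>b\<close> admit only few replacements of their \<open>i\<close>-th entry.  For the others the replacements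
  are in \<open>repl G k v i b\<close>, and by closeness \<open>repl G k u i b\<close> is large, too, for most \<open>b\<close>.\<close>

lemma many_good_cliques:
  fixes \<gamma> c \<delta> :: real
  assumes G: "fin_graph G" and k: "k \<ge> 1" and \<gamma>: "\<gamma> > 0"
    and deg: "\<And>v. v \<in> verts G \<Longrightarrow> (1 - 1 / k + \<gamma>) * card (verts G) \<le> card (nbrs G v)"
    and v: "v \<in> verts G" and F: "finite F" "card F \<le> m"
    and c: "c = \<gamma> ^ Suc k / (4 * real k)" and \<delta>: "\<delta> = \<gamma> ^ Suc k * c / (8 * (real k)\<^sup>2 * (real m + 1))"
    and close: "\<And>u. u \<in> F \<Longrightarrow> type_dist G k u v \<le> \<delta> * card (verts G) * (k * real (card (verts G)) ^ Suc k)"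
  shows "\<gamma> ^ Suc k / 2 * real (card (verts G)) ^ Suc k \<le>
    card {b \<in> cliques G k v (Suc k). \<forall>u\<in>F. \<forall>i<k. c / 2 * card (verts G) \<le> card (repl G k u i b)}"
proof -
  let ?V = "verts G"
  define n where "n = real (card ?V)"
  define \<alpha> where "\<alpha> = \<gamma> ^ Suc k"
  define N where "N = n ^ Suc k"
  have fV: "finite ?V" "?V \<noteq> {}" using G by (auto simp: fin_graph_def)
  then have n0: "n > 0" by (simp add: n_def card_gt_0_iff)
  have N0: "N \<ge> 0" using n0 by (simp add: N_def)
  have \<alpha>: "\<alpha> > 0" using \<gamma> by (simp add: \<alpha>_def)
  have c0: "c > 0" using \<alpha> k by (simp add: c \<alpha>_def)
  have \<delta>0: "\<delta> \<ge> 0" unfolding \<delta> using \<gamma> c0 by simp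
  define K where "K = cliques G k v (Suc k)"
  define P where "P = PiE {..<Suc k} (\<lambda>_. ?V)"
  have fP: "finite P" using fV by (simp add: P_def finite_PiE)
  have KP: "K \<subseteq> P" by (auto simp: K_def cliques_def P_def)
  have K: "\<alpha> * N \<le> card K"
    using card_cliques[OF G k \<gamma> deg v order_refl]
    unfolding \<alpha>_def N_def K_def n_def power_mult_distrib .
  \<comment> \<open>By \<open>card_few_replacements\<close> each \<open>Bi i\<close> has at most
    \<open>c * N\<close> members, and \<open>c = \<alpha> / (4 * k)\<close> keeps all
    \<open>k\<close> of them within \<open>\<alpha> / 4 * N\<close>.\<close>
  define Bi where "Bi i = {b\<in>K. card {s\<in>?V. b(i := s) \<in> K} < c * card ?V}" for i
  have Bi: "card (Bi i) \<le> c * N" if "i < k" for i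
    using card_few_replacements[of ?V "{..<Suc k}" i K c] fV c0 that KP
    by (simp add: Bi_def P_def N_def n_def)
  \<comment> \<open>Tuples at which \<open>u\<close> and \<open>v\<close> differ noticeably.
    Markov's inequality and the choice of \<open>\<delta>\<close> keep the at most
    \<open>m * k\<close> sets of this kind within another \<open>\<alpha> / 4 * N\<close>, so half
    of \<open>\<alpha> * N\<close> remains.\<close>
  define Ci where "Ci u i = {b\<in>P. c / 2 * n < \<bar>real (card (repl G k u i b)) - real (card (repl G k v i b))\<bar>}" for u i
  have Ci: "card (Ci u i) \<le> 2 * \<delta> * k / c * N" if "u \<in> F" "i < k" for u i
  proof -
    have "(\<Sum>b\<in>P. \<bar>real (card (repl G k u i b)) - real (card (repl G k v i b))\<bar>) \<le> type_dist G k u v"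
    proof -
      have "(\<Sum>b\<in>P. \<bar>real (card (repl G k u i b)) - real (card (repl G k v i b))\<bar>)
        = (\<Sum>i\<in>{i}. \<Sum>b\<in>P. \<bar>real (card (repl G k u i b)) - real (card (repl G k v i b))\<bar>)" by simp
      also have "\<dots> \<le> (\<Sum>i<k. \<Sum>b\<in>P. \<bar>real (card (repl G k u i b)) - real (card (repl G k v i b))\<bar>)"
        by (rule sum_mono2) (use that in \<open>auto intro: sum_nonneg\<close>)
      also have "\<dots> = type_dist G k u v" by (simp add: type_dist_def P_def sum.cartesian_product)
      finally show ?thesis .
    qed
    also have "\<dots> \<le> \<delta> * n * (k * N)" using close[OF that(1)] by (simp add: n_def N_def)
    finally have "(c / 2 * n) * card (Ci u i) \<le> \<delta> * n * (k * N)"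
      unfolding Ci_def by (intro markov_count fP) (use c0 n0 in auto)
    then have "n * (c * card (Ci u i)) \<le> n * (2 * \<delta> * k * N)" by (simp add: algebra_simps)
    then have "c * card (Ci u i) \<le> 2 * \<delta> * k * N" using n0 by simp
    then show ?thesis using c0 by (simp add: field_simps)
  qed
  define Good where "Good = {b \<in> K. \<forall>u\<in>F. \<forall>i<k. c / 2 * card ?V \<le> card (repl G k u i b)}"
  have "K - ((\<Union>i<k. Bi i) \<union> (\<Union>(u,i)\<in>F \<times> {..<k}. Ci u i)) \<subseteq> Good"
  proof
    fix b assume b: "b \<in> K - ((\<Union>i<k. Bi i) \<union> (\<Union>(u,i)\<in>F \<times> {..<k}. Ci u i))"
    have "c / 2 * card ?V \<le> card (repl G k u i b)" if ui: "u \<in> F" "i < k" for u i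
    proof -
      have "c * n \<le> card {s\<in>?V. b(i := s) \<in> K}" using b ui by (auto simp: Bi_def n_def not_less)
      \<comment> \<open>As \<open>i < k\<close>, the \<open>i\<close>-th entry of a member of
        \<open>K\<close> is adjacent to \<open>v\<close> as well as to the other entries.\<close>
      also have "\<dots> \<le> card (repl G k v i b)"
      proof (rule of_nat_mono, rule card_mono)
        show "finite (repl G k v i b)" by (simp add: repl_def finite_nbrs[OF G])
        show "{s\<in>?V. b(i := s) \<in> K} \<subseteq> repl G k v i b"
        proof safe
          fix s assume "s \<in> ?V" "b(i := s) \<in> K"
          then have cl: "\<forall>j<Suc k. \<forall>j'<Suc k. j \<noteq> j' \<longrightarrow> {(b(i := s)) j, (b(i := s)) j'} \<in> edges G"
              "\<forall>j<Suc k. j < k \<longrightarrow> {v, (b(i := s)) j} \<in> edges G"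
            by (simp_all add: K_def cliques_def)
          have "{v, s} \<in> edges G" using cl(2)[rule_format, of i] ui by simp
          moreover have "{s, b j} \<in> edges G" if "j < Suc k" "j \<noteq> i" for j
            using cl(1)[rule_format, of i j] that ui by simp
          ultimately show "s \<in> repl G k v i b" by (auto simp: repl_def nbrs_def)
        qed
      qed
      finally have "c * n \<le> card (repl G k v i b)" .
      moreover have "\<bar>real (card (repl G k u i b)) - real (card (repl G k v i b))\<bar> \<le> c / 2 * n"
        using b KP ui by (fastforce simp: Ci_def not_less)
      ultimately show ?thesis unfolding n_def[symmetric] by linarith
    qed
    then show "b \<in> Good" using b by (auto simp: Good_def)
  qed
  then have "K \<subseteq> Good \<union> ((\<Union>i<k. Bi i) \<union> (\<Union>(u,i)\<in>F \<times> {..<k}. Ci u i))" by blast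
  then have "card K \<le> card (Good \<union> ((\<Union>i<k. Bi i) \<union> (\<Union>(u,i)\<in>F \<times> {..<k}. Ci u i)))"
    by (rule card_mono[rotated])
       (use fP finite_subset[OF KP fP] F in \<open>auto simp: Good_def Bi_def Ci_def\<close>)
  also have "\<dots> \<le> card Good + (card (\<Union>i<k. Bi i) + card (\<Union>(u,i)\<in>F \<times> {..<k}. Ci u i))"
    by (rule order_trans[OF card_Un_le add_left_mono[OF card_Un_le]])
  also have "\<dots> \<le> card Good + ((\<Sum>i<k. card (Bi i)) + (\<Sum>(u,i)\<in>F \<times> {..<k}. card (Ci u i)))"
  proof (intro add_left_mono add_mono)
    show "card (\<Union>i<k. Bi i) \<le> (\<Sum>i<k. card (Bi i))" by (rule card_UN_le) simp
    have "card (\<Union>p\<in>F \<times> {..<k}. Ci (fst p) (snd p)) \<le> (\<Sum>p\<in>F \<times> {..<k}. card (Ci (fst p) (snd p)))"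
      by (rule card_UN_le) (use F in simp)
    then show "card (\<Union>(u,i)\<in>F \<times> {..<k}. Ci u i) \<le> (\<Sum>(u,i)\<in>F \<times> {..<k}. card (Ci u i))"
      by (simp add: case_prod_unfold)
  qed
  finally have "real (card K) \<le> real (card Good) + ((\<Sum>i<k. real (card (Bi i))) + (\<Sum>p\<in>F \<times> {..<k}. real (card (Ci (fst p) (snd p)))))"
    unfolding case_prod_unfold by (simp flip: of_nat_sum of_nat_add)
  also have "\<dots> \<le> real (card Good) + ((\<Sum>i<k. c * N) + (\<Sum>p\<in>F \<times> {..<k}. 2 * \<delta> * k / c * N))"
    by (intro add_left_mono add_mono sum_mono) (use Bi Ci in auto)
  also have "\<dots> = real (card Good) + (k * c * N + card F * (k * (2 * \<delta> * k / c * N)))"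
    by (simp add: card_cartesian_product)
  also have "\<dots> \<le> real (card Good) + (\<alpha> / 4 * N + \<alpha> / 4 * N)"
  proof (intro add_left_mono add_mono)
    show "k * c * N \<le> \<alpha> / 4 * N" using k by (simp add: c \<alpha>_def)
    have "card F * (k * (2 * \<delta> * k / c * N)) \<le> (m + 1) * (k * (2 * \<delta> * k / c * N))"
      using F \<delta>0 c0 N0 by (intro mult_right_mono) auto
    also have "\<dots> = \<alpha> / 4 * N"
    proof -
      have eq: "M * (L * (2 * (a * c / (8 * L\<^sup>2 * M)) * L / c * N)) = a / 4 * N" if "M > 0" "L > 0" for M L a :: real
        using that c0 by (simp add: field_simps power2_eq_square)
      have "\<delta> = \<alpha> * c / (8 * (real k)\<^sup>2 * (real m + 1))" by (simp add: \<delta> \<alpha>_def add.commute)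
      then show ?thesis using eq[of "real m + 1" "real k" \<alpha>] k by (simp add: add.commute)
    qed
    finally show "card F * (k * (2 * \<delta> * k / c * N)) \<le> \<alpha> / 4 * N" .
  qed
  finally have "\<alpha> / 2 * N \<le> card Good" using K by linarith
  then show ?thesis by (simp add: \<alpha>_def N_def n_def Good_def K_def)
qed

text \<open>The structure of \<open>H\<close> when it is a subgraph of \<open>G'\<close>: \<open>X\<close> is the part of \<open>H\<close> in the sparse graph
  \<open>\<Gamma>\<close>, and \<open>k\<close> is the colour of the part that is not joined to \<open>\<Gamma>\<close>.\<close>

definition attachment :: "nat \<Rightarrow> 'a graph \<Rightarrow> 'a set \<Rightarrow> ('a \<Rightarrow> nat) \<Rightarrow> bool" where
  "attachment k H X col \<longleftrightarrow> X \<subseteq> verts H \<and> forest_on H X \<and>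
     (\<forall>y\<in>verts H - X. col y \<le> k \<and> card (nbrs H y \<inter> X) \<le> 1 \<and> (nbrs H y \<inter> X \<noteq> {} \<longrightarrow> col y < k)) \<and>
     (\<forall>y\<in>verts H - X. \<forall>z\<in>verts H - X. {y, z} \<in> edges H \<longrightarrow>
        col y \<noteq> col z \<and> (nbrs H y \<inter> X = {} \<or> nbrs H z \<inter> X = {}))"

text \<open>\<open>T i\<close> receives the vertices of colour \<open>i\<close> without neighbours
  in \<open>X\<close>, and \<open>S x i\<close> those of colour \<open>i\<close> attached to
  \<open>x\<close>. Edges between two sets \<open>S\<close> are never called for, because attached
  vertices are pairwise nonadjacent. The sets may overlap, but their size
  \<open>card (verts H)\<close> leaves room for distinct images outside the image of
  \<open>X\<close>.\<close>

lemma embed_attachment: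
  assumes H: "fin_graph H" "attachment k H X col"
    and \<phi>: "inj_on \<phi> X" "\<phi> ` X \<subseteq> verts G"
      "\<And>x y. x \<in> X \<Longrightarrow> y \<in> X \<Longrightarrow> {x, y} \<in> edges H \<Longrightarrow> {\<phi> x, \<phi> y} \<in> edges G"
    and T: "\<And>i. i \<le> k \<Longrightarrow> T i \<subseteq> verts G \<and> card (T i) = card (verts H)"
    and S: "\<And>x i. x \<in> X \<Longrightarrow> i < k \<Longrightarrow> S x i \<subseteq> verts G \<and> card (S x i) = card (verts H)"
    and TT: "\<And>i j a b. i \<le> k \<Longrightarrow> j \<le> k \<Longrightarrow> i \<noteq> j \<Longrightarrow> a \<in> T i \<Longrightarrow> b \<in> T j \<Longrightarrow> {a, b} \<in> edges G"
    and ST: "\<And>x i j a b. x \<in> X \<Longrightarrow> i < k \<Longrightarrow> j \<le> k \<Longrightarrow> i \<noteq> j \<Longrightarrow> a \<in> S x i \<Longrightarrow> b \<in> T j \<Longrightarrow> {a, b} \<in> edges G"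
    and SX: "\<And>x i a. x \<in> X \<Longrightarrow> i < k \<Longrightarrow> a \<in> S x i \<Longrightarrow> {\<phi> x, a} \<in> edges G"
  shows "\<not> free_of H G"
proof -
  let ?Y = "verts H - X"
  have X: "X \<subseteq> verts H" using H(2) by (simp add: attachment_def)
  have fH: "finite (verts H)" using H by (simp add: fin_graph_def)
  have fX: "finite X" using X fH by (rule finite_subset)
  have col: "col y \<le> k" if "y \<in> ?Y" for y using H(2) that by (simp add: attachment_def)
  have colk: "col y < k" if "y \<in> ?Y" "x \<in> nbrs H y" "x \<in> X" for x y
    using H(2) that unfolding attachment_def by blast
  have unique: "x = x'" if "y \<in> ?Y" "x \<in> nbrs H y" "x \<in> X" "x' \<in> nbrs H y" "x' \<in> X" for x x' y
  proof -
    have "card (nbrs H y \<inter> X) \<le> 1" using H(2) that by (simp add: attachment_def)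
    then show ?thesis using that fX by (auto simp: card_le_Suc0_iff_eq)
  qed
  have proper: "col y \<noteq> col z" "nbrs H y \<inter> X = {} \<or> nbrs H z \<inter> X = {}"
    if "y \<in> ?Y" "z \<in> ?Y" "{y, z} \<in> edges H" for y z
    using H(2) that by (simp_all add: attachment_def)
  define att where "att y = (SOME x. x \<in> nbrs H y \<inter> X)" for y
  have att: "att y \<in> nbrs H y" "att y \<in> X" if "nbrs H y \<inter> X \<noteq> {}" for y
    using someI_ex[of "\<lambda>x. x \<in> nbrs H y \<inter> X"] that by (auto simp: att_def)
  define A where "A y = (if nbrs H y \<inter> X = {} then T (col y) else S (att y) (col y))" for y
  have A: "A y \<subseteq> verts G \<and> card (A y) = card (verts H)" if "y \<in> ?Y" for y
  proof (cases "nbrs H y \<inter> X = {}")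
    case True
    then show ?thesis using T[OF col[OF that]] by (simp add: A_def)
  next
    case False
    show ?thesis using S[OF att(2)[OF False] colk[OF that att[OF False]]] False by (simp add: A_def)
  qed
  have "card ?Y + card (\<phi> ` X) \<le> card (verts H)"
    using card_image_le[OF fX, of \<phi>] card_Diff_subset[OF fX X] card_mono[OF fH X] by linarith
  then obtain h where h: "inj_on h ?Y" "\<And>y. y \<in> ?Y \<Longrightarrow> h y \<in> A y - \<phi> ` X"
    using injective_selection[of ?Y "\<phi> ` X" A] A fH fX by auto
  define g where "g y = (if y \<in> X then \<phi> y else h y)" for y
  have gX: "g y = \<phi> y" if "y \<in> X" for y using that by (simp add: g_def)
  have gY: "g y = h y" if "y \<in> ?Y" for y using that by (simp add: g_def)
  have out: "{g y, g z} \<in> edges G" if yz: "y \<in> ?Y" "z \<in> ?Y" "{y, z} \<in> edges H" "nbrs H z \<inter> X = {}" for y z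
  proof -
    have hz: "h z \<in> T (col z)" using h(2)[OF yz(2)] yz by (simp add: A_def)
    have "{h y, h z} \<in> edges G"
    proof (cases "nbrs H y \<inter> X = {}")
      case True
      then have "h y \<in> T (col y)" using h(2)[OF yz(1)] by (simp add: A_def)
      then show ?thesis using TT[OF col[OF yz(1)] col[OF yz(2)] proper(1)[OF yz(1-3)]] hz by blast
    next
      case False
      then have "h y \<in> S (att y) (col y)" using h(2)[OF yz(1)] by (simp add: A_def)
      then show ?thesis
        using ST[OF att(2)[OF False] colk[OF yz(1) att[OF False]] col[OF yz(2)] proper(1)[OF yz(1-3)]] hz by blast
    qed
    then show ?thesis using yz gY by simp
  qed
  have mixed: "{g x, g y} \<in> edges G" if xy: "x \<in> X" "y \<in> ?Y" "{x, y} \<in> edges H" for x y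
  proof -
    have x: "x \<in> nbrs H y" using xy(3) by (simp add: nbrs_def insert_commute)
    then have ne: "nbrs H y \<inter> X \<noteq> {}" using xy by blast
    have "att y = x" by (rule unique[OF xy(2) att[OF ne] x xy(1)])
    then have "h y \<in> S x (col y)" using h(2)[OF xy(2)] ne by (simp add: A_def)
    then show ?thesis using SX[OF xy(1) colk[OF xy(2) x xy(1)]] xy gX gY by simp
  qed
  show ?thesis
  proof (rule not_free_ofI[OF H(1)])
    have "inj_on g (X \<union> ?Y)"
    proof (rule inj_onI)
      fix a b assume ab: "a \<in> X \<union> ?Y" "b \<in> X \<union> ?Y" "g a = g b"
      show "a = b"
      proof (cases "a \<in> X"; cases "b \<in> X")
        assume "a \<in> X" "b \<in> X"
        then show ?thesis using ab(3) gX \<phi>(1) by (auto dest: inj_onD)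
      next
        assume "a \<notin> X" "b \<notin> X"
        then show ?thesis using ab gY h(1) by (auto dest: inj_onD)
      next
        assume "a \<in> X" "b \<notin> X"
        then have "\<phi> a = h b" "h b \<notin> \<phi> ` X" using ab gX gY h(2)[of b] by auto
        then show ?thesis using \<open>a \<in> X\<close> by (metis imageI)
      next
        assume "a \<notin> X" "b \<in> X"
        then have "\<phi> b = h a" "h a \<notin> \<phi> ` X" using ab gX gY h(2)[of a] by auto
        then show ?thesis using \<open>b \<in> X\<close> by (metis imageI)
      qed
    qed
    then show "inj_on g (verts H)" using X by (simp add: Un_absorb1)
    show "g ` verts H \<subseteq> verts G"
    proof
      fix w assume "w \<in> g ` verts H"
      then obtain y where y: "y \<in> verts H" "w = g y" by blast
      show "w \<in> verts G"
        using y gX[of y] gY[of y] \<phi>(2) h(2)[of y] A[of y] by (cases "y \<in> X") auto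
    qed
    fix u v assume uv: "{u, v} \<in> edges H"
    then have V: "u \<in> verts H" "v \<in> verts H" using edge_verts[OF H(1)] by blast+
    have vu: "{v, u} \<in> edges H" using uv by (simp add: insert_commute)
    consider "u \<in> X" "v \<in> X" | "u \<in> X" "v \<in> ?Y" | "u \<in> ?Y" "v \<in> X" | "u \<in> ?Y" "v \<in> ?Y" using V by blast
    then show "{g u, g v} \<in> edges G"
    proof cases
      case 1
      then show ?thesis using \<phi>(3)[OF 1 uv] gX by simp
    next
      case 2
      then show ?thesis by (rule mixed[OF _ _ uv])
    next
      case 3
      then show ?thesis using mixed[OF 3(2,1) vu] by (simp add: insert_commute)
    next
      case 4
      from proper(2)[OF 4 uv] show ?thesis
      proof
        assume "nbrs H u \<inter> X = {}"
        then show ?thesis using out[OF 4(2,1) vu] by (simp add: insert_commute)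
      qed (rule out[OF 4 uv])
    qed
  qed
qed

text \<open>The shape required by \<open>bounded_net\<close>: \<open>u\<close> enters only through
  the range of summation, and the summand is a kernel in \<open>s\<close> and
  \<open>(i, b)\<close>.\<close>

lemma card_repl_eq_sum:
  assumes "fin_graph G"
  shows "real (card (repl G k u i b)) =
    (\<Sum>s\<in>verts G \<inter> nbrs G u. if \<forall>j\<in>{..<Suc k} - {i}. {s, b j} \<in> edges G then 1 else 0)"
proof -
  have "repl G k u i b = {s \<in> verts G \<inter> nbrs G u. \<forall>j\<in>{..<Suc k} - {i}. {s, b j} \<in> edges G}"
    using nbrs_subset[OF assms] by (auto simp: repl_def)
  moreover have "finite (verts G \<inter> nbrs G u)" using finite_nbrs[OF assms] by simp
  ultimately show ?thesis by (simp add: sum.If_cases Int_def)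
qed

text \<open>The cliques \<open>b\<close> with many replacements for every \<open>\<phi> x\<close>
  have positive density. Sets \<open>S (x, i)\<close> inside \<open>repl G k (\<phi> x) i b\<close>
  are fixed for a positive proportion of these \<open>b\<close>, and only then a box of such
  \<open>b\<close> is taken, so that one \<open>S\<close> serves the whole box. All tuples of the
  box are cliques, hence its sides are completely joined, and \<open>S (x, i)\<close> is joined to
  \<open>\<phi> x\<close> and to all sides but the \<open>i\<close>-th.\<close>

lemma contains_of_close_forest:
  fixes \<gamma> :: real
  assumes k: "k \<ge> 1" and \<gamma>: "\<gamma> > 0" and H: "fin_graph H" "attachment k H X col"
  shows "\<exists>\<delta>::real. \<delta> > 0 \<and> (\<exists>M. \<forall>(G :: 'v graph) v \<phi>. fin_graph G \<longrightarrow> M \<le> card (verts G) \<longrightarrow>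
     (\<forall>v\<in>verts G. (1 - 1 / k + \<gamma>) * card (verts G) \<le> card (nbrs G v)) \<longrightarrow> v \<in> verts G \<longrightarrow>
     inj_on \<phi> X \<longrightarrow> \<phi> ` X \<subseteq> verts G \<longrightarrow>
     (\<forall>x\<in>X. \<forall>y\<in>X. {x, y} \<in> edges H \<longrightarrow> {\<phi> x, \<phi> y} \<in> edges G) \<longrightarrow>
     (\<forall>x\<in>X. type_dist G k (\<phi> x) v \<le> \<delta> * card (verts G) * (k * real (card (verts G)) ^ Suc k)) \<longrightarrow>
     \<not> free_of H G)"
proof -
  define m where "m = card (verts H)"
  define \<alpha> where "\<alpha> = \<gamma> ^ Suc k"
  define c where "c = \<gamma> ^ Suc k / (4 * real k)"
  define \<delta> where "\<delta> = \<gamma> ^ Suc k * c / (8 * (real k)\<^sup>2 * (real m + 1))"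
  have fH: "finite (verts H)" using H by (simp add: fin_graph_def)
  have X: "X \<subseteq> verts H" using H(2) by (simp add: attachment_def)
  have fX: "finite X" using X fH by (rule finite_subset)
  have \<alpha>: "\<alpha> > 0" using \<gamma> by (simp add: \<alpha>_def)
  have c0: "c > 0" using \<gamma> k by (simp add: c_def)
  have \<delta>0: "\<delta> > 0"
    unfolding \<delta>_def using \<gamma> k c0 by (intro divide_pos_pos mult_pos_pos zero_less_power) (auto intro!: add_pos_nonneg)
  have c2: "c / 2 > 0" using c0 by simp
  have fXk: "finite (X \<times> {..<k})" using fX by simp
  from dense_common_subsets[OF fXk c2, where t = m and 'v = 'v and 'b = "nat \<Rightarrow> 'v"] obtain c' :: real and M1 where c': "c' > 0" and
    sub: "\<forall>(V::'v set) (B::(nat \<Rightarrow> 'v) set) S. finite V \<longrightarrow> M1 \<le> card V \<longrightarrow> finite B \<longrightarrow>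
     (\<forall>p\<in>X \<times> {..<k}. \<forall>b\<in>B. S p b \<subseteq> V \<and> c / 2 * card V \<le> card (S p b)) \<longrightarrow>
     (\<exists>T B'. B' \<subseteq> B \<and> c' * card B \<le> card B' \<and>
        (\<forall>p\<in>X \<times> {..<k}. T p \<subseteq> V \<and> card (T p) = m \<and> (\<forall>b\<in>B'. T p \<subseteq> S p b)))"
    by (elim exE conjE) (rule that)
  have "c' * (\<alpha> / 2) > 0" using c' \<alpha> by simp
  from dense_box[OF finite_lessThan[of "Suc k"] this, where t = m and 'v = 'v] obtain M2 where
    box: "\<forall>(V::'v set) R. finite V \<longrightarrow> M2 \<le> card V \<longrightarrow> R \<subseteq> PiE {..<Suc k} (\<lambda>_. V) \<longrightarrow>
      c' * (\<alpha> / 2) * real (card V) ^ card {..<Suc k} \<le> card R \<longrightarrow>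
      (\<exists>T. (\<forall>i\<in>{..<Suc k}. T i \<subseteq> V \<and> card (T i) = m) \<and> PiE {..<Suc k} T \<subseteq> R)" by (elim exE) (rule that)
  have main: "\<not> free_of H G"
    if G: "fin_graph G" and M: "M1 + M2 \<le> card (verts G)"
      and deg: "\<forall>v\<in>verts G. (1 - 1 / k + \<gamma>) * card (verts G) \<le> card (nbrs G v)" and v: "v \<in> verts G"
      and \<phi>: "inj_on \<phi> X" "\<phi> ` X \<subseteq> verts G" "\<forall>x\<in>X. \<forall>y\<in>X. {x, y} \<in> edges H \<longrightarrow> {\<phi> x, \<phi> y} \<in> edges G"
      and close: "\<forall>x\<in>X. type_dist G k (\<phi> x) v \<le> \<delta> * card (verts G) * (k * real (card (verts G)) ^ Suc k)"
    for G :: "'v graph" and v \<phi>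
  proof -
    let ?V = "verts G"
    have fV: "finite ?V" using G by (simp add: fin_graph_def)
    define B where "B = {b \<in> cliques G k v (Suc k). \<forall>u\<in>\<phi> ` X. \<forall>i<k. c / 2 * card ?V \<le> card (repl G k u i b)}"
    have "card (\<phi> ` X) \<le> m"
      using card_image_le[OF fX, of \<phi>] card_mono[OF fH X] by (simp add: m_def)
    then have B: "\<alpha> / 2 * real (card ?V) ^ Suc k \<le> card B"
      unfolding B_def \<alpha>_def
      by (intro many_good_cliques[OF G k \<gamma> _ v _ _ c_def \<delta>_def]) (use deg close fX in auto)
    have BP: "B \<subseteq> PiE {..<Suc k} (\<lambda>_. ?V)" by (auto simp: B_def cliques_def)
    have fB: "finite B" by (rule finite_subset[OF BP]) (use fV in \<open>simp add: finite_PiE\<close>)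
    have "\<exists>T B'. B' \<subseteq> B \<and> c' * card B \<le> card B' \<and>
        (\<forall>p\<in>X \<times> {..<k}. T p \<subseteq> ?V \<and> card (T p) = m \<and> (\<forall>b\<in>B'. T p \<subseteq> (\<lambda>(x,i) b. repl G k (\<phi> x) i b) p b))"
    proof (rule sub[rule_format])
      show "M1 \<le> card ?V" using M by simp
      fix p b assume p: "p \<in> X \<times> {..<k}" and b: "b \<in> B"
      obtain x i where [simp]: "p = (x, i)" by force
      have "repl G k (\<phi> x) i b \<subseteq> ?V" using nbrs_subset[OF G] by (auto simp: repl_def)
      moreover have "c / 2 * card ?V \<le> card (repl G k (\<phi> x) i b)" using b p by (auto simp: B_def)
      ultimately show "(case p of (x, i) \<Rightarrow> \<lambda>b. repl G k (\<phi> x) i b) b \<subseteq> ?V \<and>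
         c / 2 * card ?V \<le> card ((case p of (x, i) \<Rightarrow> \<lambda>b. repl G k (\<phi> x) i b) b)" by simp
    qed (use fV fB in auto)
    then obtain S B' where S: "B' \<subseteq> B" "c' * card B \<le> card B'"
      "\<forall>p\<in>X \<times> {..<k}. S p \<subseteq> ?V \<and> card (S p) = m \<and> (\<forall>b\<in>B'. S p \<subseteq> (\<lambda>(x,i) b. repl G k (\<phi> x) i b) p b)"
      by blast
    have "\<exists>T. (\<forall>i\<in>{..<Suc k}. T i \<subseteq> ?V \<and> card (T i) = m) \<and> PiE {..<Suc k} T \<subseteq> B'"
    proof (rule box[rule_format])
      show "M2 \<le> card ?V" using M by simp
      show "B' \<subseteq> PiE {..<Suc k} (\<lambda>_. ?V)" using S(1) BP by blast
      have "c' * (\<alpha> / 2) * real (card ?V) ^ Suc k \<le> c' * card B"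
        using mult_left_mono[OF B, of c'] c' by (simp add: mult_ac)
      then show "c' * (\<alpha> / 2) * real (card ?V) ^ card {..<Suc k} \<le> card B'" using S(2) by simp
    qed (rule fV)
    then obtain T where T: "\<forall>i\<in>{..<Suc k}. T i \<subseteq> ?V \<and> card (T i) = m" "PiE {..<Suc k} T \<subseteq> B'" by blast
    have "card (verts H) > 0" using H by (simp add: fin_graph_def card_gt_0_iff)
    then have Tne: "\<exists>a. a \<in> T i" if "i < Suc k" for i
      using T(1) that by (metis card.empty equals0I lessThan_iff m_def not_less_zero)
    then obtain t where t: "\<And>i. i < Suc k \<Longrightarrow> t i \<in> T i" by metis
    \<comment> \<open>Representatives \<open>t\<close> fill the remaining coordinates, so two
      elements of different sides occur together in one clique.\<close>
    have box2: "\<exists>b\<in>B'. b i = a \<and> b j = a'" if "i < Suc k" "j < Suc k" "i \<noteq> j" "a \<in> T i" "a' \<in> T j" for i j a a'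
    proof -
      let ?b = "\<lambda>l. if l < Suc k then if l = i then a else if l = j then a' else t l else undefined"
      have "?b \<in> PiE {..<Suc k} T" using that t by (auto simp: PiE_iff extensional_def)
      then show ?thesis using T(2) that by (intro bexI[of _ ?b]) auto
    qed
    have box1: "\<exists>b\<in>B'. b j = a'" if "j < Suc k" "a' \<in> T j" for j a'
    proof -
      let ?b = "\<lambda>l. if l < Suc k then if l = j then a' else t l else undefined"
      have "?b \<in> PiE {..<Suc k} T" using that t by (auto simp: PiE_iff extensional_def)
      then show ?thesis using T(2) that by (intro bexI[of _ ?b]) auto
    qed
    have SR: "S (x,i) \<subseteq> repl G k (\<phi> x) i b" if "x \<in> X" "i < k" "b \<in> B'" for x i b
    proof -
      have "(x,i) \<in> X \<times> {..<k}" using that by simp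
      with S(3) that(3) have "S (x,i) \<subseteq> (\<lambda>(x,i) b. repl G k (\<phi> x) i b) (x,i) b" by blast
      then show ?thesis by simp
    qed
    show ?thesis
    proof (rule embed_attachment[OF H \<phi>(1,2), where T = T and S = "\<lambda>x i. S (x,i)"])
      show "{\<phi> x, \<phi> y} \<in> edges G" if "x \<in> X" "y \<in> X" "{x, y} \<in> edges H" for x y
        using \<phi>(3) that by blast
      show "T i \<subseteq> ?V \<and> card (T i) = card (verts H)" if "i \<le> k" for i
        using T(1) that by (simp add: m_def)
      show "S (x, i) \<subseteq> ?V \<and> card (S (x, i)) = card (verts H)" if "x \<in> X" "i < k" for x i
        using S(3) that by (auto simp: m_def)
      show "{a, b} \<in> edges G" if ij: "i \<le> k" "j \<le> k" "i \<noteq> j" "a \<in> T i" "b \<in> T j" for i j a b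
      proof -
        obtain d where d: "d \<in> B'" "d i = a" "d j = b" using box2[of i j a b] ij by auto
        then have "d \<in> cliques G k v (Suc k)" using S(1) by (auto simp: B_def)
        then have "\<forall>i<Suc k. \<forall>i'<Suc k. i \<noteq> i' \<longrightarrow> {d i, d i'} \<in> edges G" unfolding cliques_def by blast
        then show ?thesis using d ij by auto
      qed
      show "{a, b} \<in> edges G" if ij: "x \<in> X" "i < k" "j \<le> k" "i \<noteq> j" "a \<in> S (x, i)" "b \<in> T j" for x i j a b
      proof -
        obtain d where d: "d \<in> B'" "d j = b" using box1[of j b] ij by auto
        then have "a \<in> repl G k (\<phi> x) i d" using SR[of x i d] ij by blast
        then show ?thesis using d ij by (auto simp: repl_def)
      qed
      show "{\<phi> x, a} \<in> edges G" if ij: "x \<in> X" "i < k" "a \<in> S (x, i)" for x i a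
      proof -
        obtain a' where "a' \<in> T 0" using Tne[of 0] by auto
        then obtain d where d: "d \<in> B'" using box1[of 0 a'] by auto
        then have "a \<in> repl G k (\<phi> x) i d" using SR[of x i d] ij by blast
        then show ?thesis by (simp add: repl_def nbrs_def)
      qed
    qed
  qed
  show ?thesis
    by (rule exI[of _ \<delta>], rule conjI[OF \<delta>0], rule exI[of _ "M1 + M2"], intro allI impI, rule main; assumption)
qed

section \<open>Bounding the chromatic threshold\<close>

text \<open>Each class \<open>U v\<close> is \<open>m\<close>-colourable: otherwise it contains the
  forest \<open>X\<close>, and then \<open>H\<close> is present by closeness to \<open>v\<close>.
  \<open>\<delta>\<close>, \<open>M\<close> and \<open>q\<close> are fixed before \<open>G\<close>,
  so the bound is uniform; its summand \<open>M\<close> settles graphs with fewer than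
  \<open>M\<close> vertices.\<close>

lemma bounded_chromatic_number_of_attachment:
  fixes \<gamma> :: real
  assumes k: "k \<ge> 1" and \<gamma>: "\<gamma> > 0" and H: "fin_graph H" "attachment k H X col"
  shows "\<exists>C. \<forall>G :: 'v graph. fin_graph G \<longrightarrow> free_of H G \<longrightarrow>
     (1 - 1 / k + \<gamma>) * card (verts G) \<le> min_degree G \<longrightarrow> chromatic_number G \<le> C"
proof -
  from contains_of_close_forest[OF assms, where 'v = 'v] obtain \<delta> :: real and M where \<delta>: "\<delta> > 0" and
   contains: "\<forall>(G :: 'v graph) v \<phi>. fin_graph G \<longrightarrow> M \<le> card (verts G) \<longrightarrow>
     (\<forall>v\<in>verts G. (1 - 1 / k + \<gamma>) * card (verts G) \<le> card (nbrs G v)) \<longrightarrow> v \<in> verts G \<longrightarrow>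
     inj_on \<phi> X \<longrightarrow> \<phi> ` X \<subseteq> verts G \<longrightarrow>
     (\<forall>x\<in>X. \<forall>y\<in>X. {x, y} \<in> edges H \<longrightarrow> {\<phi> x, \<phi> y} \<in> edges G) \<longrightarrow>
     (\<forall>x\<in>X. type_dist G k (\<phi> x) v \<le> \<delta> * card (verts G) * (k * real (card (verts G)) ^ Suc k)) \<longrightarrow>
     \<not> free_of H G" by (elim exE conjE) (rule that)
  define m where "m = card (verts H)"
  have fH: "finite (verts H)" "verts H \<noteq> {}" using H by (auto simp: fin_graph_def)
  have m0: "m > 0" using fH by (simp add: m_def card_gt_0_iff)
  have X: "X \<subseteq> verts H" "forest_on H X" using H(2) by (simp_all add: attachment_def)
  have fX: "finite X" using X(1) fH(1) by (rule finite_subset)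
  have cX: "card X \<le> m" using card_mono[OF fH(1) X(1)] by (simp add: m_def)
  define q where "q = nat \<lceil>8 / \<delta>\<^sup>2\<rceil>"
  have q: "8 \<le> \<delta>\<^sup>2 * real q"
  proof -
    have "8 / \<delta>\<^sup>2 \<le> q" unfolding q_def by linarith
    then show ?thesis using \<delta> by (simp add: field_simps)
  qed
  have main: "chromatic_number G \<le> M + 2 * 2 ^ q * m"
    if G: "fin_graph G" and free: "free_of H G" and deg: "(1 - 1 / k + \<gamma>) * card (verts G) \<le> min_degree G"
    for G :: "'v graph"
  proof (cases "M \<le> card (verts G)")
    case False
    then show ?thesis using chromatic_number_le[OF colourable_card_verts[OF G]] by linarith
  next
    case M: True
    let ?V = "verts G" and ?P = "PiE {..<Suc k} (\<lambda>_. verts G)"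
    have fV: "finite ?V" "?V \<noteq> {}" using G by (auto simp: fin_graph_def)
    have fP: "finite ?P" using fV by (simp add: finite_PiE)
    define \<kappa> :: "'v \<Rightarrow> nat \<times> (nat \<Rightarrow> 'v) \<Rightarrow> real" where
      "\<kappa> s = (\<lambda>(i,b). if \<forall>j\<in>{..<Suc k} - {i}. {s, b j} \<in> edges G then 1 else 0)" for s
    have td: "(\<Sum>z\<in>{..<k} \<times> ?P. \<bar>(\<Sum>s\<in>?V \<inter> nbrs G u. \<kappa> s z) - (\<Sum>s\<in>?V \<inter> nbrs G v. \<kappa> s z)\<bar>) = type_dist G k u v" for u v
      unfolding type_dist_def by (rule sum.cong) (auto simp: \<kappa>_def card_repl_eq_sum[OF G])
    have "\<exists>D\<subseteq>?V. card D \<le> 2 * 2 ^ q \<and>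
      (\<forall>u\<in>?V. \<exists>v\<in>D. (\<Sum>z\<in>{..<k} \<times> ?P. \<bar>(\<Sum>s\<in>?V \<inter> nbrs G u. \<kappa> s z) - (\<Sum>s\<in>?V \<inter> nbrs G v. \<kappa> s z)\<bar>)
         \<le> \<delta> * card ?V * card ({..<k} \<times> ?P))"
      by (rule bounded_net) (use fV fP q \<delta> in \<open>auto simp: \<kappa>_def split: prod.split\<close>)
    moreover have "card ({..<k} \<times> ?P) = k * real (card ?V) ^ Suc k"
      by (simp add: card_cartesian_product card_PiE_const)
    ultimately obtain D where D: "D \<subseteq> ?V" "card D \<le> 2 * 2 ^ q"
      "\<forall>u\<in>?V. \<exists>v\<in>D. type_dist G k u v \<le> \<delta> * card ?V * (k * real (card ?V) ^ Suc k)"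
      unfolding td by auto
    have fD: "finite D" using D(1) fV(1) by (rule finite_subset)
    define U where "U v = {u\<in>?V. type_dist G k u v \<le> \<delta> * card ?V * (k * real (card ?V) ^ Suc k)}" for v
    have "\<exists>c::'v \<Rightarrow> nat. (\<forall>u\<in>U v. c u < m) \<and> (\<forall>u\<in>U v. \<forall>w\<in>U v. {u, w} \<in> edges G \<longrightarrow> c u \<noteq> c w)" if v: "v \<in> D" for v
    proof (rule degenerate_colouring[OF G])
      show "finite (U v)" using fV by (simp add: U_def)
      fix U' assume U': "U' \<subseteq> U v" "U' \<noteq> {}"
      show "\<exists>u\<in>U'. card (nbrs G u \<inter> U') < m"
      proof (rule ccontr)
        assume neg: "\<not> ?thesis"
        have "U' \<subseteq> ?V" using U' by (auto simp: U_def)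
        then obtain \<phi> where \<phi>: "inj_on \<phi> X" "\<phi> ` X \<subseteq> U'"
            "\<forall>x\<in>X. \<forall>y\<in>X. {x, y} \<in> edges H \<longrightarrow> {\<phi> x, \<phi> y} \<in> edges G"
          using forest_embedding[OF H(1) G U'(2) _ _ fX cX X(2)] neg by (auto simp: not_less)
        have "\<not> free_of H G"
        proof (rule contains[rule_format, OF G M])
          fix w assume "w \<in> ?V"
          then show "(1 - 1 / k + \<gamma>) * card (verts G) \<le> card (nbrs G w)"
            using deg min_degree_le_card_nbrs[OF G] by fastforce
        qed (use \<phi> U' v D in \<open>auto simp: U_def\<close>)
        then show False using free by blast
      qed
    qed
    then obtain c :: "'v \<Rightarrow> 'v \<Rightarrow> nat" where c: "\<And>v u. v \<in> D \<Longrightarrow> u \<in> U v \<Longrightarrow> c v u < m"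
      "\<And>v u w. v \<in> D \<Longrightarrow> u \<in> U v \<Longrightarrow> w \<in> U v \<Longrightarrow> {u, w} \<in> edges G \<Longrightarrow> c v u \<noteq> c v w"
      by metis
    from D(3) obtain r where r: "\<And>u. u \<in> ?V \<Longrightarrow> r u \<in> D \<and> u \<in> U (r u)"
      unfolding U_def by (simp add: Bex_def) metis
    obtain e where e: "bij_betw e D {0..<card D}" using ex_bij_betw_finite_nat[OF fD] by blast
    \<comment> \<open>Encodes the pair of the class and the colour within it, recovered by
      \<open>div m\<close> and \<open>mod m\<close>.\<close>
    define f where "f u = e (r u) * m + c (r u) u" for u
    have "colourable (card D * m) G"
      unfolding colourable_def
    proof (intro exI[of _ f] conjI allI impI)
      show "f ` ?V \<subseteq> {..<card D * m}"
      proof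
        fix a assume "a \<in> f ` ?V"
        then obtain u where u: "u \<in> ?V" "a = f u" by blast
        have "e (r u) < card D" using e r[OF u(1)] by (auto simp: bij_betw_def)
        then have "Suc (e (r u)) * m \<le> card D * m" by (intro mult_right_mono) auto
        then show "a \<in> {..<card D * m}" using c(1)[of "r u" u] r[OF u(1)] u by (simp add: f_def)
      qed
      fix u w assume uw: "{u, w} \<in> edges G"
      then have V: "u \<in> ?V" "w \<in> ?V" using edge_verts[OF G] by blast+
      show "f u \<noteq> f w"
      proof
        assume eq: "f u = f w"
        have cu: "c (r u) u < m" and cw: "c (r w) w < m" using c(1) r V by blast+
        have "f u div m = f w div m" "f u mod m = f w mod m" using eq by simp_all
        then have "e (r u) = e (r w)" and same: "c (r u) u = c (r w) w"
          using cu cw by (simp_all add: f_def)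
        then have "r u = r w" using e r V by (auto simp: bij_betw_def dest: inj_onD)
        then show False using c(2)[of "r u" u w] r V uw same by metis
      qed
    qed
    then have "chromatic_number G \<le> card D * m" by (rule chromatic_number_le)
    also have "\<dots> \<le> 2 * 2 ^ q * m" using D(2) by (rule mult_right_mono) simp
    finally show ?thesis by simp
  qed
  show ?thesis by (rule exI[of _ "M + 2 * 2 ^ q * m"], intro allI impI, rule main; assumption)
qed

text \<open>In terms of \<open>k = r - 2\<close> the right-hand side is
  \<open>1 - 2 / (2 * k + 1)\<close>, which exceeds \<open>1 - 1 / k\<close> by
  \<open>1 / (k * (2 * k + 1))\<close>.\<close>

lemma chromatic_threshold_attachment:
  assumes r: "r \<ge> 3" and H: "fin_graph H" "attachment (r - 2) H X col"
  shows "chromatic_threshold H < (2 * real r - 5) / (2 * real r - 3)"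
proof -
  define k where "k = r - 2"
  have k: "k \<ge> 1" "real r = k + 2" using r by (auto simp: k_def)
  \<comment> \<open>A positive number below the gap \<open>1 / (k * (2 * k + 1))\<close>.\<close>
  define \<gamma> :: real where "\<gamma> = 1 / (real k * (4 * (real k + 1)))"
  have \<gamma>: "\<gamma> > 0" unfolding \<gamma>_def using k by (intro divide_pos_pos mult_pos_pos) (auto intro!: add_pos_nonneg)
  obtain C' where C': "\<forall>G :: nat graph. fin_graph G \<longrightarrow> free_of H G \<longrightarrow>
     (1 - 1 / k + \<gamma>) * card (verts G) \<le> min_degree G \<longrightarrow> chromatic_number G \<le> C'"
    using bounded_chromatic_number_of_attachment[OF k(1) \<gamma> H[folded k_def], where 'v = nat] by blast
  have d0: "0 \<le> 1 - 1 / real k + \<gamma>"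
  proof -
    have "1 / real k \<le> 1" using k by simp
    then show ?thesis using \<gamma> by linarith
  qed
  have "chromatic_threshold H \<le> 1 - 1 / k + \<gamma>"
    unfolding chromatic_threshold_def
    by (rule cInf_lower) (use C' d0 in \<open>auto intro: bdd_belowI[of _ 0]\<close>)
  also have "\<dots> < (2 * real r - 5) / (2 * real r - 3)"
  proof -
    have "(2 * real r - 5) / (2 * real r - 3) - (1 - 1 / k) = 1 / (real k * (2 * real k + 1))"
      using k by (simp add: field_simps)
    moreover have "\<gamma> < 1 / (real k * (2 * real k + 1))"
    proof -
      have pos: "real k > 0" using k by simp
      have "real k * (2 * real k + 1) < real k * (4 * (real k + 1))"
        using pos by (intro mult_strict_left_mono) auto
      then show ?thesis
        unfolding \<gamma>_def using pos by (intro divide_strict_left_mono mult_pos_pos) auto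
    qed
    ultimately show ?thesis by linarith
  qed
  finally show ?thesis .
qed

section \<open>An \<open>H\<close>-free subgraph with large minimum degree\<close>

lemma not_free_ofE:
  assumes "\<not> free_of H G" "fin_graph H"
  obtains g where "inj_on g (verts H)" "g ` verts H \<subseteq> verts G"
    "\<And>u v. {u, v} \<in> edges H \<Longrightarrow> {g u, g v} \<in> edges G"
proof -
  obtain F f where F: "subgraph F G" and f: "bij_betw f (verts F) (verts H)" "(\<lambda>e. f ` e) ` edges F = edges H"
    using assms unfolding free_of_def isomorphic_def by blast
  define g where "g = inv_into (verts F) f"
  have g: "bij_betw g (verts H) (verts F)" unfolding g_def by (rule bij_betw_inv_into[OF f(1)])
  have FG: "fin_graph F" "verts F \<subseteq> verts G" "edges F \<subseteq> edges G" using F by (auto simp: subgraph_def)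
  show ?thesis
  proof
    show "inj_on g (verts H)" "g ` verts H \<subseteq> verts G" using g FG(2) by (auto simp: bij_betw_def)
    fix u v assume "{u, v} \<in> edges H"
    then obtain e where e: "e \<in> edges F" "f ` e = {u, v}" using f(2) by (metis imageE)
    have "e \<subseteq> verts F" using edgeE[OF FG(1) e(1)] by auto
    then have "g ` f ` e = e" unfolding g_def using f(1) by (intro inv_into_image_cancel) (auto simp: bij_betw_def)
    then have "{g u, g v} = e" using e(2) by simp
    then show "{g u, g v} \<in> edges G" using e FG(3) by auto
  qed
qed

lemma card_le_removal:
  assumes "A \<subseteq> B \<union> W \<union> (\<Union>w\<in>Z. C w)" "finite B" "finite W" "Z \<subseteq> W" "\<And>w. w \<in> Z \<Longrightarrow> finite (C w) \<and> card (C w) \<le> D"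
  shows "card A \<le> card B + card W * (D + 1)"
proof -
  have fZ: "finite Z" using assms finite_subset by blast
  have "card (\<Union>w\<in>Z. C w) \<le> (\<Sum>w\<in>Z. card (C w))" by (rule card_UN_le[OF fZ])
  also have "\<dots> \<le> (\<Sum>w\<in>Z. D)" by (rule sum_mono) (use assms in auto)
  also have "\<dots> \<le> card W * D" using card_mono[OF assms(3,4)] by simp
  finally have UN: "card (\<Union>w\<in>Z. C w) \<le> card W * D" .
  have "card A \<le> card (B \<union> W \<union> (\<Union>w\<in>Z. C w))"
    by (rule card_mono[OF _ assms(1)]) (use assms fZ in auto)
  also have "\<dots> \<le> card B + card W + card (\<Union>w\<in>Z. C w)"
    using card_Un_le[of "B \<union> W" "\<Union>w\<in>Z. C w"] card_Un_le[of B W] by linarith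
  finally show ?thesis using UN by simp
qed

lemma card_parts_ge:
  assumes "finite N" "finite I" "\<And>i. i \<in> I \<Longrightarrow> L \<le> card {u\<in>N. c u = i}"
  shows "card I * L \<le> card {u\<in>N. c u \<in> I}"
proof -
  have "card I * L \<le> (\<Sum>i\<in>I. card {u\<in>N. c u = i})"
    using sum_mono[of I "\<lambda>_. L" "\<lambda>i. card {u\<in>N. c u = i}"] assms by simp
  also have "\<dots> = card (\<Union>i\<in>I. {u\<in>N. c u = i})"
    by (rule card_UN_disjoint[symmetric]) (use assms in auto)
  also have "(\<Union>i\<in>I. {u\<in>N. c u = i}) = {u\<in>N. c u \<in> I}" by blast
  finally show ?thesis .
qed

text \<open>A vertex of \<open>W\<close> keeps the \<open>k\<close> parts of colour below
  \<open>k\<close>, any other vertex the \<open>k\<close> parts different from its own. The only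
  further losses are vertices of \<open>W\<close> and common neighbours with members of
  \<open>W\<close>. A copy of \<open>H\<close> in \<open>G'\<close> would exhibit an
  \<open>attachment\<close> by itself, with \<open>X\<close> the part inside
  \<open>W\<close>.\<close>

lemma free_subgraph_construction:
  fixes G :: "nat graph" and \<Gamma> :: "'c graph" and H :: "'a graph" and c :: "nat \<Rightarrow> nat"
  assumes G: "fin_graph G" and H: "fin_graph H" and \<Gamma>: "fin_graph \<Gamma>"
    and noatt: "\<And>X col. \<not> attachment k H X col"
    and sparse: "\<And>X. X \<subseteq> verts \<Gamma> \<Longrightarrow> card X \<le> card (verts H) \<Longrightarrow> forest_on \<Gamma> X"
    and \<psi>: "inj_on \<psi> (verts \<Gamma>)" "\<psi> ` verts \<Gamma> \<subseteq> verts G"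
      "\<And>a b. {a, b} \<in> edges \<Gamma> \<Longrightarrow> {\<psi> a, \<psi> b} \<in> edges G"
    and c: "\<And>v. c v \<le> k"
    and deg: "\<And>v i. v \<in> verts G \<Longrightarrow> i \<le> k \<Longrightarrow> L \<le> card {u \<in> nbrs G v. c u = i}"
    and codeg: "\<And>u v. u \<in> verts G \<Longrightarrow> v \<in> verts G \<Longrightarrow> u \<noteq> v \<Longrightarrow> card (nbrs G u \<inter> nbrs G v) \<le> D"
  shows "\<exists>G'. subgraph G' G \<and> free_of H G' \<and> chromatic_number \<Gamma> \<le> chromatic_number G' \<and>
    k * L \<le> min_degree G' + card (verts \<Gamma>) * (D + 1)"
proof -
  let ?V = "verts G"
  have fV: "finite ?V" "?V \<noteq> {}" using G by (auto simp: fin_graph_def)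
  have f\<Gamma>: "finite (verts \<Gamma>)" using \<Gamma> by (simp add: fin_graph_def)
  define W where "W = \<psi> ` verts \<Gamma>"
  have fW: "finite W" using f\<Gamma> by (simp add: W_def)
  have WV: "W \<subseteq> ?V" using \<psi>(2) by (simp add: W_def)
  have cW: "card W = card (verts \<Gamma>)" unfolding W_def by (rule card_image[OF \<psi>(1)])
  define E1 where "E1 = (\<lambda>e. \<psi> ` e) ` edges \<Gamma>"
  define E2 where "E2 = {{w, s} |w s. w \<in> W \<and> s \<notin> W \<and> {w, s} \<in> edges G \<and> nbrs G s \<inter> W = {w} \<and> c s < k}"
  define E3 where "E3 = {{u, v} |u v. u \<notin> W \<and> v \<notin> W \<and> {u, v} \<in> edges G \<and> c u \<noteq> c v \<and>
     (nbrs G u \<inter> W = {} \<or> nbrs G v \<inter> W = {})}"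
  define G' where "G' = (?V, E1 \<union> E2 \<union> E3)"
  have E1W: "e \<subseteq> W" "e \<in> edges G" if e: "e \<in> E1" for e
  proof -
    obtain e' where e': "e' \<in> edges \<Gamma>" "e = \<psi> ` e'" using e by (auto simp: E1_def)
    obtain a b where ab: "e' = {a, b}" "a \<in> verts \<Gamma>" "b \<in> verts \<Gamma>" using edgeE[OF \<Gamma> e'(1)] by metis
    then show "e \<subseteq> W" "e \<in> edges G" using e' \<psi>(3)[of a b] by (auto simp: W_def)
  qed
  have EG: "edges G' \<subseteq> edges G" using E1W(2) by (auto simp: G'_def E2_def E3_def)
  have G'fin: "fin_graph G'"
    unfolding fin_graph_def
  proof (intro conjI)
    show "edges G' \<subseteq> [verts G']\<^bsup>2\<^esup>" using EG G by (auto simp: fin_graph_def G'_def)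
  qed (use fV in \<open>auto simp: G'_def\<close>)
  have sub: "subgraph G' G" using G'fin EG by (simp add: subgraph_def G'_def)
  have WW: "{u, v} \<in> E1" if "u \<in> W" "v \<in> W" "{u, v} \<in> edges G'" for u v
    using that by (auto simp: G'_def E2_def E3_def doubleton_eq_iff)
  have WS: "{w, s} \<in> edges G' \<longleftrightarrow> {w, s} \<in> edges G \<and> nbrs G s \<inter> W = {w} \<and> c s < k" if ws: "w \<in> W" "s \<notin> W" for w s
  proof
    assume "{w, s} \<in> edges G'"
    then have "{w, s} \<in> E2" using ws E1W(1) by (auto simp: G'_def E3_def doubleton_eq_iff)
    then show "{w, s} \<in> edges G \<and> nbrs G s \<inter> W = {w} \<and> c s < k"
      using ws by (auto simp: E2_def doubleton_eq_iff)
  next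
    assume "{w, s} \<in> edges G \<and> nbrs G s \<inter> W = {w} \<and> c s < k"
    then have "{w, s} \<in> E2" using ws unfolding E2_def by blast
    then show "{w, s} \<in> edges G'" by (simp add: G'_def)
  qed
  have SS: "{u, v} \<in> edges G' \<longleftrightarrow> {u, v} \<in> edges G \<and> c u \<noteq> c v \<and> (nbrs G u \<inter> W = {} \<or> nbrs G v \<inter> W = {})"
    if uv: "u \<notin> W" "v \<notin> W" for u v
  proof
    assume "{u, v} \<in> edges G'"
    then have "{u, v} \<in> E3" using uv E1W(1) by (auto simp: G'_def E2_def doubleton_eq_iff)
    then show "{u, v} \<in> edges G \<and> c u \<noteq> c v \<and> (nbrs G u \<inter> W = {} \<or> nbrs G v \<inter> W = {})"
      using uv by (auto simp: E3_def doubleton_eq_iff insert_commute)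
  next
    assume "{u, v} \<in> edges G \<and> c u \<noteq> c v \<and> (nbrs G u \<inter> W = {} \<or> nbrs G v \<inter> W = {})"
    then have "{u, v} \<in> E3" using uv unfolding E3_def by blast
    then show "{u, v} \<in> edges G'" by (simp add: G'_def)
  qed
  have mindeg: "k * L \<le> card (nbrs G' v) + card (verts \<Gamma>) * (D + 1)" if v: "v \<in> ?V" for v
  proof -
    have cod: "finite (nbrs G v \<inter> nbrs G w) \<and> card (nbrs G v \<inter> nbrs G w) \<le> D" if "w \<in> W - {v}" for w
      using codeg[of v w] that WV v finite_nbrs[OF G] by auto
    have fin: "finite (nbrs G' v)" by (rule finite_nbrs[OF G'fin])
    show ?thesis
    proof (cases "v \<in> W")
      case True
      have "card {..<k} * L \<le> card {u\<in>nbrs G v. c u \<in> {..<k}}"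
        by (rule card_parts_ge) (use deg[OF v] finite_nbrs[OF G] in auto)
      also have "\<dots> \<le> card (nbrs G' v) + card W * (D + 1)"
      proof (rule card_le_removal[OF _ fin fW, where Z = "W - {v}" and C = "\<lambda>w. nbrs G v \<inter> nbrs G w"])
        show "{u\<in>nbrs G v. c u \<in> {..<k}} \<subseteq> nbrs G' v \<union> W \<union> (\<Union>w\<in>W - {v}. nbrs G v \<inter> nbrs G w)"
        proof
          fix u assume u: "u \<in> {u\<in>nbrs G v. c u \<in> {..<k}}"
          show "u \<in> nbrs G' v \<union> W \<union> (\<Union>w\<in>W - {v}. nbrs G v \<inter> nbrs G w)"
          proof (cases "u \<in> W \<or> (\<exists>w\<in>W - {v}. u \<in> nbrs G w)")
            case False
            have "nbrs G u \<inter> W = {v}"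
              using False u True by (auto simp: mem_nbrs_sym[of _ G u])
            then have "u \<in> nbrs G' v" using WS[of v u] False u True by (auto simp: nbrs_def)
            then show ?thesis by simp
          qed (use u in auto)
        qed
      qed (use cod in auto)
      finally show ?thesis by (simp add: cW)
    next
      case False
      have "card ({..k} - {c v}) * L \<le> card {u\<in>nbrs G v. c u \<in> {..k} - {c v}}"
        by (rule card_parts_ge) (use deg[OF v] finite_nbrs[OF G] in auto)
      also have "\<dots> \<le> card (nbrs G' v) + card W * (D + 1)"
      proof (rule card_le_removal[OF _ fin fW, where Z = W and C = "\<lambda>w. nbrs G v \<inter> nbrs G w"])
        show "{u\<in>nbrs G v. c u \<in> {..k} - {c v}} \<subseteq> nbrs G' v \<union> W \<union> (\<Union>w\<in>W. nbrs G v \<inter> nbrs G w)"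
        proof
          fix u assume u: "u \<in> {u\<in>nbrs G v. c u \<in> {..k} - {c v}}"
          show "u \<in> nbrs G' v \<union> W \<union> (\<Union>w\<in>W. nbrs G v \<inter> nbrs G w)"
          proof (cases "u \<in> W \<or> (\<exists>w\<in>W. u \<in> nbrs G w)")
            case no: False
            have "nbrs G u \<inter> W = {}" using no by (auto simp: mem_nbrs_sym[of _ G u])
            then have "u \<in> nbrs G' v" using SS[of v u] False no u by (auto simp: nbrs_def)
            then show ?thesis by simp
          qed (use u in auto)
        qed
      qed (use cod False in auto)
      also have "card ({..k} - {c v}) = k" using c[of v] by simp
      finally show ?thesis by (simp add: cW)
    qed
  qed
  have "min_degree G' \<in> degree G' ` ?V"
    unfolding min_degree_def using fV by (auto simp: G'_def intro!: Min_in)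
  then obtain v where "v \<in> ?V" "min_degree G' = card (nbrs G' v)"
    using degree_eq_card_nbrs[OF G'fin] by auto
  then have min: "k * L \<le> min_degree G' + card (verts \<Gamma>) * (D + 1)" using mindeg by simp
  have chi: "chromatic_number \<Gamma> \<le> chromatic_number G'"
  proof (rule chromatic_number_le)
    obtain f :: "nat \<Rightarrow> nat" where f: "f ` verts G' \<subseteq> {..<chromatic_number G'}"
      "\<forall>u v. {u, v} \<in> edges G' \<longrightarrow> f u \<noteq> f v"
      using colourable_chromatic_number[OF G'fin] unfolding colourable_def by blast
    have "{\<psi> u, \<psi> v} \<in> edges G'" if "{u, v} \<in> edges \<Gamma>" for u v
    proof -
      have "\<psi> ` {u, v} \<in> E1" unfolding E1_def using that by (rule imageI)
      then show ?thesis by (simp add: G'_def)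
    qed
    moreover have "verts G' = ?V" by (simp add: G'_def)
    ultimately show "colourable (chromatic_number G') \<Gamma>"
      unfolding colourable_def using f \<psi>(2)
      by (intro exI[of _ "f \<circ> \<psi>"] conjI allI impI) (auto simp only: image_comp o_apply image_subset_iff)
  qed
  have free: "free_of H G'"
  proof (rule ccontr)
    assume "\<not> free_of H G'"
    then obtain g where g: "inj_on g (verts H)" "g ` verts H \<subseteq> verts G'"
      and hom: "\<And>u v. {u, v} \<in> edges H \<Longrightarrow> {g u, g v} \<in> edges G'"
      using H by (rule not_free_ofE) (rule that)
    have fH: "finite (verts H)" using H by (simp add: fin_graph_def)
    define X where "X = {x\<in>verts H. g x \<in> W}"
    \<comment> \<open>Pulls the part of the copy inside \<open>W\<close> back to
      \<open>\<Gamma>\<close>. Edges of \<open>G'\<close> inside \<open>W\<close> all come from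
      \<open>\<Gamma>\<close>, so \<open>\<theta>\<close> preserves edges.\<close>
    define \<theta> where "\<theta> x = inv_into (verts \<Gamma>) \<psi> (g x)" for x
    have \<theta>: "\<theta> x \<in> verts \<Gamma>" "\<psi> (\<theta> x) = g x" if "x \<in> X" for x
      using that by (auto simp: X_def W_def \<theta>_def inv_into_into f_inv_into_f)
    have \<theta>inj: "inj_on \<theta> X"
    proof (rule inj_onI)
      fix x y assume xy: "x \<in> X" "y \<in> X" "\<theta> x = \<theta> y"
      then have "g x = g y" using \<theta>(2) by metis
      then show "x = y" using g(1) xy by (auto simp: X_def dest: inj_onD)
    qed
    have \<theta>hom: "{\<theta> x, \<theta> y} \<in> edges \<Gamma>" if xy: "x \<in> X" "y \<in> X" "{x, y} \<in> edges H" for x y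
    proof -
      have "{g x, g y} \<in> E1" using WW hom[OF xy(3)] xy by (auto simp: X_def)
      then obtain e where e: "e \<in> edges \<Gamma>" "{g x, g y} = \<psi> ` e" by (auto simp: E1_def)
      have "e \<subseteq> verts \<Gamma>" using edgeE[OF \<Gamma> e(1)] by auto
      moreover have "\<psi> ` e = \<psi> ` {\<theta> x, \<theta> y}" using \<theta>(2) xy e(2) by simp
      moreover have "{\<theta> x, \<theta> y} \<subseteq> verts \<Gamma>" using \<theta>(1) xy by simp
      ultimately have "e = {\<theta> x, \<theta> y}" using inj_on_image_eq_iff[OF \<psi>(1)] by metis
      then show ?thesis using e by simp
    qed
    have XH: "X \<subseteq> verts H" by (auto simp: X_def)
    have "forest_on H X"
      unfolding forest_on_def
    proof (intro allI impI)
      fix Y assume Y: "Y \<subseteq> X" "Y \<noteq> {}"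
      have YH: "Y \<subseteq> verts H" using Y XH by blast
      have fY: "finite Y" using YH fH by (rule finite_subset)
      have "card (\<theta> ` Y) \<le> card (verts H)"
        using card_image_le[OF fY, of \<theta>] card_mono[OF fH YH] by linarith
      \<comment> \<open>Acyclicity of \<open>\<Gamma>\<close> is known only for sets of at most
        \<open>card (verts H)\<close> vertices, and a copy of \<open>H\<close> cannot involve
        more.\<close>
      then have "forest_on \<Gamma> (\<theta> ` Y)" by (intro sparse) (use \<theta>(1) Y in auto)
      then obtain y where y: "y \<in> Y" "card (nbrs \<Gamma> (\<theta> y) \<inter> \<theta> ` Y) \<le> 1"
        unfolding forest_on_def using Y(2) by blast
      have "card (nbrs H y \<inter> Y) \<le> card (nbrs \<Gamma> (\<theta> y) \<inter> \<theta> ` Y)"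
      proof (rule card_inj_on_le)
        show "inj_on \<theta> (nbrs H y \<inter> Y)" using \<theta>inj Y(1) by (meson inf_le2 inj_on_subset order_trans)
        show "\<theta> ` (nbrs H y \<inter> Y) \<subseteq> nbrs \<Gamma> (\<theta> y) \<inter> \<theta> ` Y"
          using \<theta>hom[of y] y(1) Y(1) by (auto simp: nbrs_def)
      qed (use fY in simp)
      then show "\<exists>y\<in>Y. card (nbrs H y \<inter> Y) \<le> 1" using y by force
    qed
    moreover have "c (g y) \<le> k \<and> card (nbrs H y \<inter> X) \<le> 1 \<and> (nbrs H y \<inter> X \<noteq> {} \<longrightarrow> c (g y) < k)"
      if y: "y \<in> verts H - X" for y
    proof -
      have gy: "g y \<notin> W" using y by (auto simp: X_def)
      have nb: "nbrs G (g y) \<inter> W = {g x} \<and> c (g y) < k" if "x \<in> nbrs H y \<inter> X" for x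
      proof -
        have "{g x, g y} \<in> edges G'" using hom[of x y] that by (simp add: nbrs_def insert_commute)
        then show ?thesis using WS[of "g x" "g y"] gy that by (auto simp: X_def)
      qed
      have "x = x'" if x: "x \<in> nbrs H y \<inter> X" "x' \<in> nbrs H y \<inter> X" for x x'
      proof -
        have "{g x} = {g x'}" using nb[OF x(1)] nb[OF x(2)] by simp
        then show ?thesis using g(1) x XH by (auto dest: inj_onD)
      qed
      moreover have "finite (nbrs H y \<inter> X)" using finite_nbrs[OF H] by simp
      ultimately have "card (nbrs H y \<inter> X) \<le> 1" by (simp add: card_le_Suc0_iff_eq)
      then show ?thesis using c nb by blast
    qed
    moreover have "c (g y) \<noteq> c (g z) \<and> (nbrs H y \<inter> X = {} \<or> nbrs H z \<inter> X = {})"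
      if yz: "y \<in> verts H - X" "z \<in> verts H - X" "{y, z} \<in> edges H" for y z
    proof -
      have nW: "g y \<notin> W" "g z \<notin> W" using yz by (auto simp: X_def)
      \<comment> \<open>A neighbour of \<open>y\<close> in \<open>X\<close> would give
        \<open>g y\<close> a neighbour in \<open>W\<close> already in \<open>G\<close>.\<close>
      have *: "nbrs H y \<inter> X = {}" if "nbrs G (g y) \<inter> W = {}" for y
      proof (rule ccontr)
        assume "\<not> ?thesis"
        then obtain x where x: "x \<in> nbrs H y" "g x \<in> W" by (auto simp: X_def)
        then have "{g y, g x} \<in> edges G" using hom[of y x] EG by (auto simp: nbrs_def)
        then show False using that x(2) by (auto simp: nbrs_def)
      qed
      show ?thesis using SS[OF nW] hom[OF yz(3)] * by blast
    qed
    ultimately have "attachment k H X (\<lambda>y. c (g y))" using XH by (simp add: attachment_def)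
    then show False using noatt by blast
  qed
  show ?thesis using sub free chi min by blast
qed

section \<open>Independent edges\<close>

text \<open>An event that ignores the coordinates outside \<open>A'\<close> does not change when
  these are set to the default \<open>d\<close>.\<close>

lemma prob_Pi_pmf_subset:
  assumes "finite A" "A' \<subseteq> A" and Q: "\<And>f g. (\<And>x. x \<in> A' \<Longrightarrow> f x = g x) \<Longrightarrow> Q f = Q g"
  shows "measure_pmf.prob (Pi_pmf A d p) {f. Q f} = measure_pmf.prob (Pi_pmf A' d p) {f. Q f}"
proof -
  have "Q (\<lambda>x. if x \<in> A' then f x else d) = Q f" for f by (rule Q) simp
  then show ?thesis
    unfolding Pi_pmf_subset[OF assms(1,2)] measure_map_pmf by (simp add: vimage_def)
qed

lemma prob_Pi_pmf_union:
  assumes AB: "finite A" "finite B" "A \<inter> B = {}"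
    and Q: "\<And>f g. (\<And>x. x \<in> A \<Longrightarrow> f x = g x) \<Longrightarrow> Q f = Q g"
    and R: "\<And>f g. (\<And>x. x \<in> B \<Longrightarrow> f x = g x) \<Longrightarrow> R f = R g"
  shows "measure_pmf.prob (Pi_pmf (A \<union> B) d p) {f. Q f \<and> R f} =
    measure_pmf.prob (Pi_pmf A d p) {f. Q f} * measure_pmf.prob (Pi_pmf B d p) {f. R f}"
proof -
  let ?P = "Pi_pmf A d p" and ?P' = "Pi_pmf B d p"
  have Q': "Q (\<lambda>x. if x \<in> A then f x else g x) = Q f" for f g by (rule Q) simp
  have R': "R (\<lambda>x. if x \<in> A then f x else g x) = R g" for f g by (rule R) (use AB in auto)
  have "measure_pmf.prob (Pi_pmf (A \<union> B) d p) {f. Q f \<and> R f} =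
    measure_pmf.prob (pair_pmf ?P ?P') ({f. Q f} \<times> {f. R f})"
    unfolding Pi_pmf_union[OF AB] measure_map_pmf
    by (rule arg_cong2[where f = measure]) (auto simp: Q' R')
  \<comment> \<open>The product rule is for countable sets, and supports are countable.\<close>
  also have "\<dots> = measure_pmf.prob (pair_pmf ?P ?P') (({f. Q f} \<inter> set_pmf ?P) \<times> ({f. R f} \<inter> set_pmf ?P'))"
    by (subst measure_Int_set_pmf[symmetric]) (auto intro!: arg_cong2[where f = measure])
  also have "\<dots> = measure_pmf.prob ?P ({f. Q f} \<inter> set_pmf ?P) * measure_pmf.prob ?P' ({f. R f} \<inter> set_pmf ?P')"
    by (rule measure_pmf_prob_product) auto
  finally show ?thesis by (simp add: measure_Int_set_pmf)
qed

context
  fixes A :: "'e set" and p :: real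
  assumes A: "finite A" and p: "0 \<le> p" "p \<le> 1"
begin

abbreviation "bern \<equiv> Pi_pmf A False (\<lambda>_. bernoulli_pmf p)"

lemma prob_all_present:
  assumes "E \<subseteq> A"
  shows "measure_pmf.prob bern {X. \<forall>e\<in>E. X e} = p ^ card E"
proof -
  have fE: "finite E" using assms A by (rule finite_subset)
  have "measure_pmf.prob bern {X. \<forall>e\<in>E. X e} =
    measure_pmf.prob (Pi_pmf E False (\<lambda>_. bernoulli_pmf p)) {X. \<forall>e\<in>E. X e}"
    by (rule prob_Pi_pmf_subset[OF A assms]) auto
  also have "\<dots> = measure_pmf.prob (Pi_pmf E False (\<lambda>_. bernoulli_pmf p)) (Pi E (\<lambda>_. {True}))"
    by (rule arg_cong2[where f = measure]) auto
  also have "\<dots> = p ^ card E"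
    using p fE by (simp add: measure_Pi_pmf_Pi measure_pmf_single)
  finally show ?thesis .
qed

lemma prob_all_absent:
  assumes "E \<subseteq> A"
  shows "measure_pmf.prob bern {X. \<forall>e\<in>E. \<not> X e} = (1 - p) ^ card E"
proof -
  have fE: "finite E" using assms A by (rule finite_subset)
  have "measure_pmf.prob bern {X. \<forall>e\<in>E. \<not> X e} =
    measure_pmf.prob (Pi_pmf E False (\<lambda>_. bernoulli_pmf p)) {X. \<forall>e\<in>E. \<not> X e}"
    by (rule prob_Pi_pmf_subset[OF A assms]) auto
  also have "\<dots> = measure_pmf.prob (Pi_pmf E False (\<lambda>_. bernoulli_pmf p)) (Pi E (\<lambda>_. {False}))"
    by (rule arg_cong2[where f = measure]) auto
  also have "\<dots> = (1 - p) ^ card E"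
    using p fE by (simp add: measure_Pi_pmf_Pi measure_pmf_single)
  finally show ?thesis .
qed

text \<open>Hoeffding's lower tail: the number of present elements of \<open>E\<close> is binomially
  distributed.\<close>

lemma prob_few_present:
  assumes "E \<subseteq> A" "E \<noteq> {}" "t \<ge> 0"
  shows "measure_pmf.prob bern {X. card {e\<in>E. X e} \<le> card E * p - t} \<le> exp (- 2 * t\<^sup>2 / card E)"
proof -
  have fE: "finite E" using assms(1) A by (rule finite_subset)
  interpret binomial_distribution "card E" p by unfold_locales (use p in auto)
  have "measure_pmf.prob bern {X. card {e\<in>E. X e} \<le> card E * p - t} =
    measure_pmf.prob (Pi_pmf E False (\<lambda>_. bernoulli_pmf p)) {X. card {e\<in>E. X e} \<le> card E * p - t}"
  proof (rule prob_Pi_pmf_subset[OF A assms(1)])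
    fix f g :: "'e \<Rightarrow> bool" assume "\<And>x. x \<in> E \<Longrightarrow> f x = g x"
    then have "{e\<in>E. f e} = {e\<in>E. g e}" by auto
    then show "(card {e\<in>E. f e} \<le> card E * p - t) = (card {e\<in>E. g e} \<le> card E * p - t)" by simp
  qed
  also have "\<dots> = measure_pmf.prob (binomial_pmf (card E) p) {x. real x \<le> card E * p - t}"
    using p fE by (subst binomial_pmf_altdef'[OF fE refl, where dflt = False]) (auto simp: measure_map_pmf vimage_def)
  also have "\<dots> \<le> exp (- 2 * t\<^sup>2 / card E)"
    by (rule prob_le) (use assms fE in \<open>auto simp: card_gt_0_iff\<close>)
  finally show ?thesis .
qed

text \<open>Disjoint blocks are independent, and each is completely present with probability
  \<open>p ^ L\<close>.\<close>

lemma prob_no_block_present: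
  assumes "\<And>j. j < J \<Longrightarrow> E j \<subseteq> A \<and> card (E j) = L"
    and "\<And>i j. i < J \<Longrightarrow> j < J \<Longrightarrow> i \<noteq> j \<Longrightarrow> E i \<inter> E j = {}"
  shows "measure_pmf.prob bern {X. \<forall>j<J. \<exists>e\<in>E j. \<not> X e} = (1 - p ^ L) ^ J"
  using assms
proof (induction J)
  case 0
  then show ?case by simp
next
  case (Suc J)
  let ?U = "\<Union>j<J. E j" and ?bern = "\<lambda>A. Pi_pmf A False (\<lambda>_. bernoulli_pmf p)"
  have U: "?U \<subseteq> A" "E J \<subseteq> A" using Suc.prems(1) by (auto simp: less_Suc_eq)
  have "E j \<inter> E J = {}" if "j < J" for j using Suc.prems(2)[of j J] that by simp
  then have UJ: "?U \<inter> E J = {}" by blast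
  have fin: "finite ?U" "finite (E J)" using U finite_subset[OF _ A] by blast+
  have dep: "(\<forall>j<J. \<exists>e\<in>E j. \<not> f e) = (\<forall>j<J. \<exists>e\<in>E j. \<not> g e)"
    if agree: "\<And>x. x \<in> ?U \<Longrightarrow> f x = g x" for f g
  proof -
    have "(\<exists>e\<in>E j. \<not> f e) = (\<exists>e\<in>E j. \<not> g e)" if "j < J" for j
      by (rule bex_cong[OF refl]) (use agree that in auto)
    then show ?thesis by simp
  qed
  have "measure_pmf.prob bern {X. \<forall>j<Suc J. \<exists>e\<in>E j. \<not> X e} =
    measure_pmf.prob bern {X. (\<forall>j<J. \<exists>e\<in>E j. \<not> X e) \<and> (\<exists>e\<in>E J. \<not> X e)}"
    by (rule arg_cong2[where f = measure]) (auto simp: less_Suc_eq)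
  also have "\<dots> = measure_pmf.prob (?bern (?U \<union> E J)) {X. (\<forall>j<J. \<exists>e\<in>E j. \<not> X e) \<and> (\<exists>e\<in>E J. \<not> X e)}"
  proof (rule prob_Pi_pmf_subset[OF A])
    fix f g :: "'e \<Rightarrow> bool" assume agree: "\<And>x. x \<in> ?U \<union> E J \<Longrightarrow> f x = g x"
    have "(\<exists>e\<in>E J. \<not> f e) = (\<exists>e\<in>E J. \<not> g e)"
      by (rule bex_cong[OF refl]) (use agree in auto)
    then show "((\<forall>j<J. \<exists>e\<in>E j. \<not> f e) \<and> (\<exists>e\<in>E J. \<not> f e)) = ((\<forall>j<J. \<exists>e\<in>E j. \<not> g e) \<and> (\<exists>e\<in>E J. \<not> g e))"
      using dep[of f g] agree by auto
  qed (use U in auto)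
  also have "\<dots> = measure_pmf.prob (?bern ?U) {X. \<forall>j<J. \<exists>e\<in>E j. \<not> X e} * measure_pmf.prob (?bern (E J)) {X. \<exists>e\<in>E J. \<not> X e}"
    by (rule prob_Pi_pmf_union[OF fin UJ]) (rule dep, auto)
  also have "measure_pmf.prob (?bern ?U) {X. \<forall>j<J. \<exists>e\<in>E j. \<not> X e} = measure_pmf.prob bern {X. \<forall>j<J. \<exists>e\<in>E j. \<not> X e}"
    by (rule prob_Pi_pmf_subset[OF A U(1), symmetric]) (rule dep, auto)
  also have "\<dots> = (1 - p ^ L) ^ J"
    by (rule Suc.IH) (use Suc.prems in auto)
  also have "measure_pmf.prob (?bern (E J)) {X. \<exists>e\<in>E J. \<not> X e} = measure_pmf.prob bern {X. \<exists>e\<in>E J. \<not> X e}"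
    by (rule prob_Pi_pmf_subset[OF A U(2), symmetric]) auto
  also have "{X. \<exists>e\<in>E J. \<not> X e} = UNIV - {X. \<forall>e\<in>E J. X e}" by auto
  also have "measure_pmf.prob bern (UNIV - {X. \<forall>e\<in>E J. X e}) = 1 - measure_pmf.prob bern {X. \<forall>e\<in>E J. X e}"
    using measure_pmf.prob_compl[of "{X. \<forall>e\<in>E J. X e}" bern] by simp
  also have "measure_pmf.prob bern {X. \<forall>e\<in>E J. X e} = p ^ L"
    using prob_all_present[OF U(2)] Suc.prems(1)[of J] by simp
  finally show ?case by simp
qed

end

lemma prob_Union_le:
  fixes b :: real
  assumes "finite I" "\<And>i. i \<in> I \<Longrightarrow> measure_pmf.prob M (B i) \<le> b"
  shows "measure_pmf.prob M (\<Union>i\<in>I. B i) \<le> card I * b"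
proof -
  have "measure_pmf.prob M (\<Union>i\<in>I. B i) \<le> (\<Sum>i\<in>I. measure_pmf.prob M (B i))"
    by (rule measure_pmf.finite_measure_subadditive_finite[OF assms(1)]) auto
  also have "\<dots> \<le> card I * b" using sum_mono[of I "\<lambda>i. measure_pmf.prob M (B i)" "\<lambda>_. b"] assms(2) by simp
  finally show ?thesis .
qed

section \<open>Codegrees\<close>

text \<open>Union bound over the \<open>n choose D\<close> candidate sets of \<open>D\<close> common
  neighbours, each of which prescribes \<open>2 * D\<close> distinct edges.\<close>

lemma prob_codegree_ge:
  fixes p :: real
  assumes p: "0 \<le> p" "p \<le> 1" and uv: "u < n" "v < n" "u \<noteq> v"
  shows "measure_pmf.prob (Pi_pmf ([{..<n}]\<^bsup>2\<^esup>) False (\<lambda>_. bernoulli_pmf p))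
     {X. D \<le> card {a\<in>{..<n} - {u, v}. X {u, a} \<and> X {v, a}}} \<le> real (n choose D) * p ^ (2 * D)"
proof -
  let ?M = "Pi_pmf ([{..<n}]\<^bsup>2\<^esup>) False (\<lambda>_. bernoulli_pmf p)"
  have fA: "finite ([{..<n}]\<^bsup>2\<^esup>)" by (simp add: finite_imp_finite_nsets)
  define \<S> where "\<S> = {S. S \<subseteq> {..<n} \<and> card S = D}"
  have f\<S>: "finite \<S>" by (simp add: \<S>_def)
  define B where "B S = {X. S \<subseteq> {..<n} - {u, v} \<and> (\<forall>e\<in>(\<lambda>a. {u, a}) ` S \<union> (\<lambda>a. {v, a}) ` S. X e)}" for S
  have sub: "{X. D \<le> card {a\<in>{..<n} - {u, v}. X {u, a} \<and> X {v, a}}} \<subseteq> (\<Union>S\<in>\<S>. B S)"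
  proof
    fix X assume "X \<in> {X. D \<le> card {a\<in>{..<n} - {u, v}. X {u, a} \<and> X {v, a}}}"
    then have "D \<le> card {a\<in>{..<n} - {u, v}. X {u, a} \<and> X {v, a}}" by simp
    then obtain S where "S \<subseteq> {a\<in>{..<n} - {u, v}. X {u, a} \<and> X {v, a}}" "card S = D"
      by (rule obtain_subset_with_card_n)
    then show "X \<in> (\<Union>S\<in>\<S>. B S)" by (intro UN_I[of S]) (auto simp: \<S>_def B_def)
  qed
  have "measure_pmf.prob ?M (B S) \<le> p ^ (2 * D)" if S: "S \<in> \<S>" for S
  proof (cases "S \<subseteq> {..<n} - {u, v}")
    case True
    let ?E = "(\<lambda>a. {u, a}) ` S \<union> (\<lambda>a. {v, a}) ` S"
    have fS: "finite S" using S finite_subset[of S "{..<n}"] by (auto simp: \<S>_def)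
    have "card ?E = card ((\<lambda>a. {u, a}) ` S) + card ((\<lambda>a. {v, a}) ` S)"
      by (rule card_Un_disjoint) (use fS True uv in \<open>auto simp: doubleton_eq_iff\<close>)
    also have "card ((\<lambda>a. {u, a}) ` S) = card S" by (rule card_image) (auto simp: inj_on_def doubleton_eq_iff)
    also have "card ((\<lambda>a. {v, a}) ` S) = card S" by (rule card_image) (auto simp: inj_on_def doubleton_eq_iff)
    finally have "card ?E = 2 * D" using S by (simp add: \<S>_def)
    moreover have "?E \<subseteq> [{..<n}]\<^bsup>2\<^esup>" using True uv by auto
    then have "measure_pmf.prob ?M {X. \<forall>e\<in>?E. X e} = p ^ card ?E"
      by (rule prob_all_present[OF fA p])
    moreover have "B S = {X. \<forall>e\<in>?E. X e}" unfolding B_def using True by simp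
    ultimately show ?thesis by simp
  next
    case False
    then have "B S = {}" by (simp add: B_def)
    then show ?thesis using p by simp
  qed
  then have "measure_pmf.prob ?M (\<Union>S\<in>\<S>. B S) \<le> card \<S> * p ^ (2 * D)"
    using prob_Union_le[OF f\<S>, where M = ?M and B = B and b = "p ^ (2 * D)"] by blast
  moreover have "card \<S> = n choose D" using n_subsets[of "{..<n}" D] by (simp add: \<S>_def)
  moreover have "measure_pmf.prob ?M {X. D \<le> card {a\<in>{..<n} - {u, v}. X {u, a} \<and> X {v, a}}} \<le>
      measure_pmf.prob ?M (\<Union>S\<in>\<S>. B S)"
    by (rule measure_pmf.finite_measure_mono[OF sub]) simp
  ultimately show ?thesis by simp
qed

text \<open>A single term of the exponential series.\<close>

lemma power_self_le_fact_exp: "real D ^ D \<le> fact D * exp (real D)"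
proof -
  have sums: "(\<lambda>i. real D ^ i /\<^sub>R fact i) sums exp (real D)" by (rule exp_converges)
  have "(\<Sum>i\<in>{D}. real D ^ i /\<^sub>R fact i) \<le> (\<Sum>i. real D ^ i /\<^sub>R fact i)"
    by (rule sum_le_suminf) (use sums in \<open>auto simp: sums_iff\<close>)
  also have "\<dots> = exp (real D)" using sums by (simp add: sums_iff)
  finally show ?thesis by (simp add: field_simps)
qed

text \<open>The left side is at most \<open>(n * p ^ 2) ^ D / D! \<le> (D / 6) ^ D / D! \<le> (e /
  6) ^ D\<close>, and 6 is twice the upper bound 3 for \<open>e\<close>.\<close>

lemma binomial_power_le_half_power:
  fixes p :: real
  assumes p: "0 \<le> p" and D: "6 * p\<^sup>2 * n \<le> D"
  shows "real (n choose D) * p ^ (2 * D) \<le> (1 / 2) ^ D"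
proof -
  have e3: "exp (real D) \<le> 3 ^ D"
  proof -
    have "exp (real D) = exp 1 ^ D" by (simp flip: exp_of_nat_mult)
    also have "\<dots> \<le> 3 ^ D" by (rule power_mono) (use exp_le in auto)
    finally show ?thesis .
  qed
  have "real (n choose D) * fact D \<le> real n ^ D"
    using binomial_fact_pow[of n D] by (metis of_nat_fact of_nat_le_iff of_nat_mult of_nat_power)
  then have "fact D * (real (n choose D) * p ^ (2 * D)) \<le> real n ^ D * p ^ (2 * D)"
    using mult_right_mono[of "real (n choose D) * fact D" "real n ^ D" "p ^ (2 * D)"] p by (simp add: mult_ac)
  also have "\<dots> = (p\<^sup>2 * n) ^ D" by (simp add: power_mult_distrib power_mult)
  also have "\<dots> \<le> (D / 6) ^ D" by (rule power_mono) (use D p in auto)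
  also have "\<dots> = real D ^ D / 6 ^ D" by (simp add: power_divide)
  also have "\<dots> \<le> fact D * 3 ^ D / 6 ^ D"
    by (intro divide_right_mono order_trans[OF power_self_le_fact_exp] mult_left_mono e3) auto
  also have "\<dots> = fact D * (1 / 2) ^ D"
  proof -
    have "(3::real) ^ D * 2 ^ D = 6 ^ D" by (simp flip: power_mult_distrib)
    then show ?thesis by (simp add: power_divide field_simps)
  qed
  finally show ?thesis by simp
qed

section \<open>Locally acyclic graphs of large chromatic number\<close>

text \<open>Markov's inequality for the number of events \<open>B i\<close> that occur.\<close>

lemma prob_card_ge:
  fixes a :: real
  assumes I: "finite I" and a: "a > 0"
  shows "measure_pmf.prob M {x. a \<le> card {i\<in>I. x \<in> B i}} \<le> (\<Sum>i\<in>I. measure_pmf.prob M (B i)) / a"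
proof -
  have int: "integrable M (\<lambda>x. indicator (B i) x :: real)" for i
    by (rule measure_pmf.integrable_const_bound[where B = 1]) auto
  have card: "real (card {i\<in>I. x \<in> B i}) = (\<Sum>i\<in>I. indicator (B i) x)" for x
    using I by (simp add: indicator_def sum.If_cases Int_def)
  have "measure M {x\<in>space M. a \<le> (\<Sum>i\<in>I. indicator (B i) x)} \<le> (\<integral>x. (\<Sum>i\<in>I. indicator (B i) x) \<partial>M) / a"
    by (rule integral_Markov_inequality_measure[where A = "{}"]) (use int a in \<open>auto intro: sum_nonneg\<close>)
  also have "(\<integral>x. (\<Sum>i\<in>I. indicator (B i) x) \<partial>M) = (\<Sum>i\<in>I. measure_pmf.prob M (B i))"
    using int by (subst Bochner_Integration.integral_sum) auto
  finally show ?thesis by (simp add: card)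
qed

text \<open>If all degrees inside \<open>Y\<close> were at least 2, counting incidences would give
  at least \<open>card Y\<close> edges.\<close>

lemma forest_on_of_few_edges:
  assumes G: "fin_graph G" and X: "X \<subseteq> verts G"
    and few: "\<And>Y. Y \<subseteq> X \<Longrightarrow> Y \<noteq> {} \<Longrightarrow> card {e \<in> edges G. e \<subseteq> Y} < card Y"
  shows "forest_on G X"
  unfolding forest_on_def
proof (intro allI impI)
  fix Y assume Y: "Y \<subseteq> X" "Y \<noteq> {}"
  let ?F = "{e \<in> edges G. e \<subseteq> Y}"
  have fV: "finite (verts G)" using G by (simp add: fin_graph_def)
  have fY: "finite Y" using Y X finite_subset[OF _ fV] by blast
  have YF: "fin_graph (Y, ?F)"
    unfolding fin_graph_def
  proof (intro conjI subsetI)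
    fix e assume e: "e \<in> edges (Y, ?F)"
    then have "e \<in> edges G" by simp
    then obtain u v where "e = {u, v}" "u \<noteq> v" by (rule edgeE[OF G])
    then show "e \<in> [verts (Y, ?F)]\<^bsup>2\<^esup>" using e by simp
  qed (use Y fY in simp_all)
  have fF: "finite ?F" using fY by (intro finite_subset[of ?F "Pow Y"]) auto
  show "\<exists>y\<in>Y. card (nbrs G y \<inter> Y) \<le> 1"
  proof (rule ccontr)
    assume neg: "\<not> ?thesis"
    have "card Y * 2 = (\<Sum>y\<in>Y. 2)" by simp
    also have "\<dots> \<le> (\<Sum>y\<in>Y. card {e\<in>?F. y \<in> e})"
    proof (rule sum_mono)
      fix y assume y: "y \<in> Y"
      have "nbrs (Y, ?F) y = nbrs G y \<inter> Y" using y by (auto simp: nbrs_def)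
      then have "card {e\<in>?F. y \<in> e} = card (nbrs G y \<inter> Y)"
        using degree_eq_card_nbrs[OF YF, of y] by (simp add: degree_def)
      then show "2 \<le> card {e\<in>?F. y \<in> e}" using neg y by force
    qed
    also have "\<dots> = 2 * card ?F"
    proof (rule sum_multicount[OF fY fF])
      show "\<forall>e\<in>?F. card {y\<in>Y. y \<in> e} = 2"
      proof
        fix e assume e: "e \<in> ?F"
        then have "e \<in> edges G" by simp
        then obtain u v where uv: "e = {u, v}" "u \<noteq> v" by (rule edgeE[OF G])
        then have "{y\<in>Y. y \<in> e} = {u, v}" using e by auto
        then show "card {y\<in>Y. y \<in> e} = 2" using uv by simp
      qed
    qed
    finally show False using few[OF Y] by simp
  qed
qed

text \<open>Union bound over the sets of exactly \<open>card S\<close> pairs in \<open>S\<close>,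
  whose number is bounded in terms of \<open>m\<close> alone.\<close>

lemma prob_dense_set:
  fixes p :: real and n :: nat
  assumes p: "0 \<le> p" "p \<le> 1" and S: "S \<subseteq> {..<n}" "card S \<le> m"
  shows "measure_pmf.prob (Pi_pmf ([{..<n}]\<^bsup>2\<^esup>) False (\<lambda>_. bernoulli_pmf p))
     {X. card S \<le> card {e\<in>[S]\<^bsup>2\<^esup>. X e}} \<le> 2 ^ (m ^ 2) * p ^ card S"
proof -
  let ?M = "Pi_pmf ([{..<n}]\<^bsup>2\<^esup>) False (\<lambda>_. bernoulli_pmf p)"
  have fA: "finite ([{..<n}]\<^bsup>2\<^esup>)" by (simp add: finite_imp_finite_nsets)
  have fS: "finite S" using S finite_subset by blast
  have f2: "finite ([S]\<^bsup>2\<^esup>)" using fS by (simp add: finite_imp_finite_nsets)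
  have SA: "[S]\<^bsup>2\<^esup> \<subseteq> [{..<n}]\<^bsup>2\<^esup>" by (rule nsets_mono[OF S(1)])
  define \<E> where "\<E> = {E. E \<subseteq> [S]\<^bsup>2\<^esup> \<and> card E = card S}"
  have f\<E>: "finite \<E>" using f2 by (simp add: \<E>_def)
  have sub: "{X. card S \<le> card {e\<in>[S]\<^bsup>2\<^esup>. X e}} \<subseteq> (\<Union>E\<in>\<E>. {X. \<forall>e\<in>E. X e})"
  proof
    fix X assume "X \<in> {X. card S \<le> card {e\<in>[S]\<^bsup>2\<^esup>. X e}}"
    then have "card S \<le> card {e\<in>[S]\<^bsup>2\<^esup>. X e}" by simp
    then obtain E where "E \<subseteq> {e\<in>[S]\<^bsup>2\<^esup>. X e}" "card E = card S"
      by (rule obtain_subset_with_card_n)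
    then show "X \<in> (\<Union>E\<in>\<E>. {X. \<forall>e\<in>E. X e})" by (intro UN_I[of E]) (auto simp: \<E>_def)
  qed
  have "measure_pmf.prob ?M {X. \<forall>e\<in>E. X e} \<le> p ^ card S" if "E \<in> \<E>" for E
    using prob_all_present[OF fA p, of E] that SA by (auto simp: \<E>_def)
  then have "measure_pmf.prob ?M (\<Union>E\<in>\<E>. {X. \<forall>e\<in>E. X e}) \<le> card \<E> * p ^ card S"
    using prob_Union_le[OF f\<E>, where M = ?M and B = "\<lambda>E. {X. \<forall>e\<in>E. X e}" and b = "p ^ card S"] by blast
  moreover have "measure_pmf.prob ?M {X. card S \<le> card {e\<in>[S]\<^bsup>2\<^esup>. X e}} \<le>
      measure_pmf.prob ?M (\<Union>E\<in>\<E>. {X. \<forall>e\<in>E. X e})"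
    by (rule measure_pmf.finite_measure_mono[OF sub]) simp
  moreover have "real (card \<E>) * p ^ card S \<le> 2 ^ (m ^ 2) * p ^ card S"
  proof (rule mult_right_mono)
    have "card \<E> \<le> card (Pow ([S]\<^bsup>2\<^esup>))" by (rule card_mono) (use f2 in \<open>auto simp: \<E>_def\<close>)
    also have "\<dots> = 2 ^ (card S choose 2)" using f2 by (simp add: card_Pow card_nsets)
    also have "\<dots> \<le> 2 ^ (m ^ 2)"
    proof (rule power_increasing)
      have "card S choose 2 \<le> card S ^ 2"
        using binomial_fact_pow[of "card S" 2] by (simp add: fact_2)
      also have "\<dots> \<le> m ^ 2" using S(2) by (rule power_mono) simp
      finally show "card S choose 2 \<le> m ^ 2" .
    qed simp
    finally show "real (card \<E>) \<le> 2 ^ (m ^ 2)" by (metis of_nat_le_iff of_nat_numeral of_nat_power)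
  qed (use p in simp)
  ultimately show ?thesis by linarith
qed

text \<open>First moment. There are at most \<open>n ^ j\<close> sets of size \<open>j\<close>, each
  dense with probability at most \<open>2 ^ (m ^ 2) * p ^ j\<close>, and
  \<open>n * p \<ge> 1\<close> allows each \<open>j \<le> m\<close> to be replaced by
  \<open>m\<close>. Sets with at least as many edges as vertices are those that have to be destroyed
  to reach \<open>forest_on\<close>.\<close>

lemma prob_many_dense_sets:
  fixes p :: real and n :: nat
  assumes p: "0 \<le> p" "p \<le> 1" and np: "1 \<le> n * p" and n: "n > 0"
  shows "measure_pmf.prob (Pi_pmf ([{..<n}]\<^bsup>2\<^esup>) False (\<lambda>_. bernoulli_pmf p))
     {X. n / 2 \<le> card {S. S \<subseteq> {..<n} \<and> S \<noteq> {} \<and> card S \<le> m \<and> card S \<le> card {e\<in>[S]\<^bsup>2\<^esup>. X e}}}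
     \<le> 2 * m * 2 ^ (m ^ 2) * (n * p) ^ m / n"
proof -
  let ?M = "Pi_pmf ([{..<n}]\<^bsup>2\<^esup>) False (\<lambda>_. bernoulli_pmf p)"
  define \<S> where "\<S> = {S. S \<subseteq> {..<n} \<and> S \<noteq> {} \<and> card S \<le> m}"
  have f\<S>: "finite \<S>" by (rule finite_subset[of _ "Pow {..<n}"]) (auto simp: \<S>_def)
  let ?B = "\<lambda>S. {X. card S \<le> card {e\<in>[S]\<^bsup>2\<^esup>. X e}}"
  have sz: "card S \<in> {1..m}" if "S \<in> \<S>" for S
    using that finite_subset[of S "{..<n}"] by (auto simp: \<S>_def Suc_le_eq card_gt_0_iff)
  have "(\<Sum>S\<in>\<S>. measure_pmf.prob ?M (?B S)) \<le> (\<Sum>S\<in>\<S>. 2 ^ (m ^ 2) * p ^ card S)"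
    by (rule sum_mono) (rule prob_dense_set[OF p]; simp add: \<S>_def)
  also have "\<dots> = (\<Sum>j\<in>{1..m}. \<Sum>S\<in>{S\<in>\<S>. card S = j}. 2 ^ (m ^ 2) * p ^ card S)"
    by (rule sum.group[symmetric]) (use f\<S> sz in auto)
  also have "\<dots> \<le> (\<Sum>j\<in>{1..m}. 2 ^ (m ^ 2) * (n * p) ^ m)"
  proof (rule sum_mono)
    fix j assume j: "j \<in> {1..m}"
    have "card {S\<in>\<S>. card S = j} \<le> card {S. S \<subseteq> {..<n} \<and> card S = j}"
      by (rule card_mono) (auto simp: \<S>_def)
    also have "\<dots> = n choose j" using n_subsets[of "{..<n}" j] by simp
    also have "\<dots> \<le> (n choose j) * fact j" by simp
    also have "\<dots> \<le> n ^ j" by (rule binomial_fact_pow)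
    finally have c: "real (card {S\<in>\<S>. card S = j}) \<le> real n ^ j" by (metis of_nat_le_iff of_nat_power)
    have "(\<Sum>S\<in>{S\<in>\<S>. card S = j}. 2 ^ (m ^ 2) * p ^ card S) = real (card {S\<in>\<S>. card S = j}) * (2 ^ (m ^ 2) * p ^ j)"
      by simp
    also have "\<dots> \<le> real n ^ j * (2 ^ (m ^ 2) * p ^ j)" by (rule mult_right_mono[OF c]) (use p in simp)
    also have "\<dots> = 2 ^ (m ^ 2) * (n * p) ^ j" by (simp add: power_mult_distrib)
    also have "\<dots> \<le> 2 ^ (m ^ 2) * (n * p) ^ m"
      using j np by (intro mult_left_mono power_increasing) auto
    finally show "(\<Sum>S\<in>{S\<in>\<S>. card S = j}. 2 ^ (m ^ 2) * p ^ card S) \<le> 2 ^ (m ^ 2) * (n * p) ^ m" .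
  qed
  finally have sum: "(\<Sum>S\<in>\<S>. measure_pmf.prob ?M (?B S)) \<le> m * (2 ^ (m ^ 2) * (n * p) ^ m)" by simp
  have "measure_pmf.prob ?M {X. n / 2 \<le> card {S\<in>\<S>. X \<in> ?B S}} \<le> (\<Sum>S\<in>\<S>. measure_pmf.prob ?M (?B S)) / (n / 2)"
    by (rule prob_card_ge[OF f\<S>]) (use n in simp)
  also have "\<dots> \<le> m * (2 ^ (m ^ 2) * (n * p) ^ m) / (n / 2)"
    by (rule divide_right_mono[OF sum]) simp
  finally show ?thesis by (simp add: \<S>_def conj_assoc mult_ac)
qed

text \<open>The crude count \<open>2 ^ n\<close> of candidate sets suffices, because in the
  application \<open>p * (a choose 2)\<close> is of larger order than \<open>n\<close>.\<close>

lemma prob_independent_set: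
  fixes p :: real and n :: nat
  assumes p: "0 \<le> p" "p \<le> 1"
  shows "measure_pmf.prob (Pi_pmf ([{..<n}]\<^bsup>2\<^esup>) False (\<lambda>_. bernoulli_pmf p))
     {X. \<exists>I\<subseteq>{..<n}. card I = a \<and> (\<forall>e\<in>[I]\<^bsup>2\<^esup>. \<not> X e)} \<le> 2 ^ n * exp (- p * (a choose 2))"
proof -
  let ?M = "Pi_pmf ([{..<n}]\<^bsup>2\<^esup>) False (\<lambda>_. bernoulli_pmf p)"
  have fA: "finite ([{..<n}]\<^bsup>2\<^esup>)" by (simp add: finite_imp_finite_nsets)
  define \<S> where "\<S> = {I. I \<subseteq> {..<n} \<and> card I = a}"
  have f\<S>: "finite \<S>" by (simp add: \<S>_def)
  have "measure_pmf.prob ?M {X. \<forall>e\<in>[I]\<^bsup>2\<^esup>. \<not> X e} \<le> exp (- p * (a choose 2))" if I: "I \<in> \<S>" for I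
  proof -
    have "card ([I]\<^bsup>2\<^esup>) = a choose 2" using I finite_subset[of I "{..<n}"] by (auto simp: \<S>_def card_nsets)
    moreover have "[I]\<^bsup>2\<^esup> \<subseteq> [{..<n}]\<^bsup>2\<^esup>" using I by (intro nsets_mono) (simp add: \<S>_def)
    ultimately have "measure_pmf.prob ?M {X. \<forall>e\<in>[I]\<^bsup>2\<^esup>. \<not> X e} = (1 - p) ^ (a choose 2)"
      using prob_all_absent[OF fA p, of "[I]\<^bsup>2\<^esup>"] by simp
    also have "\<dots> \<le> exp (- p) ^ (a choose 2)"
      using p exp_ge_add_one_self[of "- p"] by (intro power_mono) auto
    also have "\<dots> = exp (- p * (a choose 2))" by (simp add: mult.commute flip: exp_of_nat_mult)
    finally show ?thesis .
  qed
  then have "measure_pmf.prob ?M (\<Union>I\<in>\<S>. {X. \<forall>e\<in>[I]\<^bsup>2\<^esup>. \<not> X e}) \<le> card \<S> * exp (- p * (a choose 2))"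
    using prob_Union_le[OF f\<S>, where M = ?M and B = "\<lambda>I. {X. \<forall>e\<in>[I]\<^bsup>2\<^esup>. \<not> X e}" and b = "exp (- p * (a choose 2))"] by blast
  also have "\<dots> \<le> 2 ^ n * exp (- p * (a choose 2))"
  proof (rule mult_right_mono)
    have "card \<S> \<le> card (Pow {..<n})" by (rule card_mono) (auto simp: \<S>_def)
    then show "real (card \<S>) \<le> 2 ^ n" by (simp add: card_Pow)
  qed simp
  also have "(\<Union>I\<in>\<S>. {X. \<forall>e\<in>[I]\<^bsup>2\<^esup>. \<not> X e}) = {X. \<exists>I\<subseteq>{..<n}. card I = a \<and> (\<forall>e\<in>[I]\<^bsup>2\<^esup>. \<not> X e)}"
    by (auto simp: \<S>_def)
  finally show ?thesis .
qed

text \<open>One vertex of each dense set is deleted, fewer than \<open>n / 2\<close> in all. The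
  more than \<open>n / 2\<close> remaining vertices contain no independent set of size
  \<open>a\<close>, so fewer than \<open>C\<close> colour classes, each of size at most
  \<open>n / (2 * C)\<close>, cannot cover them.\<close>

lemma sparse_graph_of_deletion:
  fixes n :: nat
  assumes n: "n > 0" and C: "C > 0"
    and dense: "real (card {S. S \<subseteq> {..<n} \<and> S \<noteq> {} \<and> card S \<le> m \<and> card S \<le> card {e\<in>[S]\<^bsup>2\<^esup>. X e}}) < real n / 2"
    and indep: "\<And>I. I \<subseteq> {..<n} \<Longrightarrow> card I = a \<Longrightarrow> \<exists>e\<in>[I]\<^bsup>2\<^esup>. X e"
    and a: "real a < real n / (2 * real C) + 1"
  shows "\<exists>\<Gamma>::nat graph. fin_graph \<Gamma> \<and> C \<le> chromatic_number \<Gamma> \<and>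
    (\<forall>Y\<subseteq>verts \<Gamma>. card Y \<le> m \<longrightarrow> forest_on \<Gamma> Y)"
proof -
  define \<D> where "\<D> = {S. S \<subseteq> {..<n} \<and> S \<noteq> {} \<and> card S \<le> m \<and> card S \<le> card {e\<in>[S]\<^bsup>2\<^esup>. X e}}"
  have f\<D>: "finite \<D>" by (rule finite_subset[of _ "Pow {..<n}"]) (auto simp: \<D>_def)
  define R where "R = (\<lambda>S. SOME v. v \<in> S) ` \<D>"
  have R: "S \<inter> R \<noteq> {}" if "S \<in> \<D>" for S
    using some_in_eq[of S] that by (auto simp: R_def \<D>_def)
  have cR: "real (card R) < n / 2"
    using card_image_le[OF f\<D>, of "\<lambda>S. SOME v. v \<in> S"] dense by (simp add: R_def \<D>_def)
  define V where "V = {..<n} - R"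
  have "n \<le> card V + card R"
    using diff_card_le_card_Diff[of R "{..<n}"] f\<D> by (simp add: V_def R_def)
  then have cV: "real (card V) > n / 2" using cR by linarith
  then have "V \<noteq> {}" by auto
  moreover have "finite V" by (simp add: V_def)
  ultimately have V: "V \<noteq> {}" "finite V" .
  define \<Gamma> where "\<Gamma> = (V, {e\<in>[V]\<^bsup>2\<^esup>. X e})"
  have \<Gamma>: "fin_graph \<Gamma>" using V by (auto simp: fin_graph_def \<Gamma>_def)
  have "forest_on \<Gamma> Y" if Y: "Y \<subseteq> verts \<Gamma>" "card Y \<le> m" for Y
  proof (rule forest_on_of_few_edges[OF \<Gamma> Y(1)])
    fix Z assume Z: "Z \<subseteq> Y" "Z \<noteq> {}"
    have fY: "finite Y" using Y V finite_subset by (auto simp: \<Gamma>_def)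
    have "Z \<inter> R = {}" using Z Y by (auto simp: \<Gamma>_def V_def)
    then have "Z \<notin> \<D>" using R by blast
    moreover have "Z \<subseteq> {..<n}" using Z Y by (auto simp: \<Gamma>_def V_def)
    moreover have "card Z \<le> m" using card_mono[OF fY Z(1)] Y by linarith
    ultimately have "card {e\<in>[Z]\<^bsup>2\<^esup>. X e} < card Z" using Z by (auto simp: \<D>_def not_le)
    moreover have "{e \<in> edges \<Gamma>. e \<subseteq> Z} = {e\<in>[Z]\<^bsup>2\<^esup>. X e}"
      using Z Y by (auto simp: \<Gamma>_def nsets_def)
    ultimately show "card {e \<in> edges \<Gamma>. e \<subseteq> Z} < card Z" by simp
  qed
  moreover have "C \<le> chromatic_number \<Gamma>"
  proof (rule ccontr)
    assume neg: "\<not> ?thesis"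
    define k where "k = chromatic_number \<Gamma>"
    have k: "k < C" using neg by (simp add: k_def)
    obtain c :: "nat \<Rightarrow> nat" where c: "c ` V \<subseteq> {..<k}" "\<forall>u v. {u, v} \<in> edges \<Gamma> \<longrightarrow> c u \<noteq> c v"
      using colourable_chromatic_number[OF \<Gamma>] unfolding colourable_def k_def by (auto simp: \<Gamma>_def)
    have small: "real (card {v\<in>V. c v = i}) \<le> n / (2 * C)" for i
    proof (rule ccontr)
      assume "\<not> ?thesis"
      \<comment> \<open>As \<open>a < n / (2 * C) + 1\<close>, an integer above
        \<open>n / (2 * C)\<close> is at least \<open>a\<close>.\<close>
      then have "a \<le> card {v\<in>V. c v = i}" using a by linarith
      then obtain I where I: "I \<subseteq> {v\<in>V. c v = i}" "card I = a" by (rule obtain_subset_with_card_n)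
      have "I \<subseteq> {..<n}" using I by (auto simp: V_def)
      from indep[OF this I(2)] obtain e where e: "e \<in> [I]\<^bsup>2\<^esup>" "X e" by blast
      then have "card e = 2" "e \<subseteq> I" by (auto simp: nsets_def)
      then obtain u v where uv: "e = {u, v}" "u \<noteq> v" "u \<in> I" "v \<in> I" unfolding card_2_iff by auto
      then have "{u, v} \<in> edges \<Gamma>" using e I by (auto simp: \<Gamma>_def)
      then show False using c(2) uv I by auto
    qed
    have "V \<subseteq> (\<Union>i<k. {v\<in>V. c v = i})" using c(1) by auto
    then have "card V \<le> card (\<Union>i<k. {v\<in>V. c v = i})" by (rule card_mono[rotated]) (use V in auto)
    also have "\<dots> \<le> (\<Sum>i<k. card {v\<in>V. c v = i})" by (rule card_UN_le) simp
    finally have "real (card V) \<le> (\<Sum>i<k. real (card {v\<in>V. c v = i}))" by (simp flip: of_nat_sum)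
    also have "\<dots> \<le> (\<Sum>i<k. n / (2 * C))" by (rule sum_mono) (rule small)
    also have "\<dots> = k * (n / (2 * C))" by simp
    also have "\<dots> \<le> C * (n / (2 * C))" by (rule mult_right_mono) (use k in auto)
    also have "\<dots> = n / 2" using C by simp
    finally show False using cV by simp
  qed
  ultimately show ?thesis using \<Gamma> by blast
qed

text \<open>Erdos's random construction with \<open>p = n powr (\<theta> - 1)\<close>. The exponent
  \<open>\<theta> = 1 / (2 * m)\<close> makes \<open>(n * p) ^ m = n powr (1 / 2)\<close>, so the
  expected number of dense sets is of smaller order than \<open>n\<close>. For \<open>a\<close>
  about \<open>n / (2 * C)\<close>, however, \<open>p * (a choose 2)\<close> is of order
  \<open>n powr (1 + \<theta>)\<close>, which beats \<open>2 ^ n\<close>.\<close>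

lemma ex_sparse_high_chromatic:
  assumes C: "C > 0" and m: "m > 0"
  shows "\<exists>\<Gamma>::nat graph. fin_graph \<Gamma> \<and> C \<le> chromatic_number \<Gamma> \<and>
    (\<forall>Y\<subseteq>verts \<Gamma>. card Y \<le> m \<longrightarrow> forest_on \<Gamma> Y)"
proof -
  define \<theta> where "\<theta> = 1 / (2 * real m)"
  have \<theta>: "0 < \<theta>" "\<theta> \<le> 1 / 2" using m by (auto simp: \<theta>_def field_simps)
  define K where "K = 2 * m * 2 ^ (m ^ 2)"
  define d where "d = 2 * real C"
  have d0: "d > 0" using C by (simp add: d_def)
  have "(\<lambda>n. K * real n powr (1/2) / real n) \<longlonglongrightarrow> 0" by real_asymp
  moreover have "(\<lambda>n. 2 powr real n * exp (- (real n powr (\<theta> - 1)) * ((real n / d) * (real n / d - 1) / 2))) \<longlonglongrightarrow> 0"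
    using \<theta> d0 by real_asymp
  ultimately have "(\<lambda>n. K * real n powr (1/2) / real n + 2 powr real n * exp (- (real n powr (\<theta> - 1)) * ((real n / d) * (real n / d - 1) / 2))) \<longlonglongrightarrow> 0"
    using tendsto_add by fastforce
  then have "\<forall>\<^sub>F n in sequentially. K * real n powr (1/2) / real n + 2 powr real n * exp (- (real n powr (\<theta> - 1)) * ((real n / d) * (real n / d - 1) / 2)) < 1"
    by (rule order_tendstoD) simp
  moreover have "\<forall>\<^sub>F n in sequentially. real n / d \<ge> 1" using d0 by real_asymp
  moreover have "\<forall>\<^sub>F n in sequentially. n > 0" by (rule eventually_gt_at_top)
  ultimately have "\<forall>\<^sub>F n in sequentially. n > 0 \<and> real n / d \<ge> 1 \<and> K * real n powr (1/2) / real n + 2 powr real n * exp (- (real n powr (\<theta> - 1)) * ((real n / d) * (real n / d - 1) / 2)) < 1"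
    by eventually_elim simp
  then obtain n where n: "n > 0" "real n / d \<ge> 1" and
    small: "K * real n powr (1/2) / real n + 2 powr real n * exp (- (real n powr (\<theta> - 1)) * ((real n / d) * (real n / d - 1) / 2)) < 1"
    by (auto dest!: eventually_happens)
  define p where "p = real n powr (\<theta> - 1)"
  have n1: "real n \<ge> 1" using n by simp
  have p: "0 \<le> p" "p \<le> 1"
    using powr_mono[of "\<theta> - 1" 0 "real n"] \<theta> n1 by (auto simp: p_def)
  have np: "n * p = real n powr \<theta>" using n1 by (simp add: p_def powr_diff)
  have npm: "(n * p) ^ m = real n powr (1/2)"
    unfolding np using n1 m by (simp add: \<theta>_def powr_powr flip: powr_realpow)
  have np1: "1 \<le> n * p" unfolding np using n1 \<theta> by (simp add: ge_one_powr_ge_zero)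
  define a where "a = nat \<lceil>real n / d\<rceil>"
  have a: "real n / d \<le> a" "real a < real n / d + 1" using n(2) unfolding a_def by linarith+
  let ?M = "Pi_pmf ([{..<n}]\<^bsup>2\<^esup>) False (\<lambda>_. bernoulli_pmf p)"
  define B1 where "B1 = {X. n / 2 \<le> card {S. S \<subseteq> {..<n} \<and> S \<noteq> {} \<and> card S \<le> m \<and> card S \<le> card {e\<in>[S]\<^bsup>2\<^esup>. X e}}}"
  define B2 where "B2 = {X. \<exists>I\<subseteq>{..<n}. card I = a \<and> (\<forall>e\<in>[I]\<^bsup>2\<^esup>. \<not> X e)}"
  have "measure_pmf.prob ?M B1 \<le> K * real n powr (1/2) / real n"
    using prob_many_dense_sets[OF p np1 n(1), of m] unfolding npm by (simp add: B1_def K_def)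
  moreover have "measure_pmf.prob ?M B2 \<le> 2 powr real n * exp (- (real n powr (\<theta> - 1)) * ((real n / d) * (real n / d - 1) / 2))"
  proof -
    have ch: "real (a choose 2) = real a * (real a - 1) / 2"
      using choose_two[of a] a(1) n(2) by (cases a) (auto simp: real_of_nat_div algebra_simps)
    have "(real n / d) * (real n / d - 1) \<le> real a * (real a - 1)"
      by (rule mult_mono) (use a n in auto)
    then have "(real n / d) * (real n / d - 1) / 2 \<le> real (a choose 2)"
      unfolding ch by (rule divide_right_mono) simp
    then have "exp (- p * (a choose 2)) \<le> exp (- p * ((real n / d) * (real n / d - 1) / 2))"
      unfolding exp_le_cancel_iff mult_minus_left neg_le_iff_le by (rule mult_left_mono[OF _ p(1)])
    then have "2 ^ n * exp (- p * (a choose 2)) \<le> 2 ^ n * exp (- p * ((real n / d) * (real n / d - 1) / 2))"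
      by (rule mult_left_mono) simp
    with prob_independent_set[OF p, of n a, folded B2_def]
    have "measure_pmf.prob ?M B2 \<le> 2 ^ n * exp (- p * ((real n / d) * (real n / d - 1) / 2))"
      by (rule order_trans)
    moreover have "(2::real) ^ n = 2 powr real n" by (simp add: powr_realpow)
    ultimately show ?thesis unfolding p_def by simp
  qed
  moreover have "measure_pmf.prob ?M (B1 \<union> B2) \<le> measure_pmf.prob ?M B1 + measure_pmf.prob ?M B2"
    by (rule measure_Un_le) auto
  ultimately have "measure_pmf.prob ?M (B1 \<union> B2) < 1" using small by linarith
  then have "B1 \<union> B2 \<noteq> UNIV" by force
  then obtain X where X: "X \<notin> B1" "X \<notin> B2" by blast
  show ?thesis
  proof (rule sparse_graph_of_deletion[OF n(1) C])
    show "real (card {S. S \<subseteq> {..<n} \<and> S \<noteq> {} \<and> card S \<le> m \<and> card S \<le> card {e\<in>[S]\<^bsup>2\<^esup>. X e}}) < real n / 2"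
      using X(1) by (simp add: B1_def)
    show "\<exists>e\<in>[I]\<^bsup>2\<^esup>. X e" if "I \<subseteq> {..<n}" "card I = a" for I
      using X(2) that by (auto simp: B2_def)
    show "real a < real n / (2 * real C) + 1" using a(2) by (simp add: d_def)
  qed
qed

section \<open>The random graph\<close>

lemma real_div_le_nat_div: "real n / real x - 1 \<le> real (n div x)"
  using floor_divide_of_nat_eq[of n x, where 'a = real] by linarith

text \<open>The residue classes modulo \<open>k + 1\<close> serve as the parts.\<close>

lemma card_residue_class_ge: "n div Suc k \<le> card {u\<in>{..<n}. u mod Suc k = i}" if "i \<le> k"
proof -
  have "card ((\<lambda>q. q * Suc k + i) ` {..<n div Suc k}) \<le> card {u\<in>{..<n}. u mod Suc k = i}"
  proof (rule card_mono)
    show "(\<lambda>q. q * Suc k + i) ` {..<n div Suc k} \<subseteq> {u\<in>{..<n}. u mod Suc k = i}"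
    proof safe
      fix q assume "q < n div Suc k"
      then have "Suc q * Suc k \<le> (n div Suc k) * Suc k" by (intro mult_right_mono) auto
      also have "\<dots> \<le> n" by (rule div_times_less_eq_dividend)
      finally have "q * Suc k + Suc k \<le> n" by simp
      then show "q * Suc k + i < n" using that by linarith
      show "(q * Suc k + i) mod Suc k = i" using that by (simp only: mod_mult_self3) simp
    qed
  qed simp
  moreover have "inj_on (\<lambda>q. q * Suc k + i) {..<n div Suc k}" by (rule inj_onI) (simp del: mult_Suc_right)
  ultimately show ?thesis by (simp add: card_image)
qed

text \<open>The deterministic half: three conditions on the edge indicator \<open>X\<close> are all
  that is asked of chance. A copy of \<open>\<Gamma>\<close> is sought only among translates by
  multiples of \<open>K\<close>, which lie in disjoint blocks of vertices and are therefore
  independent.\<close>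

lemma random_graph_good:
  fixes n :: nat and \<Gamma> :: "nat graph" and H :: "'a graph" and y :: real and X :: "nat set \<Rightarrow> bool"
  defines "G \<equiv> ({..<n}, {e \<in> [{..<n}]\<^bsup>2\<^esup>. X e})"
  assumes n: "n > 0" and H: "fin_graph H" and noatt: "\<And>S col. \<not> attachment k H S col"
    and \<Gamma>: "fin_graph \<Gamma>" "verts \<Gamma> \<subseteq> {..<K}"
    and sparse: "\<And>S. S \<subseteq> verts \<Gamma> \<Longrightarrow> card S \<le> card (verts H) \<Longrightarrow> forest_on \<Gamma> S"
    and copy: "j < n div K" "\<And>e. e \<in> edges \<Gamma> \<Longrightarrow> X ((\<lambda>a. a + j * K) ` e)"
    and deg: "\<And>v i. v < n \<Longrightarrow> i \<le> k \<Longrightarrow>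
        y < real (card {e \<in> (\<lambda>u. {v, u}) ` {u\<in>{..<n}. u \<noteq> v \<and> u mod Suc k = i}. X e})"
    and codeg: "\<And>u v. u < n \<Longrightarrow> v < n \<Longrightarrow> u \<noteq> v \<Longrightarrow> card {a\<in>{..<n} - {u, v}. X {u, a} \<and> X {v, a}} < D"
  shows "\<exists>G'. subgraph G' G \<and> free_of H G' \<and> chromatic_number \<Gamma> \<le> chromatic_number G' \<and>
    k * y - card (verts \<Gamma>) * (real D + 1) \<le> min_degree G'"
proof -
  have G: "fin_graph G" using n by (auto simp: G_def fin_graph_def)
  have V: "verts G = {..<n}" by (simp add: G_def)
  have nb: "nbrs G v = {u\<in>{..<n}. u \<noteq> v \<and> X {v, u}}" if "v < n" for v
    using that by (auto simp: nbrs_def G_def)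
  define L where "L = nat \<lceil>y\<rceil>"
  have "\<exists>G'. subgraph G' G \<and> free_of H G' \<and> chromatic_number \<Gamma> \<le> chromatic_number G' \<and>
    k * L \<le> min_degree G' + card (verts \<Gamma>) * (D + 1)"
  proof (rule free_subgraph_construction[OF G H \<Gamma>(1) noatt sparse, where \<psi> = "\<lambda>a. a + j * K" and c = "\<lambda>u. u mod Suc k"])
    show "inj_on (\<lambda>a. a + j * K) (verts \<Gamma>)" by (simp add: inj_on_def)
    show VG: "(\<lambda>a. a + j * K) ` verts \<Gamma> \<subseteq> verts G"
    proof
      fix b assume "b \<in> (\<lambda>a. a + j * K) ` verts \<Gamma>"
      then obtain a where a: "a < K" "b = a + j * K" using \<Gamma>(2) by auto
      have "Suc j * K \<le> (n div K) * K" using copy(1) by (intro mult_right_mono) auto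
      also have "\<dots> \<le> n" by simp
      finally show "b \<in> verts G" using a by (simp add: V)
    qed
    show "{a + j * K, b + j * K} \<in> edges G" if "{a, b} \<in> edges \<Gamma>" for a b
      using copy(2)[OF that] VG edge_verts[OF \<Gamma>(1) that] by (auto simp: G_def)
    show "v mod Suc k \<le> k" for v by (simp add: less_Suc_eq_le)
    show "L \<le> card {u \<in> nbrs G v. u mod Suc k = i}" if v: "v \<in> verts G" and i: "i \<le> k" for v i
    proof -
      have vn: "v < n" using v by (simp add: V)
      have "{e \<in> (\<lambda>u. {v, u}) ` {u\<in>{..<n}. u \<noteq> v \<and> u mod Suc k = i}. X e} =
        (\<lambda>u. {v, u}) ` {u \<in> nbrs G v. u mod Suc k = i}"
        unfolding nb[OF vn] by auto
      also have "card \<dots> \<le> card {u \<in> nbrs G v. u mod Suc k = i}"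
        by (rule card_image_le) (simp add: finite_nbrs[OF G])
      finally show ?thesis using deg[OF vn i] unfolding L_def by linarith
    qed
    show "card (nbrs G u \<inter> nbrs G v) \<le> D" if "u \<in> verts G" "v \<in> verts G" "u \<noteq> v" for u v
    proof -
      have "u < n" "v < n" using that by (simp_all add: V)
      moreover from this have "nbrs G u \<inter> nbrs G v = {a\<in>{..<n} - {u, v}. X {u, a} \<and> X {v, a}}"
        by (auto simp: nb)
      ultimately show ?thesis using codeg[of u v] that(3) by simp
    qed
  qed
  then obtain G' where G': "subgraph G' G" "free_of H G'" "chromatic_number \<Gamma> \<le> chromatic_number G'"
    and min: "k * L \<le> min_degree G' + card (verts \<Gamma>) * (D + 1)" by blast
  have "k * y \<le> k * real L" unfolding L_def by (intro mult_left_mono) linarith+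
  also have "\<dots> \<le> min_degree G' + card (verts \<Gamma>) * (real D + 1)"
  proof -
    have "real (k * L) \<le> real (min_degree G' + card (verts \<Gamma>) * (D + 1))"
      using min by (simp only: of_nat_le_iff)
    then show ?thesis by (simp only: of_nat_mult of_nat_add of_nat_1)
  qed
  finally show ?thesis using G' by (intro exI[of _ G']) auto
qed

lemma prob_not_good_le:
  fixes \<Gamma> :: "nat graph" and \<eta> p :: real and n :: nat
  defines "M \<equiv> Pi_pmf ([{..<n}]\<^bsup>2\<^esup>) False (\<lambda>_. bernoulli_pmf p)"
  assumes \<Gamma>: "fin_graph \<Gamma>" "verts \<Gamma> \<subseteq> {..<K}" and K: "K > 0" and \<eta>: "\<eta> \<ge> 0"
    and p: "0 \<le> p" "p \<le> 1" and n: "2 * Suc k < n"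
    and p_large: "real n powr (- 1 / 2) \<le> p ^ card (edges \<Gamma>)" "real n powr (- 1 / 4) \<le> p"
    and y: "y = (real n / Suc k - 2) * p - \<eta> * p * n" and D: "D = nat \<lceil>6 * p\<^sup>2 * n\<rceil>"
  shows "measure_pmf.prob M {X. \<not> ((\<exists>j<n div K. \<forall>e\<in>edges \<Gamma>. X ((\<lambda>a. a + j * K) ` e)) \<and>
      (\<forall>v<n. \<forall>i\<le>k. y < real (card {e \<in> (\<lambda>u. {v, u}) ` {u\<in>{..<n}. u \<noteq> v \<and> u mod Suc k = i}. X e})) \<and>
      (\<forall>u<n. \<forall>v<n. u \<noteq> v \<longrightarrow> card {a\<in>{..<n} - {u, v}. X {u, a} \<and> X {v, a}} < D))}
    \<le> exp (- (real n powr (- 1 / 2)) * (real n / K - 1)) +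
       real n * Suc k * exp (- 2 * \<eta>\<^sup>2 * real n powr (1 / 2)) + real n * real n * (1 / 2) powr (6 * real n powr (1 / 2))"
proof -
  have fA: "finite ([{..<n}]\<^bsup>2\<^esup>)" by (simp add: finite_imp_finite_nsets)
  have n1: "real n \<ge> 1" "n > 0" using n by auto
  define E where "E j = (\<lambda>e. (\<lambda>a. a + j * K) ` e) ` edges \<Gamma>" for j
  define E' where "E' v i = (\<lambda>u. {v, u}) ` {u\<in>{..<n}. u \<noteq> v \<and> u mod Suc k = i}" for v i
  define B1 where "B1 = {X. \<forall>j<n div K. \<exists>e\<in>E j. \<not> X e}"
  define B2 where "B2 = (\<lambda>(v,i). {X. real (card {e \<in> E' v i. X e}) \<le> y})"
  define B3 where "B3 = (\<lambda>(u,v). {X :: nat set \<Rightarrow> bool. u \<noteq> v \<and> D \<le> card {a\<in>{..<n} - {u, v}. X {u, a} \<and> X {v, a}}})"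
  \<comment> \<open>Serves twice: it bounds the Hoeffding exponent for \<open>B2\<close> and the
    number \<open>D\<close> for \<open>B3\<close> from below.\<close>
  have np: "real n powr (1 / 2) \<le> p\<^sup>2 * n"
  proof -
    have "real n powr (1 / 2) = real n powr (- 1 / 4) * real n powr (- 1 / 4) * real n powr 1"
      by (simp only: powr_add[symmetric]) simp
    also have "\<dots> = (real n powr (- 1 / 4))\<^sup>2 * n" using n1 by (simp add: power2_eq_square)
    also have "\<dots> \<le> p\<^sup>2 * n" using p_large(2) by (intro mult_right_mono power_mono) auto
    finally show ?thesis .
  qed
  have b1: "measure_pmf.prob M B1 \<le> exp (- (real n powr (- 1 / 2)) * (real n / K - 1))"
  proof -
    have EA: "E j \<subseteq> [{..<n}]\<^bsup>2\<^esup> \<and> card (E j) = card (edges \<Gamma>)" if j: "j < n div K" for j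
    proof
      have "Suc j * K \<le> (n div K) * K" using j by (intro mult_right_mono) auto
      also have "\<dots> \<le> n" by simp
      finally have jK: "j * K + K \<le> n" by simp
      show "E j \<subseteq> [{..<n}]\<^bsup>2\<^esup>"
      proof
        fix e assume "e \<in> E j"
        then obtain e' where e': "e' \<in> edges \<Gamma>" "e = (\<lambda>a. a + j * K) ` e'" by (auto simp: E_def)
        obtain u v where uv: "e' = {u, v}" "u \<in> verts \<Gamma>" "v \<in> verts \<Gamma>" "u \<noteq> v" using e'(1) by (rule edgeE[OF \<Gamma>(1)])
        then have "u < K" "v < K" using \<Gamma>(2) by auto
        then show "e \<in> [{..<n}]\<^bsup>2\<^esup>" using e'(2) uv jK by simp
      qed
      have "inj_on (\<lambda>e. (\<lambda>a. a + j * K) ` e) (edges \<Gamma>)"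
        by (rule inj_onI) (simp add: inj_image_eq_iff inj_on_def)
      then show "card (E j) = card (edges \<Gamma>)" unfolding E_def by (rule card_image)
    qed
    have disj: "E i \<inter> E j = {}" if "i \<noteq> j" for i j
    proof (rule ccontr)
      assume "E i \<inter> E j \<noteq> {}"
      then obtain e where e: "e \<in> E i" "e \<in> E j" by blast
      have block: "\<forall>b\<in>e. b div K = l" "e \<noteq> {}" if el: "e \<in> E l" for l
      proof -
        obtain e' where e': "e' \<in> edges \<Gamma>" "e = (\<lambda>a. a + l * K) ` e'" using el by (auto simp: E_def)
        obtain u v where uv: "e' = {u, v}" "u \<in> verts \<Gamma>" "v \<in> verts \<Gamma>" using e'(1) by (rule edgeE[OF \<Gamma>(1)])
        then have "u < K" "v < K" using \<Gamma>(2) by auto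
        then show "\<forall>b\<in>e. b div K = l" "e \<noteq> {}" using e'(2) uv by auto
      qed
      obtain b where "b \<in> e" using block(2)[OF e(1)] by blast
      then have "b div K = i" "b div K = j" using block(1)[OF e(1)] block(1)[OF e(2)] by blast+
      then show False using that by simp
    qed
    have "measure_pmf.prob M B1 = (1 - p ^ card (edges \<Gamma>)) ^ (n div K)"
      unfolding M_def B1_def by (rule prob_no_block_present[OF fA p]) (use EA disj in auto)
    also have "\<dots> \<le> exp (- (p ^ card (edges \<Gamma>))) ^ (n div K)"
      using exp_ge_add_one_self[of "- (p ^ card (edges \<Gamma>))"] p by (intro power_mono) (auto simp: power_le_one)
    also have "\<dots> = exp (- (p ^ card (edges \<Gamma>) * (n div K)))"
      by (simp add: mult.commute flip: exp_of_nat_mult)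
    also have "\<dots> \<le> exp (- (real n powr (- 1 / 2) * (real n / K - 1)))"
      unfolding exp_le_cancel_iff neg_le_iff_le
    proof (cases "real n / K - 1 \<ge> 0")
      case True
      have "real n / K - 1 \<le> real (n div K)"
        by (rule real_div_le_nat_div)
      then show "real n powr (- 1 / 2) * (real n / K - 1) \<le> p ^ card (edges \<Gamma>) * real (n div K)"
        using p_large(1) True p by (intro mult_mono) auto
    next
      case False
      have "real n powr (- 1 / 2) * (real n / K - 1) \<le> 0" using False by (intro mult_nonneg_nonpos) auto
      also have "0 \<le> p ^ card (edges \<Gamma>) * real (n div K)" using p by simp
      finally show "real n powr (- 1 / 2) * (real n / K - 1) \<le> p ^ card (edges \<Gamma>) * real (n div K)" .
    qed
    finally show ?thesis by simp
  qed
  have b2: "measure_pmf.prob M (\<Union>q\<in>{..<n} \<times> {..k}. B2 q) \<le>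
      card ({..<n} \<times> {..k}) * exp (- 2 * \<eta>\<^sup>2 * real n powr (1 / 2))"
  proof (rule prob_Union_le)
    fix q assume "q \<in> {..<n} \<times> {..k}"
    then obtain v i where q: "q = (v, i)" "v < n" "i \<le> k" by auto
    define N where "N = card (E' v i)"
    have "card (E' v i) = card {u\<in>{..<n}. u \<noteq> v \<and> u mod Suc k = i}"
      unfolding E'_def by (rule card_image) (auto simp: inj_on_def doubleton_eq_iff)
    also have "{u\<in>{..<n}. u \<noteq> v \<and> u mod Suc k = i} = {u\<in>{..<n}. u mod Suc k = i} - {v}" by auto
    also have "card \<dots> \<ge> card {u\<in>{..<n}. u mod Suc k = i} - card {v}"
      by (rule diff_card_le_card_Diff) simp
    finally have "n div Suc k - 1 \<le> N"
      using card_residue_class_ge[OF q(3), of n] by (simp add: N_def)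
    moreover have "real n / Suc k - 1 \<le> real (n div Suc k)"
      by (rule real_div_le_nat_div)
    \<comment> \<open>One unit is lost by rounding in \<open>n div Suc k\<close>, one because
      \<open>v\<close> may lie in the class itself; hence the \<open>- 2\<close> in
      \<open>y\<close>.\<close>
    ultimately have N: "real n / Suc k - 2 \<le> real N" by linarith
    have "real n / Suc k > 2" using n by (simp add: field_simps)
    then have N0: "real N > 0" using N by linarith
    have Nn: "real N \<le> n"
    proof -
      have "N \<le> card {u\<in>{..<n}. u \<noteq> v \<and> u mod Suc k = i}" unfolding N_def E'_def by (rule card_image_le) simp
      also have "\<dots> \<le> card {..<n}" by (rule card_mono) auto
      finally show ?thesis by simp
    qed
    have EA: "E' v i \<subseteq> [{..<n}]\<^bsup>2\<^esup>" using q by (auto simp: E'_def)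
    have "y \<le> N * p - \<eta> * p * n" unfolding y using mult_right_mono[OF N p(1)] by simp
    then have "measure_pmf.prob M (B2 q) \<le> measure_pmf.prob M {X. real (card {e \<in> E' v i. X e}) \<le> N * p - \<eta> * p * n}"
      by (intro measure_pmf.finite_measure_mono) (auto simp: B2_def q)
    also have "\<dots> \<le> exp (- 2 * (\<eta> * p * n)\<^sup>2 / N)"
      unfolding M_def N_def using N0 \<eta> p by (intro prob_few_present[OF fA p EA]) (auto simp: N_def)
    also have "\<dots> \<le> exp (- 2 * \<eta>\<^sup>2 * real n powr (1 / 2))"
    proof -
      have "\<eta>\<^sup>2 * real n powr (1 / 2) \<le> \<eta>\<^sup>2 * (p\<^sup>2 * n)" by (rule mult_left_mono[OF np]) simp
      also have "\<dots> = (\<eta> * p * n)\<^sup>2 / n" using n1 by (simp add: power2_eq_square)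
      also have "\<dots> \<le> (\<eta> * p * n)\<^sup>2 / N" by (rule divide_left_mono) (use Nn N0 n1 in auto)
      finally show ?thesis by simp
    qed
    finally show "measure_pmf.prob M (B2 q) \<le> exp (- 2 * \<eta>\<^sup>2 * real n powr (1 / 2))" .
  qed simp
  have b3: "measure_pmf.prob M (\<Union>q\<in>{..<n} \<times> {..<n}. B3 q) \<le>
      card ({..<n} \<times> {..<n}) * (1 / 2) powr (6 * real n powr (1 / 2))"
  proof (rule prob_Union_le)
    fix q assume "q \<in> {..<n} \<times> {..<n}"
    then obtain u v where q: "q = (u, v)" "u < n" "v < n" by auto
    show "measure_pmf.prob M (B3 q) \<le> (1 / 2) powr (6 * real n powr (1 / 2))"
    proof (cases "u = v")
      case True
      then have "B3 q = {}" by (simp add: B3_def q)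
      then show ?thesis by simp
    next
      case False
      have D6: "6 * p\<^sup>2 * n \<le> D" unfolding D by linarith
      have "measure_pmf.prob M (B3 q) \<le> real (n choose D) * p ^ (2 * D)"
        using prob_codegree_ge[OF p q(2,3) False, of D] False by (simp add: B3_def q M_def)
      also have "\<dots> \<le> (1 / 2) ^ D" by (rule binomial_power_le_half_power[OF p(1) D6])
      also have "\<dots> = (1 / 2) powr real D" by (simp add: powr_realpow)
      also have "\<dots> \<le> (1 / 2) powr (6 * real n powr (1 / 2))"
        by (rule powr_mono') (use D6 np in auto)
      finally show ?thesis .
    qed
  qed simp
  have "measure_pmf.prob M {X. \<not> ((\<exists>j<n div K. \<forall>e\<in>edges \<Gamma>. X ((\<lambda>a. a + j * K) ` e)) \<and>
      (\<forall>v<n. \<forall>i\<le>k. y < real (card {e \<in> (\<lambda>u. {v, u}) ` {u\<in>{..<n}. u \<noteq> v \<and> u mod Suc k = i}. X e})) \<and>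
      (\<forall>u<n. \<forall>v<n. u \<noteq> v \<longrightarrow> card {a\<in>{..<n} - {u, v}. X {u, a} \<and> X {v, a}} < D))}
     \<le> measure_pmf.prob M (B1 \<union> ((\<Union>q\<in>{..<n} \<times> {..k}. B2 q) \<union> (\<Union>q\<in>{..<n} \<times> {..<n}. B3 q)))"
  proof (rule measure_pmf.finite_measure_mono)
    show "{X. \<not> ((\<exists>j<n div K. \<forall>e\<in>edges \<Gamma>. X ((\<lambda>a. a + j * K) ` e)) \<and>
      (\<forall>v<n. \<forall>i\<le>k. y < real (card {e \<in> (\<lambda>u. {v, u}) ` {u\<in>{..<n}. u \<noteq> v \<and> u mod Suc k = i}. X e})) \<and>
      (\<forall>u<n. \<forall>v<n. u \<noteq> v \<longrightarrow> card {a\<in>{..<n} - {u, v}. X {u, a} \<and> X {v, a}} < D))}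
      \<subseteq> B1 \<union> ((\<Union>q\<in>{..<n} \<times> {..k}. B2 q) \<union> (\<Union>q\<in>{..<n} \<times> {..<n}. B3 q))"
      unfolding B1_def B2_def B3_def E_def E'_def by (auto simp: not_less) (metis leD)
  qed simp
  also have "\<dots> \<le> measure_pmf.prob M B1 + (measure_pmf.prob M (\<Union>q\<in>{..<n} \<times> {..k}. B2 q) + measure_pmf.prob M (\<Union>q\<in>{..<n} \<times> {..<n}. B3 q))"
    by (rule order_trans[OF measure_Un_le add_left_mono[OF measure_Un_le]]) auto
  also have "\<dots> \<le> exp (- (real n powr (- 1 / 2)) * (real n / K - 1)) +
     (card ({..<n} \<times> {..k}) * exp (- 2 * \<eta>\<^sup>2 * real n powr (1 / 2)) + card ({..<n} \<times> {..<n}) * (1 / 2) powr (6 * real n powr (1 / 2)))"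
    by (intro add_mono b1 b2 b3)
  also have "real (card ({..<n} \<times> {..k})) = real n * Suc k" by (simp add: card_cartesian_product algebra_simps)
  also have "real (card ({..<n} \<times> {..<n})) = real n * real n" by (simp add: card_cartesian_product)
  finally show ?thesis by (simp only: add.assoc)
qed


section \<open>Assembling the estimates\<close>

text \<open>The bound \<open>\<epsilon> \<le> 1 / 4\<close> yields
  \<open>p n \<ge> n powr (- 1 / 4)\<close>, and the one with \<open>card (edges \<Gamma>)\<close>
  yields \<open>p n ^ card (edges \<Gamma>) \<ge> n powr (- 1 / 2)\<close>, enough for a copy of
  \<open>\<Gamma>\<close> among the blocks. The one with \<open>card (verts \<Gamma>)\<close>
  reduces the codegree loss, about \<open>6 * (p n) ^ 2 * n\<close> for each vertex of
  \<open>\<Gamma>\<close>, to \<open>\<epsilon> / 8 * p n * n\<close>; here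
  \<open>p n < \<epsilon> ^ 2\<close> and \<open>48 = 6 * 8\<close>.\<close>

lemma aas_free_subgraph:
  fixes H :: "'a graph" and \<Gamma> :: "nat graph" and \<epsilon> :: real and p :: "nat \<Rightarrow> real"
  assumes k: "k \<ge> 1" and H: "fin_graph H" and noatt: "\<And>S col. \<not> attachment k H S col"
    and \<Gamma>: "fin_graph \<Gamma>"
    and sparse: "\<And>S. S \<subseteq> verts \<Gamma> \<Longrightarrow> card S \<le> card (verts H) \<Longrightarrow> forest_on \<Gamma> S"
    and \<epsilon>: "0 < \<epsilon>" "\<epsilon> \<le> 1 / 4" "\<epsilon> * real (card (edges \<Gamma>)) \<le> 1 / 2" "48 * real (card (verts \<Gamma>)) * \<epsilon> \<le> 1"
    and p: "\<forall>\<^sub>F n in sequentially. real n powr (- \<epsilon>) < p n \<and> p n < \<epsilon>\<^sup>2"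
  shows "asymptotically_almost_surely (\<lambda>n. random_graph n (p n))
        (\<lambda>n G. \<exists>G'. subgraph G' G \<and> free_of H G' \<and> chromatic_number \<Gamma> \<le> chromatic_number G' \<and>
          (1 - \<epsilon>) * (real k / (real k + 1)) * p n * real n \<le> real (min_degree G'))"
proof -
  define K where "K = Suc (Max (verts \<Gamma>))"
  have fV: "finite (verts \<Gamma>)" "verts \<Gamma> \<noteq> {}" using \<Gamma> by (auto simp: fin_graph_def)
  have K: "verts \<Gamma> \<subseteq> {..<K}" "K > 0" using fV by (auto simp: K_def less_Suc_eq_le)
  define \<eta> where "\<eta> = \<epsilon> / (4 * (real k + 1))"
  have \<eta>: "\<eta> > 0" using \<epsilon> by (simp add: \<eta>_def)
  define V where "V = real (card (verts \<Gamma>))"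
  have V1: "V \<ge> 1" using fV by (simp add: V_def Suc_le_eq card_gt_0_iff)
  define f where "f n = exp (- (real n powr (- 1 / 2)) * (real n / K - 1)) +
       real n * Suc k * exp (- 2 * \<eta>\<^sup>2 * real n powr (1 / 2)) + real n * real n * (1 / 2) powr (6 * real n powr (1 / 2))" for n
  define Q where "Q n G \<longleftrightarrow> (\<exists>G'. subgraph G' G \<and> free_of H G' \<and> chromatic_number \<Gamma> \<le> chromatic_number G' \<and>
          (1 - \<epsilon>) * (real k / (real k + 1)) * p n * real n \<le> real (min_degree G'))" for n and G :: "nat graph"
  have "f \<longlonglongrightarrow> 0"
  proof -
    have Kp: "real K > 0" using K by simp
    have e2: "\<eta>\<^sup>2 > 0" using \<eta> by simp
    have t1: "(\<lambda>n. exp (- (real n powr (- 1 / 2)) * (real n / K - 1))) \<longlonglongrightarrow> 0" using Kp by real_asymp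
    have t2: "(\<lambda>n. real n * Suc k * exp (- 2 * \<eta>\<^sup>2 * real n powr (1 / 2))) \<longlonglongrightarrow> 0" using e2 by real_asymp
    have t3: "(\<lambda>n. real n * real n * (1 / 2) powr (6 * real n powr (1 / 2))) \<longlonglongrightarrow> 0" by real_asymp
    show ?thesis using tendsto_add[OF tendsto_add[OF t1 t2] t3] unfolding f_def by simp
  qed
  \<comment> \<open>As \<open>p n * n \<ge> n powr (3 / 4)\<close>, this absorbs the additive losses
    \<open>2 * k * p n\<close> and \<open>2 * V\<close> into
    \<open>\<epsilon> / 8 * p n * n\<close>.\<close>
  have large: "\<forall>\<^sub>F n in sequentially. 16 * (real k + V) \<le> \<epsilon> * real n powr (3 / 4)"
    using \<epsilon>(1) by real_asymp
  have lower: "\<forall>\<^sub>F n in sequentially. 1 - f n \<le> measure_pmf.prob (random_graph n (p n)) {G. Q n G}"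
    using p large eventually_gt_at_top[of "2 * Suc k"]
  proof eventually_elim
    case (elim n)
    then have n: "2 * Suc k < n" and n1: "real n \<ge> 1" by auto
    have "real n powr (- \<epsilon>) > 0" using n1 by simp
    then have p0: "0 < p n" using elim by linarith
    have "\<epsilon>\<^sup>2 \<le> 1" using \<epsilon> by (intro power_le_one) auto
    then have p01: "0 \<le> p n" "p n \<le> 1" using p0 elim by auto
    have pl1: "real n powr (- 1 / 4) \<le> p n"
    proof -
      have "real n powr (- 1 / 4) \<le> real n powr (- \<epsilon>)" using \<epsilon> n1 by (intro powr_mono) auto
      then show ?thesis using elim by linarith
    qed
    have pl2: "real n powr (- 1 / 2) \<le> p n ^ card (edges \<Gamma>)"
    proof -
      have "real n powr (- 1 / 2) \<le> real n powr (- (\<epsilon> * real (card (edges \<Gamma>))))"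
        using \<epsilon> n1 by (intro powr_mono) auto
      also have "\<dots> = (real n powr (- \<epsilon>)) ^ card (edges \<Gamma>)"
        using n1 by (simp add: powr_powr flip: powr_realpow)
      also have "\<dots> \<le> p n ^ card (edges \<Gamma>)" using elim by (intro power_mono) auto
      finally show ?thesis .
    qed
    define y where "y = (real n / Suc k - 2) * p n - \<eta> * p n * n"
    define D where "D = nat \<lceil>6 * (p n)\<^sup>2 * n\<rceil>"
    define M where "M = Pi_pmf ([{..<n}]\<^bsup>2\<^esup>) False (\<lambda>_. bernoulli_pmf (p n))"
    define good where "good X \<longleftrightarrow> ((\<exists>j<n div K. \<forall>e\<in>edges \<Gamma>. X ((\<lambda>a. a + j * K) ` e)) \<and>
      (\<forall>v<n. \<forall>i\<le>k. y < real (card {e \<in> (\<lambda>u. {v, u}) ` {u\<in>{..<n}. u \<noteq> v \<and> u mod Suc k = i}. X e})) \<and>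
      (\<forall>u<n. \<forall>v<n. u \<noteq> v \<longrightarrow> card {a\<in>{..<n} - {u, v}. X {u, a} \<and> X {v, a}} < D))" for X :: "nat set \<Rightarrow> bool"
    have bad: "measure_pmf.prob M {X. \<not> good X} \<le> f n"
      unfolding good_def f_def M_def
      by (rule prob_not_good_le[OF \<Gamma> K less_imp_le[OF \<eta>] p01 n pl2 pl1 y_def D_def])
    have deg_bound: "(1 - \<epsilon>) * (real k / (real k + 1)) * p n * real n \<le> k * y - card (verts \<Gamma>) * (real D + 1)"
    proof -
      define a where "a = real k / (real k + 1)"
      define z where "z = p n * real n"
      have a: "1 / 2 \<le> a" "a \<le> 1" using k by (auto simp: a_def field_simps)
      have z0: "z \<ge> 0" using p0 by (simp add: z_def)
      have ky: "k * y = a * z - 2 * k * p n - \<epsilon> * a / 4 * z"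
        unfolding y_def a_def z_def \<eta>_def by (simp add: field_simps)
      have "real D \<le> 6 * (p n)\<^sup>2 * n + 1"
      proof -
        have "0 \<le> 6 * (p n)\<^sup>2 * n" by simp
        then show ?thesis unfolding D_def by linarith
      qed
      also have "6 * (p n)\<^sup>2 * n = 6 * p n * z" by (simp add: z_def power2_eq_square)
      also have "6 * p n * z \<le> 6 * \<epsilon>\<^sup>2 * z" using elim z0 by (intro mult_right_mono) auto
      finally have "V * (real D + 1) \<le> V * (6 * \<epsilon>\<^sup>2 * z + 2)" using V1 by (intro mult_left_mono) auto
      also have "\<dots> = (48 * V * \<epsilon>) * (\<epsilon> / 8 * z) + 2 * V" by (simp add: power2_eq_square algebra_simps)
      also have "\<dots> \<le> 1 * (\<epsilon> / 8 * z) + 2 * V"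
        using \<epsilon> z0 by (intro add_right_mono mult_right_mono) (auto simp: V_def)
      finally have VD: "V * (real D + 1) \<le> \<epsilon> / 8 * z + 2 * V" by simp
      have "\<epsilon> * real n powr (3 / 4) \<le> \<epsilon> * z"
      proof (rule mult_left_mono)
        have "real n powr (3 / 4) = real n powr (- 1 / 4) * real n powr 1" by (simp only: powr_add[symmetric]) simp
        also have "\<dots> \<le> z" unfolding z_def using pl1 n1 p01 by (intro mult_mono) auto
        finally show "real n powr (3 / 4) \<le> z" .
      qed (use \<epsilon> in simp)
      then have "2 * (real k + V) \<le> \<epsilon> / 8 * z" using elim by linarith
      moreover have "2 * real k * p n \<le> 2 * real k * 1" by (rule mult_left_mono) (use p01 in auto)
      ultimately have "2 * k * p n + V * (real D + 1) \<le> \<epsilon> / 4 * z" using VD by simp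
      also have "\<dots> \<le> \<epsilon> * a / 2 * z"
      proof (rule mult_right_mono[OF _ z0])
        have "\<epsilon> * (1 / 2) \<le> \<epsilon> * a" using a \<epsilon> by (intro mult_left_mono) auto
        then show "\<epsilon> / 4 \<le> \<epsilon> * a / 2" by simp
      qed
      finally have "2 * k * p n + V * (real D + 1) \<le> \<epsilon> * a / 2 * z" .
      moreover have "0 \<le> \<epsilon> * a / 4 * z" using \<epsilon> a z0 by simp
      moreover have "(1 - \<epsilon>) * a * z = a * z - (\<epsilon> * a / 2 * z + \<epsilon> * a / 4 * z + \<epsilon> * a / 4 * z)" by (simp add: algebra_simps)
      ultimately have "(1 - \<epsilon>) * a * z \<le> k * y - V * (real D + 1)" unfolding ky by linarith
      then show ?thesis by (simp add: a_def z_def V_def mult.assoc)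
    qed
    have "Q n ({..<n}, {e \<in> [{..<n}]\<^bsup>2\<^esup>. X e})" if X: "good X" for X
    proof -
      obtain j where j: "j < n div K" "\<forall>e\<in>edges \<Gamma>. X ((\<lambda>a. a + j * K) ` e)" using X unfolding good_def by blast
      have "\<exists>G'. subgraph G' ({..<n}, {e \<in> [{..<n}]\<^bsup>2\<^esup>. X e}) \<and> free_of H G' \<and>
         chromatic_number \<Gamma> \<le> chromatic_number G' \<and> k * y - card (verts \<Gamma>) * (real D + 1) \<le> min_degree G'"
        by (rule random_graph_good[OF _ H noatt \<Gamma> K(1) sparse j(1)])
           (use n j(2) X in \<open>auto simp: good_def\<close>)
      then show ?thesis unfolding Q_def using deg_bound order_trans by blast
    qed
    then have "{X. good X} \<subseteq> (\<lambda>X. ({..<n}, {e \<in> [{..<n}]\<^bsup>2\<^esup>. X e})) -` {G. Q n G}" by auto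
    then have "measure_pmf.prob M {X. good X} \<le> measure_pmf.prob (random_graph n (p n)) {G. Q n G}"
      unfolding random_graph_def measure_map_pmf M_def
      by (rule measure_pmf.finite_measure_mono) simp
    moreover have "measure_pmf.prob M {X. \<not> good X} = 1 - measure_pmf.prob M {X. good X}"
      using measure_pmf.prob_compl[of "{X. good X}" M] by (simp add: Compl_eq_Diff_UNIV[symmetric] Collect_neg_eq)
    ultimately show ?case using bad by linarith
  qed
  have "(\<lambda>n. measure_pmf.prob (random_graph n (p n)) {G. Q n G}) \<longlonglongrightarrow> 1"
  proof (rule tendsto_sandwich[OF lower])
    show "(\<lambda>n. 1 - f n) \<longlonglongrightarrow> 1" using tendsto_diff[OF tendsto_const[of 1] \<open>f \<longlonglongrightarrow> 0\<close>] by simp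
  qed (auto intro: measure_pmf.prob_le_1)
  then show ?thesis unfolding asymptotically_almost_surely_def Q_def .
qed

lemma asymptotically_almost_surely_mono:
  assumes "asymptotically_almost_surely M P" "\<And>n x. P n x \<Longrightarrow> Q n x"
  shows "asymptotically_almost_surely M Q"
  unfolding asymptotically_almost_surely_def
proof (rule tendsto_sandwich)
  show "(\<lambda>n. measure_pmf.prob (M n) {x. P n x}) \<longlonglongrightarrow> 1"
    using assms(1) by (simp add: asymptotically_almost_surely_def)
  show "\<forall>\<^sub>F n in sequentially. measure_pmf.prob (M n) {x. P n x} \<le> measure_pmf.prob (M n) {x. Q n x}"
    by (intro always_eventually allI measure_pmf.finite_measure_mono) (use assms(2) in auto)
qed (auto intro: measure_pmf.prob_le_1)

theorem theorem8p6:
  fixes r C :: nat and H :: "'a graph"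
  assumes "r \<ge> 3"
    and "fin_graph H"
    and "chromatic_number H = r"
    and "chromatic_threshold H \<ge> (2 * real r - 5) / (2 * real r - 3)"
  shows "\<exists>\<epsilon>\<^sub>0 > (0::real). \<forall>\<epsilon>. 0 < \<epsilon> \<and> \<epsilon> < \<epsilon>\<^sub>0 \<longrightarrow>
    (\<forall>p :: nat \<Rightarrow> real.
      (\<forall>\<^sub>F n in sequentially. real n powr (- \<epsilon>) < p n \<and> p n < \<epsilon>\<^sup>2) \<longrightarrow>
      asymptotically_almost_surely (\<lambda>n. random_graph n (p n))
        (\<lambda>n G. \<exists>G'. subgraph G' G \<and> free_of H G' \<and> chromatic_number G' \<ge> C \<and>
          real (min_degree G') \<ge> (1 - \<epsilon>) * ((real r - 2) / (real r - 1)) * p n * real n))"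
proof -
  define k where "k = r - 2"
  have k: "k \<ge> 1" "real k = real r - 2" "real k + 1 = real r - 1" using assms(1) by (auto simp: k_def)
  have kr: "real k / (real k + 1) = (real r - 2) / (real r - 1)" by (simp only: k(3)) (simp only: k(2))
  \<comment> \<open>The lower bound on the threshold enters here: it rules out every attachment
    structure on \<open>H\<close>.\<close>
  have noatt: "\<not> attachment k H S col" for S col
    using chromatic_threshold_attachment[OF assms(1,2), of S col] assms(4) by (auto simp: k_def)
  have "card (verts H) > 0" using assms(2) by (simp add: fin_graph_def card_gt_0_iff)
  \<comment> \<open>\<open>Suc C\<close> because the construction asks for a positive chromatic
    number.\<close>
  then obtain \<Gamma> :: "nat graph" where \<Gamma>: "fin_graph \<Gamma>" "Suc C \<le> chromatic_number \<Gamma>"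
    "\<forall>Y\<subseteq>verts \<Gamma>. card Y \<le> card (verts H) \<longrightarrow> forest_on \<Gamma> Y"
    using ex_sparse_high_chromatic[of "Suc C" "card (verts H)"] by blast
  \<comment> \<open>The sum of the coefficients in the bounds on \<open>\<epsilon>\<close>, so that
    \<open>\<epsilon> * s < 1\<close> implies all three of them at once.\<close>
  define s where "s = 48 * real (card (verts \<Gamma>)) + 2 * real (card (edges \<Gamma>)) + 4"
  have s: "s > 0" by (simp add: s_def add_nonneg_pos)
  show ?thesis
  proof (rule exI[of _ "1 / s"], intro conjI allI impI)
    show "0 < 1 / s" using s by simp
    fix \<epsilon> :: real and p :: "nat \<Rightarrow> real"
    assume \<epsilon>: "0 < \<epsilon> \<and> \<epsilon> < 1 / s"
      and p: "\<forall>\<^sub>F n in sequentially. real n powr (- \<epsilon>) < p n \<and> p n < \<epsilon>\<^sup>2"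
    have "\<epsilon> * s < 1" using \<epsilon> s by (simp add: field_simps)
    moreover have "\<epsilon> * s = 48 * real (card (verts \<Gamma>)) * \<epsilon> + 2 * (\<epsilon> * real (card (edges \<Gamma>))) + 4 * \<epsilon>"
      by (simp add: s_def algebra_simps)
    moreover have "0 \<le> 48 * real (card (verts \<Gamma>)) * \<epsilon>" "0 \<le> \<epsilon> * real (card (edges \<Gamma>))" using \<epsilon> by auto
    ultimately have e: "\<epsilon> \<le> 1 / 4" "\<epsilon> * real (card (edges \<Gamma>)) \<le> 1 / 2" "48 * real (card (verts \<Gamma>)) * \<epsilon> \<le> 1"
      using \<epsilon> by linarith+
    have "asymptotically_almost_surely (\<lambda>n. random_graph n (p n))
        (\<lambda>n G. \<exists>G'. subgraph G' G \<and> free_of H G' \<and> chromatic_number \<Gamma> \<le> chromatic_number G' \<and>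
          (1 - \<epsilon>) * (real k / (real k + 1)) * p n * real n \<le> real (min_degree G'))"
      by (rule aas_free_subgraph[OF k(1) assms(2) noatt \<Gamma>(1) _ _ e p]) (use \<epsilon> \<Gamma>(3) in auto)
    then show "asymptotically_almost_surely (\<lambda>n. random_graph n (p n))
        (\<lambda>n G. \<exists>G'. subgraph G' G \<and> free_of H G' \<and> chromatic_number G' \<ge> C \<and>
          real (min_degree G') \<ge> (1 - \<epsilon>) * ((real r - 2) / (real r - 1)) * p n * real n)"
    proof (rule asymptotically_almost_surely_mono)
      fix n and G :: "nat graph"
      assume "\<exists>G'. subgraph G' G \<and> free_of H G' \<and> chromatic_number \<Gamma> \<le> chromatic_number G' \<and>
          (1 - \<epsilon>) * (real k / (real k + 1)) * p n * real n \<le> real (min_degree G')"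
      then show "\<exists>G'. subgraph G' G \<and> free_of H G' \<and> chromatic_number G' \<ge> C \<and>
          real (min_degree G') \<ge> (1 - \<epsilon>) * ((real r - 2) / (real r - 1)) * p n * real n"
        using \<Gamma>(2) unfolding kr by (meson Suc_leD order_trans)
    qed
  qed
qed

end
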